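(* Let $p$ be a prime and let $G$ be a pro-$p$-group. (i) If $G$ is abelian with $\mathrm{rk}(G)>1$, then $\widehat{\mathrm{d}}(G)\leq \frac{p^2+p-1}{p^3}$, and equality holds if and only if $G/\widehat{Z}(G)\simeq C_p\times C_p$. (ii) If $G$ is nonabelian and $\widehat{Z}(G)\neq Z(G)$, then $\widehat{\mathrm{d}}(G)\leq \frac{p^3+p-1}{p^4}$.
   Context: Conventions: $p$ is a prime, $x^y=y^{-1}xy$, $Z(G)$ is the center of $G$, $C_p$ is the cyclic group of order $p$. A pro-$p$-group is a projective limit $G=\lim_{N\in\mathcal{P}(G)}G/N$, where $\mathcal{P}(G)$ is the set of closed normal subgroups $N$ of $G$ with $G/N$ a finite $p$-group. The rank is $\mathrm{rk}(G)=\sup\{d(H)\mid H \text{ a closed subgroup of } G\}$, where $d(H)$ is the minimal number of topological generators of $H$. For a pro-$p$-group $G$, the complete nonabelian tensor square $G\widehat{\otimes}G$ is the pro-$p$-group topologically generated by symbols $x\widehat{\otimes}y$ ($x,y\in G$) subject to the relations $xy\widehat{\otimes}z=(x^y\widehat{\otimes}z^y)(y\widehat{\otimes}z)$ and $y\widehat{\otimes}tz=(y\widehat{\otimes}z)(y^z\widehat{\otimes}t^z)$ for all $x,y,z,t\in G$; equivalently $G\widehat{\otimes}G=\lim_{(N,M)\in\mathcal{P}(G)\times\mathcal{P}(G)}G/N\otimes G/M$ (projective limit of the ordinary nonabelian tensor products), and $(x,y)\mapsto x\widehat{\otimes}y$ is continuous. Let $\widehat{\nabla}(G)$ be the closed (central)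 subgroup generated by all $x\widehat{\otimes}x$, $x\in G$. The complete nonabelian exterior square is $G\widehat{\wedge}G=(G\widehat{\otimes}G)/\widehat{\nabla}(G)$, and $x\widehat{\wedge}y$ is the image of $x\widehat{\otimes}y$. The complete exterior center is the subgroup $\widehat{Z}(G)=\{g\in G\mid g\widehat{\wedge}y=1\ \text{for all } y\in G\}$. $\mu$ is the unique normalized Haar measure on $G$. The exterior degree is $\widehat{\mathrm{d}}(G)=(\mu\times\mu)(\{(x,y)\in G\times G\mid x\widehat{\wedge}y=1\})$. *)

theory Defs
  imports
    "HOL-Analysis.Analysis"
    "HOL-Algebra.Elementary_Groups"
    "HOL-Library.Extended_Nat"
    "HOL-Computational_Algebra.Primes"
begin

text \<open>A word over \<open>X\<close> is a list of pairs \<open>(x, b)\<close>, where \<open>(x, True)\<close> stands for the letter \<open>x\<close>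
  and \<open>(x, False)\<close> for its formal inverse. A relation \<open>u = v\<close> is a pair \<open>(u, v)\<close> of words.\<close>

type_synonym 'x gword = "('x \<times> bool) list"

definition gwords :: "'x set \<Rightarrow> 'x gword set" where
  "gwords X = lists (X \<times> UNIV)"

inductive pres_eq :: "'x set \<Rightarrow> ('x gword \<times> 'x gword) set \<Rightarrow> 'x gword \<Rightarrow> 'x gword \<Rightarrow> bool"
  for X R where
  refl: "u \<in> gwords X \<Longrightarrow> pres_eq X R u u"
| sym: "pres_eq X R u v \<Longrightarrow> pres_eq X R v u"
| trans: "pres_eq X R u v \<Longrightarrow> pres_eq X R v w \<Longrightarrow> pres_eq X R u w"
| cong: "pres_eq X R u v \<Longrightarrow> a \<in> gwords X \<Longrightarrow> b \<in> gwords X \<Longrightarrow> pres_eq X R (a @ u @ b) (a @ v @ b)"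
| cancel: "x \<in> X \<Longrightarrow> pres_eq X R [(x, s), (x, \<not> s)] []"
| rel: "(u, v) \<in> R \<Longrightarrow> u \<in> gwords X \<Longrightarrow> v \<in> gwords X \<Longrightarrow> pres_eq X R u v"

definition pres_class :: "'x set \<Rightarrow> ('x gword \<times> 'x gword) set \<Rightarrow> 'x gword \<Rightarrow> 'x gword set" where
  "pres_class X R u = {v. pres_eq X R u v}"

definition presented_group :: "'x set \<Rightarrow> ('x gword \<times> 'x gword) set \<Rightarrow> 'x gword set monoid" where
  "presented_group X R =
     \<lparr>carrier = pres_class X R ` gwords X,
      mult = (\<lambda>A B. \<Union>u\<in>A. \<Union>v\<in>B. pres_class X R (u @ v)),
      one = pres_class X R []\<rparr>"

text \<open>\<open>quot_limit G \<N>\<close> is the limit of the groups \<open>G/N\<close>, \<open>N \<in> \<N>\<close>. Elements of \<open>G Mod N\<close> are cosets,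
  and for \<open>N \<subseteq> M\<close> the transition map \<open>G/N \<rightarrow> G/M\<close> is \<open>C \<mapsto> M <#> C\<close>.\<close>

definition quot_limit :: "('a, 'm) monoid_scheme \<Rightarrow> 'a set set \<Rightarrow> ('a set \<Rightarrow> 'a set) monoid" where
  "quot_limit G \<N> =
     \<lparr>carrier = {f \<in> (\<Pi>\<^sub>E N\<in>\<N>. carrier (G Mod N)).
                   \<forall>N\<in>\<N>. \<forall>M\<in>\<N>. N \<subseteq> M \<longrightarrow> f M = M <#>\<^bsub>G\<^esub> f N},
      mult = (\<lambda>f g. \<lambda>N\<in>\<N>. f N \<otimes>\<^bsub>G Mod N\<^esub> g N),
      one = (\<lambda>N\<in>\<N>. \<one>\<^bsub>G Mod N\<^esub>)\<rparr>"

definition quot_limit_topology ::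
  "('a, 'm) monoid_scheme \<Rightarrow> 'a set set \<Rightarrow> ('a set \<Rightarrow> 'a set) topology" where
  "quot_limit_topology G \<N> =
     subtopology (product_topology (\<lambda>N. discrete_topology (carrier (G Mod N))) \<N>)
                 (carrier (quot_limit G \<N>))"

definition to_quot_limit :: "('a, 'm) monoid_scheme \<Rightarrow> 'a set set \<Rightarrow> 'a \<Rightarrow> 'a set \<Rightarrow> 'a set" where
  "to_quot_limit G \<N> g = (\<lambda>N\<in>\<N>. N #>\<^bsub>G\<^esub> g)"

definition topological_group :: "('a, 'm) monoid_scheme \<Rightarrow> 'a topology \<Rightarrow> bool" where
  "topological_group G T \<longleftrightarrow>
     group G \<and> topspace T = carrier G \<and>
     continuous_map (prod_topology T T) T (\<lambda>(x, y). x \<otimes>\<^bsub>G\<^esub> y) \<and>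
     continuous_map T T (\<lambda>x. inv\<^bsub>G\<^esub> x)"

definition finite_p_group :: "nat \<Rightarrow> ('a, 'm) monoid_scheme \<Rightarrow> bool" where
  "finite_p_group p P \<longleftrightarrow> group P \<and> finite (carrier P) \<and> (\<exists>k::nat. order P = p ^ k)"

definition p_quot_kernels :: "nat \<Rightarrow> ('a, 'm) monoid_scheme \<Rightarrow> 'a topology \<Rightarrow> 'a set set" where
  "p_quot_kernels p G T = {N. N \<lhd> G \<and> closedin T N \<and> finite_p_group p (G Mod N)}"

definition pro_p_group :: "nat \<Rightarrow> ('a, 'm) monoid_scheme \<Rightarrow> 'a topology \<Rightarrow> bool" where
  "pro_p_group p G T \<longleftrightarrow>
     topological_group G T \<and>
     (let \<P> = p_quot_kernels p G T in
       to_quot_limit G \<P> \<in> iso G (quot_limit G \<P>) \<and>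
       homeomorphic_map T (quot_limit_topology G \<P>) (to_quot_limit G \<P>))"

definition top_generate :: "('a, 'm) monoid_scheme \<Rightarrow> 'a topology \<Rightarrow> 'a set \<Rightarrow> 'a set" where
  "top_generate G T S = T closure_of (generate G S)"

text \<open>The value is \<open>\<infinity>\<close> (the infimum of the empty set) if \<open>H\<close> is not topologically finitely generated.\<close>

definition top_gen_number :: "('a, 'm) monoid_scheme \<Rightarrow> 'a topology \<Rightarrow> 'a set \<Rightarrow> enat" where
  "top_gen_number G T H = (INF S\<in>{S. S \<subseteq> H \<and> finite S \<and> top_generate G T S = H}. enat (card S))"

definition pro_rank :: "('a, 'm) monoid_scheme \<Rightarrow> 'a topology \<Rightarrow> enat" where
  "pro_rank G T = (SUP H\<in>{H. subgroup H G \<and> closedin T H}. top_gen_number G T H)"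

definition group_center :: "('a, 'm) monoid_scheme \<Rightarrow> 'a set" where
  "group_center G = {z \<in> carrier G. \<forall>x\<in>carrier G. z \<otimes>\<^bsub>G\<^esub> x = x \<otimes>\<^bsub>G\<^esub> z}"

definition conj_by :: "('a, 'm) monoid_scheme \<Rightarrow> 'a \<Rightarrow> 'a \<Rightarrow> 'a" where
  "conj_by G x y = inv\<^bsub>G\<^esub> y \<otimes>\<^bsub>G\<^esub> x \<otimes>\<^bsub>G\<^esub> y"

definition tensor_relations ::
  "('a, 'm) monoid_scheme \<Rightarrow> (('a \<times> 'a) gword \<times> ('a \<times> 'a) gword) set" where
  "tensor_relations G =
     {([((x \<otimes>\<^bsub>G\<^esub> y, z), True)], [((conj_by G x y, conj_by G z y), True), ((y, z), True)]) | x y z.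
        x \<in> carrier G \<and> y \<in> carrier G \<and> z \<in> carrier G} \<union>
     {([((y, t \<otimes>\<^bsub>G\<^esub> z), True)], [((y, z), True), ((conj_by G y z, conj_by G t z), True)]) | y z t.
        y \<in> carrier G \<and> z \<in> carrier G \<and> t \<in> carrier G}"

definition tensor_square :: "('a, 'm) monoid_scheme \<Rightarrow> ('a \<times> 'a) gword set monoid" where
  "tensor_square G = presented_group (carrier G \<times> carrier G) (tensor_relations G)"

definition tensor :: "('a, 'm) monoid_scheme \<Rightarrow> 'a \<Rightarrow> 'a \<Rightarrow> ('a \<times> 'a) gword set" where
  "tensor G x y = pres_class (carrier G \<times> carrier G) (tensor_relations G) [((x, y), True)]"

text \<open>The pro-\<open>p\<close>-group topologically generated by the symbols \<open>x \<otimes> y\<close> subject to the tensor relations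
  is the completion of the abstract group with this presentation. As the symbol has to be
  a continuous function of \<open>(x, y)\<close>, the completion runs over those finite \<open>p\<close>-quotients \<open>(G \<otimes> G)/K\<close>
  in which the image of \<open>x \<otimes> y\<close> depends continuously on \<open>(x, y)\<close>; these are the finite quotients of the
  groups \<open>G/N \<otimes> G/N\<close> for \<open>N\<close> in \<open>p_quot_kernels p G T\<close>.\<close>

definition tensor_kernels ::
  "nat \<Rightarrow> ('a, 'm) monoid_scheme \<Rightarrow> 'a topology \<Rightarrow> ('a \<times> 'a) gword set set set" where
  "tensor_kernels p G T =
     {K. K \<lhd> tensor_square G \<and> finite_p_group p (tensor_square G Mod K) \<and>
         continuous_map (prod_topology T T)
           (discrete_topology (carrier (tensor_square G Mod K)))
           (\<lambda>(x, y). K #>\<^bsub>tensor_square G\<^esub> tensor G x y)}"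

definition ctensor_square where
  "ctensor_square p G T = quot_limit (tensor_square G) (tensor_kernels p G T)"

definition ctensor_topology where
  "ctensor_topology p G T = quot_limit_topology (tensor_square G) (tensor_kernels p G T)"

definition ctensor where
  "ctensor p G T x y = to_quot_limit (tensor_square G) (tensor_kernels p G T) (tensor G x y)"

definition cnabla where
  "cnabla p G T =
     top_generate (ctensor_square p G T) (ctensor_topology p G T) {ctensor p G T x x | x. x \<in> carrier G}"

definition cext_square where
  "cext_square p G T = ctensor_square p G T Mod cnabla p G T"

definition cwedge where
  "cwedge p G T x y = cnabla p G T #>\<^bsub>ctensor_square p G T\<^esub> ctensor p G T x y"

definition cext_center :: "nat \<Rightarrow> ('a, 'm) monoid_scheme \<Rightarrow> 'a topology \<Rightarrow> 'a set" where
  "cext_center p G T =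
     {g \<in> carrier G. \<forall>y\<in>carrier G. cwedge p G T g y = \<one>\<^bsub>cext_square p G T\<^esub>}"

text \<open>Without second countability a Borel probability measure invariant under translations need not be
  determined uniquely, so regularity is part of the definition. On a compact group left Haar measure
  is also right invariant.\<close>

definition normalized_haar :: "('a, 'm) monoid_scheme \<Rightarrow> 'a topology \<Rightarrow> 'a measure \<Rightarrow> bool" where
  "normalized_haar G T \<mu> \<longleftrightarrow>
     space \<mu> = carrier G \<and>
     sets \<mu> = sigma_sets (carrier G) {U. openin T U} \<and>
     emeasure \<mu> (carrier G) = 1 \<and>
     (\<forall>g\<in>carrier G. \<forall>A\<in>sets \<mu>. emeasure \<mu> (g <#\<^bsub>G\<^esub> A) = emeasure \<mu> A) \<and>
     (\<forall>A\<in>sets \<mu>. emeasure \<mu> A = (INF U\<in>{U. openin T U \<and> A \<subseteq> U}. emeasure \<mu> U)) \<and>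
     (\<forall>U. openin T U \<longrightarrow> emeasure \<mu> U = (SUP K\<in>{K. compactin T K \<and> closedin T K \<and> K \<subseteq> U}. emeasure \<mu> K))"

text \<open>If \<open>G\<close> is not second countable, closed subsets of \<open>G \<times> G\<close> need not belong to the product of
  the two Borel \<open>\<sigma>\<close>-algebras, and \<open>measure\<close> is \<open>0\<close> on nonmeasurable sets. By completion regularity of
  Haar measure (Kakutani, Kodaira) all Borel subsets of \<open>G \<times> G\<close> are measurable for the completion of
  the product measure, which agrees on them with the Haar measure of \<open>G \<times> G\<close>.\<close>

definition ext_degree :: "nat \<Rightarrow> ('a, 'm) monoid_scheme \<Rightarrow> 'a topology \<Rightarrow> 'a measure \<Rightarrow> real" where
  "ext_degree p G T \<mu> =
     measure (completion (\<mu> \<Otimes>\<^sub>M \<mu>))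
       {(x, y). x \<in> carrier G \<and> y \<in> carrier G \<and> cwedge p G T x y = \<one>\<^bsub>cext_square p G T\<^esub>}"

end

theory Submission
  imports Defs "HOL-Algebra.Multiplicative_Group"
begin

text \<open>
  Call \<open>x\<close> and \<open>y\<close> orthogonal if \<open>x \<and> y = 1\<close> in the complete exterior square. The elements orthogonal to
  a given \<open>x\<close> form a subgroup, and the exterior degree is the integral over \<open>x\<close> of its measure. This
  measure is \<open>1\<close> on the exterior center \<open>Z\<close> and at most \<open>1/p\<close> elsewhere, so that the degree is at most
  \<open>\<mu>(Z) + (1 - \<mu>(Z))/p\<close>. If \<open>Z\<close> is not the whole group then \<open>\<mu>(Z) \<le> 1/p\<^sup>2\<close>: for \<open>x\<close> outside \<open>Z\<close> the
  subgroup orthogonal to \<open>x\<close> lies strictly between \<open>Z\<close> and \<open>G\<close>, as it contains \<open>x\<close>, and indices are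
  powers of \<open>p\<close>. This is the bound for abelian groups. In the nonabelian case the same argument,
  applied to the commutator pairing, shows that \<open>Z(G)\<close> has index at least \<open>p\<^sup>2\<close>, and \<open>Z\<close> is by
  hypothesis properly contained in \<open>Z(G)\<close>, which gives \<open>\<mu>(Z) \<le> 1/p\<^sup>3\<close>.

  Neither \<open>Z\<close> nor the relation of orthogonality need be open, so the argument is carried out on open
  approximations. A continuous alternating pairing \<open>b\<close> from \<open>G \<times> G\<close> to a finite \<open>p\<close>-group factors through
  the complete exterior square, and conversely these pairings detect whether \<open>x \<and> y\<close> is trivial
  (\<open>wedge_trivial_imp\<close> and \<open>detecting_pairing\<close>). Each pairing yields a relation that contains
  orthogonality and whose radical, the set of elements related to everything, is an open
  normal subgroup (\<open>exterior_relation\<close>). Such a relation is a finite union of rectangles of cosets, for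
  which the integral is elementary; monotonicity gives the bounds for the exterior degree. These
  relations are closed under conjunction, and orthogonality is their intersection. If the degree attains
  the bound for abelian groups, or if \<open>G/Z\<close> has order \<open>p\<^sup>2\<close>, then all proper radicals have measure
  exactly \<open>1/p\<^sup>2\<close>; being directed they all coincide, and orthogonality is itself one of the relations
  (\<open>minimal_index\<close>).

  It remains to find one nontrivial alternating pairing on an abelian group of rank at least \<open>2\<close>. Two
  nontrivial characters \<open>f\<close> and \<open>f'\<close> with values in \<open>\<int>/p\<close> and distinct kernels give the pairing \<open>f x * f' y - f' x * f y\<close>.
  If all nontrivial characters have the same kernel, an element outside of this kernel generates every
  finite quotient, and then every closed subgroup is topologically generated by one element.
\<close>

section \<open>Finite \<open>p\<close>-groups as quotients\<close>

lemma finite_p_group_subgroup: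
  assumes "prime p" "finite_p_group p P" "subgroup H P"
  shows "finite_p_group p (P\<lparr>carrier := H\<rparr>)"
proof -
  interpret group P using assms by (simp add: finite_p_group_def)
  obtain k where k: "order P = p ^ k" "finite (carrier P)" using assms by (auto simp: finite_p_group_def)
  have "card H dvd p ^ k"
    using lagrange[OF assms(3)] k by (metis dvd_triv_right)
  then obtain j where "card H = p ^ j"
    using divides_primepow_nat[OF assms(1)] by blast
  moreover have "finite H" using k assms(3) finite_subset subgroup.subset by blast
  ultimately show ?thesis
    using subgroup_imp_group[OF assms(3)] by (auto simp: finite_p_group_def order_def)
qed

lemma finite_p_group_iso:
  assumes "finite_p_group p P" "P \<cong> Q" "group Q"
  shows "finite_p_group p Q"
proof -
  obtain h where "h \<in> iso P Q" using assms by (auto simp: is_iso_def)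
  hence "bij_betw h (carrier P) (carrier Q)" by (simp add: iso_def)
  hence "finite (carrier Q)" "order Q = order P"
    using assms(1) by (auto simp: finite_p_group_def order_def bij_betw_finite bij_betw_same_card)
  thus ?thesis using assms by (auto simp: finite_p_group_def)
qed

lemma finite_p_group_DirProd:
  assumes "finite_p_group p P" "finite_p_group p Q"
  shows "finite_p_group p (P \<times>\<times> Q)"
proof -
  obtain j k where "order P = p ^ j" "order Q = p ^ k"
    using assms by (auto simp: finite_p_group_def)
  hence "order (P \<times>\<times> Q) = p ^ (j + k)"
    by (simp add: order_def power_add card_cartesian_product)
  thus ?thesis using assms
    by (auto simp: finite_p_group_def DirProd_group simp del: power_add)
qed

lemma (in group) rcos_eq_iff:
  assumes "subgroup H G" "x \<in> carrier G" "y \<in> carrier G"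
  shows "H #> x = H #> y \<longleftrightarrow> x \<otimes> inv y \<in> H"
  using assms rcos_self[of x H] repr_independence[of x H y] subgroup.rcos_module[OF assms(1) is_group]
  by metis

lemma (in group) rcos_eq_self_iff:
  assumes "subgroup H G" "x \<in> carrier G"
  shows "H #> x = H \<longleftrightarrow> x \<in> H"
  using assms coset_join1[of H x] coset_join2[of x H] by blast

text \<open>By the first isomorphism theorem the quotient is isomorphic to a subgroup of the target.\<close>

lemma finite_p_group_Mod_kernel:
  assumes "prime p" "group G" "finite_p_group p P" "h \<in> hom G P"
  shows "finite_p_group p (G Mod kernel G P h)"
proof -
  interpret group_hom G P h
    using assms by (simp add: group_hom_def group_hom_axioms_def finite_p_group_def)
  let ?I = "P\<lparr>carrier := h ` carrier G\<rparr>"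
  have sub: "subgroup (h ` carrier G) P" by (rule img_is_subgroup)
  have "group ?I" using sub H.subgroup_imp_group by blast
  then interpret I: group_hom G ?I h
    using assms(2,4) by (auto simp: group_hom_def group_hom_axioms_def hom_def)
  have ker: "kernel G ?I h = kernel G P h" by (simp add: kernel_def)
  have "G Mod kernel G P h \<cong> ?I" using I.FactGroup_iso ker by simp
  hence "?I \<cong> G Mod kernel G P h"
    using normal.factorgroup_is_group[OF normal_kernel] group.iso_sym by blast
  thus ?thesis
    using finite_p_group_iso finite_p_group_subgroup[OF assms(1,3) sub]
      normal.factorgroup_is_group[OF normal_kernel] by blast
qed

lemma finite_p_group_epi:
  assumes "prime p" "finite_p_group p P" "group Q" "h \<in> hom P Q" "h ` carrier P = carrier Q"
  shows "finite_p_group p Q"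
proof -
  interpret group_hom P Q h
    using assms by (simp add: group_hom_def group_hom_axioms_def finite_p_group_def)
  let ?K = "kernel P Q h"
  obtain k where k: "order P = p ^ k" "finite (carrier P)" using assms by (auto simp: finite_p_group_def)
  have "card (rcosets\<^bsub>P\<^esub> ?K) dvd p ^ k"
    using G.lagrange[OF subgroup_kernel] k by (metis dvd_triv_left)
  then obtain j where "order (P Mod ?K) = p ^ j"
    using divides_primepow_nat[OF assms(1)] by (auto simp: order_def FactGroup_def)
  moreover have "finite (carrier (P Mod ?K))"
    using k by (simp add: carrier_FactGroup)
  ultimately have "finite_p_group p (P Mod ?K)"
    using normal.factorgroup_is_group[OF normal_kernel] by (auto simp: finite_p_group_def)
  thus ?thesis using finite_p_group_iso FactGroup_iso assms by blast
qed

lemma rcos_trans: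
  fixes G (structure)
  assumes "group G" "N \<subseteq> M" "subgroup N G" "subgroup M G" "x \<in> carrier G"
  shows "M <#> (N #> x) = M #> x"
proof -
  interpret group G by fact
  have "M <#> N = M"
  proof
    show "M <#> N \<subseteq> M"
      using assms by (auto simp: set_mult_def dest: subgroup.m_closed)
    show "M \<subseteq> M <#> N"
      using assms subgroup.one_closed[of N G] subgroup.subset[of M G]
      by (force simp: set_mult_def)
  qed
  thus ?thesis
    using assms setmult_rcos_assoc[of M N x] subgroup.subset by metis
qed

lemma finite_p_group_Mod_mono:
  assumes "prime p" "N \<lhd> G" "M \<lhd> G" "N \<subseteq> M" "finite_p_group p (G Mod N)"
  shows "finite_p_group p (G Mod M)"
proof (rule finite_p_group_epi[OF assms(1,5)])
  interpret N: normal N G by fact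
  interpret M: normal M G by fact
  have *: "M <#>\<^bsub>G\<^esub> (N #>\<^bsub>G\<^esub> x) = M #>\<^bsub>G\<^esub> x" if "x \<in> carrier G" for x
    using rcos_trans[OF N.is_group assms(4) N.subgroup_axioms M.subgroup_axioms that] .
  show "group (G Mod M)" by (rule M.factorgroup_is_group)
  show "(\<lambda>C. M <#>\<^bsub>G\<^esub> C) \<in> hom (G Mod N) (G Mod M)"
    by (auto simp: hom_def carrier_FactGroup * N.rcos_sum M.rcos_sum)
  show "(\<lambda>C. M <#>\<^bsub>G\<^esub> C) ` carrier (G Mod N) = carrier (G Mod M)"
    by (auto simp: carrier_FactGroup * image_iff intro!: bexI)
qed

text \<open>The quotient embeds into the product of the two given quotients.\<close>

lemma finite_p_group_Mod_Int:
  assumes "prime p" "N \<lhd> G" "M \<lhd> G" "finite_p_group p (G Mod N)" "finite_p_group p (G Mod M)"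
  shows "N \<inter> M \<lhd> G" "finite_p_group p (G Mod (N \<inter> M))"
proof -
  interpret N: normal N G by fact
  interpret M: normal M G by fact
  let ?h = "\<lambda>x. (N #>\<^bsub>G\<^esub> x, M #>\<^bsub>G\<^esub> x)"
  let ?P = "(G Mod N) \<times>\<times> (G Mod M)"
  have hom: "?h \<in> hom G ?P"
    by (auto simp: hom_def carrier_FactGroup N.rcos_sum M.rcos_sum)
  have "kernel G ?P ?h = N \<inter> M"
    using N.rcos_eq_self_iff[OF N.subgroup_axioms] N.rcos_eq_self_iff[OF M.subgroup_axioms] N.subset
    by (auto simp: kernel_def)
  moreover have "finite_p_group p (G Mod kernel G ?P ?h)"
    by (rule finite_p_group_Mod_kernel[OF assms(1) N.is_group finite_p_group_DirProd[OF assms(4,5)] hom])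
  moreover have "kernel G ?P ?h \<lhd> G"
  proof (rule group_hom.normal_kernel)
    show "group_hom G ?P ?h"
      using hom DirProd_group[OF N.factorgroup_is_group M.factorgroup_is_group] N.is_group
      by (simp add: group_hom_def group_hom_axioms_def)
  qed
  ultimately show "N \<inter> M \<lhd> G" "finite_p_group p (G Mod (N \<inter> M))" by simp_all
qed

lemma finite_p_group_Mod_self:
  assumes "group G"
  shows "carrier G \<lhd> G" "finite_p_group p (G Mod carrier G)"
proof -
  interpret group G by fact
  show n: "carrier G \<lhd> G" by (rule normal_self)
  have "carrier (G Mod carrier G) = {carrier G}"
    using coset_join2[OF _ subgroup_self] by (force simp: carrier_FactGroup)
  hence "order (G Mod carrier G) = p ^ 0" "finite (carrier (G Mod carrier G))" by (simp_all add: order_def)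
  thus "finite_p_group p (G Mod carrier G)"
    using normal.factorgroup_is_group[OF n] unfolding finite_p_group_def by blast
qed

section \<open>Presentations and the tensor square\<close>

lemma gwords_simps [simp]:
  "[] \<in> gwords X" "a # u \<in> gwords X \<longleftrightarrow> fst a \<in> X \<and> u \<in> gwords X"
  "u @ v \<in> gwords X \<longleftrightarrow> u \<in> gwords X \<and> v \<in> gwords X"
  by (auto simp: gwords_def mem_Times_iff)

lemma pres_eq_gwords: "pres_eq X R u v \<Longrightarrow> u \<in> gwords X \<and> v \<in> gwords X"
  by (induction rule: pres_eq.induct) auto

lemma pres_class_eq_iff:
  assumes "u \<in> gwords X"
  shows "pres_class X R u = pres_class X R v \<longleftrightarrow> pres_eq X R u v"
  using assms pres_eq.refl pres_eq.sym pres_eq.trans unfolding pres_class_def by blast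

lemma pres_eq_append:
  assumes "pres_eq X R u u'" "pres_eq X R v v'"
  shows "pres_eq X R (u @ v) (u' @ v')"
proof -
  have "pres_eq X R ([] @ u @ v) ([] @ u' @ v)"
    using assms pres_eq_gwords by (intro pres_eq.cong) (force+)
  moreover have "pres_eq X R (u' @ v @ []) (u' @ v' @ [])"
    using assms pres_eq_gwords by (intro pres_eq.cong) (force+)
  ultimately show ?thesis using pres_eq.trans by fastforce
qed

lemma pres_class_mult:
  assumes "u \<in> gwords X" "v \<in> gwords X"
  shows "pres_class X R u \<otimes>\<^bsub>presented_group X R\<^esub> pres_class X R v = pres_class X R (u @ v)"
proof -
  have "pres_class X R (u' @ v') = pres_class X R (u @ v)"
    if "u' \<in> pres_class X R u" "v' \<in> pres_class X R v" for u' v'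
  proof -
    have "pres_eq X R (u @ v) (u' @ v')" using that pres_eq_append by (auto simp: pres_class_def)
    thus ?thesis using assms pres_class_eq_iff[of "u @ v" X R "u' @ v'"] by simp
  qed
  hence "(\<Union>u'\<in>pres_class X R u. \<Union>v'\<in>pres_class X R v. pres_class X R (u' @ v')) =
      (\<Union>u'\<in>pres_class X R u. \<Union>v'\<in>pres_class X R v. pres_class X R (u @ v))"
    by (intro SUP_cong) auto
  moreover have "pres_class X R u \<noteq> {}" "pres_class X R v \<noteq> {}"
    using assms pres_eq.refl unfolding pres_class_def by blast+
  ultimately show ?thesis by (simp add: presented_group_def)
qed

lemma pres_class_one: "\<one>\<^bsub>presented_group X R\<^esub> = pres_class X R []"
  by (simp add: presented_group_def)

lemma carrier_presented_group: "carrier (presented_group X R) = pres_class X R ` gwords X"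
  by (simp add: presented_group_def)

lemma group_presented_group: "group (presented_group X R)"
proof (rule groupI)
  let ?G = "presented_group X R"
  show "\<exists>B\<in>carrier ?G. B \<otimes>\<^bsub>?G\<^esub> A = \<one>\<^bsub>?G\<^esub>" if "A \<in> carrier ?G" for A
  proof -
    obtain u where u: "u \<in> gwords X" "A = pres_class X R u"
      using \<open>A \<in> carrier ?G\<close> by (auto simp: carrier_presented_group)
    have "\<exists>v\<in>gwords X. pres_eq X R (v @ u) []" using u(1)
    proof (induction u)
      case Nil
      show ?case using pres_eq.refl[of "[]" X R] by (intro bexI[of _ "[]"]) auto
    next
      case (Cons a u)
      then obtain v where v: "v \<in> gwords X" "pres_eq X R (v @ u) []" by auto
      obtain x s where a: "a = (x, s)" "x \<in> X" using Cons.prems by (cases a) auto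
      have "pres_eq X R (v @ [(x, \<not> s), (x, \<not> \<not> s)] @ u) (v @ [] @ u)"
        using v Cons.prems by (intro pres_eq.cong pres_eq.cancel a) auto
      hence "pres_eq X R ((v @ [(x, \<not> s)]) @ a # u) []"
        using v(2) pres_eq.trans a by fastforce
      thus ?case using v(1) a by (intro bexI[of _ "v @ [(x, \<not> s)]"]) auto
    qed
    then obtain v where "v \<in> gwords X" "pres_eq X R (v @ u) []" by blast
    thus ?thesis using u
      by (intro bexI[of _ "pres_class X R v"])
        (auto simp: pres_class_mult pres_class_one carrier_presented_group pres_class_eq_iff)
  qed
qed (auto simp: carrier_presented_group pres_class_mult pres_class_one)

lemma inv_pres_class_letter:
  assumes "x \<in> X"
  shows "inv\<^bsub>presented_group X R\<^esub> (pres_class X R [(x, s)]) = pres_class X R [(x, \<not> s)]"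
proof (rule group.inv_equality[OF group_presented_group])
  have "pres_eq X R [(x, \<not> s), (x, \<not> \<not> s)] []" using assms by (rule pres_eq.cancel)
  thus "pres_class X R [(x, \<not> s)] \<otimes>\<^bsub>presented_group X R\<^esub> pres_class X R [(x, s)] = \<one>\<^bsub>presented_group X R\<^esub>"
    using assms by (simp add: pres_class_mult pres_class_one pres_class_eq_iff)
qed (use assms in \<open>auto simp: carrier_presented_group\<close>)

lemma presented_group_generated:
  "carrier (presented_group X R) =
     generate (presented_group X R) ((\<lambda>x. pres_class X R [(x, True)]) ` X)"
    (is "carrier ?G = generate ?G ?S")
proof
  interpret G: group ?G by (rule group_presented_group)
  have S: "?S \<subseteq> carrier ?G" by (auto simp: carrier_presented_group)
  have letter: "pres_class X R [(x, s)] \<in> generate ?G ?S" if "x \<in> X" for x s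
  proof (cases s)
    case True thus ?thesis using that by (auto intro: generate.incl)
  next
    case False thus ?thesis
      using generate.inv[of "pres_class X R [(x, True)]" ?S ?G] that inv_pres_class_letter[of x X R True] by auto
  qed
  have "pres_class X R u \<in> generate ?G ?S" if "u \<in> gwords X" for u using that
  proof (induction u)
    case Nil show ?case using generate.one[of ?G ?S] by (simp add: pres_class_one)
  next
    case (Cons a u)
    thus ?case
      using generate.eng[OF letter Cons.IH, of "fst a" "snd a"] by (simp add: pres_class_mult)
  qed
  thus "carrier ?G \<subseteq> generate ?G ?S" by (auto simp: carrier_presented_group)
  show "generate ?G ?S \<subseteq> carrier ?G" using G.generate_incl[OF S] .
qed

definition word_value :: "('b, 'n) monoid_scheme \<Rightarrow> ('x \<Rightarrow> 'b) \<Rightarrow> 'x gword \<Rightarrow> 'b" where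
  "word_value P f w = foldr (\<lambda>(x, s) b. (if s then f x else inv\<^bsub>P\<^esub> f x) \<otimes>\<^bsub>P\<^esub> b) w \<one>\<^bsub>P\<^esub>"

lemma word_value_simps [simp]:
  "word_value P f [] = \<one>\<^bsub>P\<^esub>"
  "word_value P f ((x, s) # w) = (if s then f x else inv\<^bsub>P\<^esub> f x) \<otimes>\<^bsub>P\<^esub> word_value P f w"
  by (simp_all add: word_value_def)

lemma presented_group_universal:
  assumes "group P" and f: "\<And>x. x \<in> X \<Longrightarrow> f x \<in> carrier P"
    and R: "\<And>u v. (u, v) \<in> R \<Longrightarrow> u \<in> gwords X \<Longrightarrow> v \<in> gwords X \<Longrightarrow> word_value P f u = word_value P f v"
  obtains \<phi> where "\<phi> \<in> hom (presented_group X R) P"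
    "\<And>x. x \<in> X \<Longrightarrow> \<phi> (pres_class X R [(x, True)]) = f x"
proof -
  interpret P: group P by fact
  let ?e = "word_value P f"
  have closed [simp]: "?e w \<in> carrier P" if "w \<in> gwords X" for w
    using that by (induction w) (auto simp: f)
  have app: "?e (u @ v) = ?e u \<otimes>\<^bsub>P\<^esub> ?e v" if "u \<in> gwords X" "v \<in> gwords X" for u v
    using that by (induction u) (auto simp: f P.m_assoc)
  have eq: "?e u = ?e v" if "pres_eq X R u v" for u v
    using that
  proof (induction rule: pres_eq.induct)
    case (cong u v a b)
    thus ?case using pres_eq_gwords[OF cong.hyps(1)] by (simp add: app)
  next
    case (cancel x s)
    thus ?case using f by (cases s) auto
  qed (use R in auto)
  let ?\<phi> = "\<lambda>C. the_elem (?e ` C)"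
  have val: "?\<phi> (pres_class X R u) = ?e u" if "u \<in> gwords X" for u
  proof -
    have "?e ` pres_class X R u = {?e u}"
      using eq pres_eq.refl[OF that] by (auto simp: pres_class_def)
    thus ?thesis by simp
  qed
  show ?thesis
  proof
    show "?\<phi> \<in> hom (presented_group X R) P"
      by (auto simp: hom_def carrier_presented_group pres_class_mult val app)
    show "?\<phi> (pres_class X R [(x, True)]) = f x" if "x \<in> X" for x
      using that f by (simp add: val)
  qed
qed

context group
begin

lemma mult_inv_cancel:
  assumes "x \<in> carrier G" "y \<in> carrier G"
  shows "x \<otimes> (inv x \<otimes> y) = y" "inv x \<otimes> (x \<otimes> y) = y"
  using assms by (simp_all flip: m_assoc)

lemma conj_by_simps [simp]:
  assumes "x \<in> carrier G" "y \<in> carrier G"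
  shows conj_by_closed: "conj_by G x y \<in> carrier G"
    and "conj_by G x \<one> = x" "conj_by G \<one> x = \<one>" "conj_by G x x = x"
  using assms by (auto simp: conj_by_def)

lemma conj_by_mult:
  assumes "x \<in> carrier G" "y \<in> carrier G" "z \<in> carrier G"
  shows "conj_by G (x \<otimes> y) z = conj_by G x z \<otimes> conj_by G y z"
  using assms by (simp add: conj_by_def m_assoc mult_inv_cancel)

lemma conj_by_conj_by:
  assumes "x \<in> carrier G" "y \<in> carrier G" "z \<in> carrier G"
  shows "conj_by G (conj_by G x y) z = conj_by G x (y \<otimes> z)"
  using assms by (simp add: conj_by_def m_assoc inv_mult_group)

lemma conj_by_swap:
  assumes "y \<in> carrier G" "z \<in> carrier G"
  shows "y \<otimes> conj_by G z y = z \<otimes> y"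
  using assms by (simp add: conj_by_def m_assoc mult_inv_cancel)

lemma conj_by_inv:
  assumes "x \<in> carrier G" "y \<in> carrier G"
  shows "conj_by G (inv x) y = inv (conj_by G x y)"
  using assms by (simp add: conj_by_def m_assoc inv_mult_group)

end

text \<open>The maps that satisfy the tensor relations; by the universal property they are the maps that
  factor through a homomorphism defined on the tensor square.\<close>

definition tensor_pairing ::
  "('a, 'm) monoid_scheme \<Rightarrow> ('b, 'n) monoid_scheme \<Rightarrow> ('a \<Rightarrow> 'a \<Rightarrow> 'b) \<Rightarrow> bool" where
  "tensor_pairing G P b \<longleftrightarrow>
     (\<forall>x\<in>carrier G. \<forall>y\<in>carrier G. b x y \<in> carrier P) \<and>
     (\<forall>x\<in>carrier G. \<forall>y\<in>carrier G. \<forall>z\<in>carrier G.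
        b (x \<otimes>\<^bsub>G\<^esub> y) z = b (conj_by G x y) (conj_by G z y) \<otimes>\<^bsub>P\<^esub> b y z) \<and>
     (\<forall>y\<in>carrier G. \<forall>z\<in>carrier G. \<forall>t\<in>carrier G.
        b y (t \<otimes>\<^bsub>G\<^esub> z) = b y z \<otimes>\<^bsub>P\<^esub> b (conj_by G y z) (conj_by G t z))"

lemma group_tensor_square: "group (tensor_square G)"
  by (simp add: tensor_square_def group_presented_group)

lemma tensor_pairing_tensor:
  fixes G (structure)
  assumes "group G"
  shows "tensor_pairing G (tensor_square G) (tensor G)"
proof -
  interpret group G by fact
  let ?X = "carrier G \<times> carrier G" and ?R = "tensor_relations G"
  have rel: "pres_class ?X ?R u = pres_class ?X ?R v"
    if "(u, v) \<in> ?R" "u \<in> gwords ?X" "v \<in> gwords ?X" for u v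
    using that pres_eq.rel pres_class_eq_iff by blast
  show ?thesis
    unfolding tensor_pairing_def
  proof (intro conjI ballI)
    fix x y z assume xyz: "x \<in> carrier G" "y \<in> carrier G" "z \<in> carrier G"
    show "tensor G x y \<in> carrier (tensor_square G)"
      using xyz by (auto simp: tensor_def tensor_square_def carrier_presented_group)
    have "pres_class ?X ?R [((x \<otimes> y, z), True)] =
        pres_class ?X ?R [((conj_by G x y, conj_by G z y), True), ((y, z), True)]"
      using xyz by (intro rel) (auto simp: tensor_relations_def)
    thus "tensor G (x \<otimes> y) z =
        tensor G (conj_by G x y) (conj_by G z y) \<otimes>\<^bsub>tensor_square G\<^esub> tensor G y z"
      using xyz by (simp add: tensor_def tensor_square_def pres_class_mult)
    have "pres_class ?X ?R [((x, z \<otimes> y), True)] =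
        pres_class ?X ?R [((x, y), True), ((conj_by G x y, conj_by G z y), True)]"
      using xyz by (intro rel) (auto simp: tensor_relations_def)
    thus "tensor G x (z \<otimes> y) =
        tensor G x y \<otimes>\<^bsub>tensor_square G\<^esub> tensor G (conj_by G x y) (conj_by G z y)"
      using xyz by (simp add: tensor_def tensor_square_def pres_class_mult)
  qed
qed

lemma tensor_closed:
  "group G \<Longrightarrow> x \<in> carrier G \<Longrightarrow> y \<in> carrier G \<Longrightarrow> tensor G x y \<in> carrier (tensor_square G)"
  using tensor_pairing_tensor[of G] by (simp add: tensor_pairing_def)

lemma tensor_square_universal:
  assumes "group G" "group P" "tensor_pairing G P b"
  obtains \<phi> where "\<phi> \<in> hom (tensor_square G) P"
    "\<And>x y. x \<in> carrier G \<Longrightarrow> y \<in> carrier G \<Longrightarrow> \<phi> (tensor G x y) = b x y"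
proof -
  interpret G: group G by fact
  interpret P: group P by fact
  let ?f = "\<lambda>(x, y). b x y"
  have closed: "b x y \<in> carrier P" if "x \<in> carrier G" "y \<in> carrier G" for x y
    using assms(3) that by (simp add: tensor_pairing_def)
  obtain \<phi> where "\<phi> \<in> hom (presented_group (carrier G \<times> carrier G) (tensor_relations G)) P"
    "\<And>x. x \<in> carrier G \<times> carrier G \<Longrightarrow>
       \<phi> (pres_class (carrier G \<times> carrier G) (tensor_relations G) [(x, True)]) = ?f x"
  proof (rule presented_group_universal[OF assms(2),
        of "carrier G \<times> carrier G" ?f "tensor_relations G"])
    fix u v assume "(u, v) \<in> tensor_relations G"
    thus "word_value P ?f u = word_value P ?f v"
      using assms(3) by (auto simp: tensor_relations_def tensor_pairing_def)
  qed (use closed in auto)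
  thus ?thesis using that by (force simp: tensor_square_def tensor_def)
qed

lemma tensor_pairing_hom:
  assumes "group G" "tensor_pairing G Q b" "\<phi> \<in> hom Q P"
  shows "tensor_pairing G P (\<lambda>x y. \<phi> (b x y))"
proof -
  interpret G: group G by fact
  show ?thesis
    using assms(2,3) unfolding tensor_pairing_def
    by (simp add: hom_mult[OF assms(3)] hom_in_carrier[OF assms(3)])
qed

lemma tensor_pairing_conj:
  assumes "group G" "tensor_pairing G P b" "w \<in> carrier G"
  shows "tensor_pairing G P (\<lambda>x y. b (conj_by G x w) (conj_by G y w))"
proof -
  interpret G: group G by fact
  show ?thesis
    using assms(2,3) unfolding tensor_pairing_def
    by (simp add: G.conj_by_mult G.conj_by_conj_by G.conj_by_swap)
qed

locale pairing = G: group G + P: group P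
  for G :: "('a, 'm) monoid_scheme" (structure) and P :: "('b, 'n) monoid_scheme" and b +
  assumes pairing: "tensor_pairing G P b"
begin

lemma closed [simp]: "x \<in> carrier G \<Longrightarrow> y \<in> carrier G \<Longrightarrow> b x y \<in> carrier P"
  using pairing by (simp add: tensor_pairing_def)

lemma mult_left:
  "x \<in> carrier G \<Longrightarrow> y \<in> carrier G \<Longrightarrow> z \<in> carrier G \<Longrightarrow>
     b (x \<otimes> y) z = b (conj_by G x y) (conj_by G z y) \<otimes>\<^bsub>P\<^esub> b y z"
  using pairing by (simp add: tensor_pairing_def)

lemma mult_right:
  "y \<in> carrier G \<Longrightarrow> z \<in> carrier G \<Longrightarrow> t \<in> carrier G \<Longrightarrow>
     b y (t \<otimes> z) = b y z \<otimes>\<^bsub>P\<^esub> b (conj_by G y z) (conj_by G t z)"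
  using pairing by (simp add: tensor_pairing_def)

lemma one_left [simp]: "y \<in> carrier G \<Longrightarrow> b \<one> y = \<one>\<^bsub>P\<^esub>"
  using mult_left[of \<one> \<one> y] P.r_cancel_one[of "b \<one> y" "b \<one> y"] by simp

lemma one_right [simp]: "x \<in> carrier G \<Longrightarrow> b x \<one> = \<one>\<^bsub>P\<^esub>"
  using mult_right[of x \<one> \<one>] P.r_cancel_one[of "b x \<one>" "b x \<one>"] by simp

text \<open>Conjugation by \<open>b y z\<close> acts on the values of \<open>b\<close> as conjugation of both arguments by a commutator of
  \<open>y\<close> and \<open>z\<close>: expand \<open>b (x y) (t z)\<close> in the two possible orders and cancel the outer factors.\<close>

lemma conj_by_value:
  assumes "x \<in> carrier G" "y \<in> carrier G" "z \<in> carrier G" "t \<in> carrier G"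
  shows "b (conj_by G x (z \<otimes> y)) (conj_by G t (z \<otimes> y)) \<otimes>\<^bsub>P\<^esub> b y z =
         b y z \<otimes>\<^bsub>P\<^esub> b (conj_by G x (y \<otimes> z)) (conj_by G t (y \<otimes> z))"
    (is "?L \<otimes>\<^bsub>P\<^esub> _ = _ \<otimes>\<^bsub>P\<^esub> ?R")
proof -
  let ?a = "b (conj_by G x y) (conj_by G z y)" and ?c = "b (conj_by G y z) (conj_by G t z)"
  have cl: "?a \<in> carrier P" "?c \<in> carrier P" "?L \<in> carrier P" "?R \<in> carrier P" "b y z \<in> carrier P"
    using assms by simp_all
  have "b (x \<otimes> y) (t \<otimes> z) = (?a \<otimes>\<^bsub>P\<^esub> ?L) \<otimes>\<^bsub>P\<^esub> (b y z \<otimes>\<^bsub>P\<^esub> ?c)"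
    using assms
    by (subst mult_left) (simp_all add: mult_right G.conj_by_mult G.conj_by_conj_by G.conj_by_swap)
  moreover have "b (x \<otimes> y) (t \<otimes> z) = (?a \<otimes>\<^bsub>P\<^esub> b y z) \<otimes>\<^bsub>P\<^esub> (?R \<otimes>\<^bsub>P\<^esub> ?c)"
    using assms
    by (subst mult_right) (simp_all add: mult_left G.conj_by_mult G.conj_by_conj_by G.conj_by_swap)
  ultimately have "?a \<otimes>\<^bsub>P\<^esub> ((?L \<otimes>\<^bsub>P\<^esub> b y z) \<otimes>\<^bsub>P\<^esub> ?c) = ?a \<otimes>\<^bsub>P\<^esub> ((b y z \<otimes>\<^bsub>P\<^esub> ?R) \<otimes>\<^bsub>P\<^esub> ?c)"
    using cl by (simp add: P.m_assoc)
  thus ?thesis using cl by (simp add: P.m_closed)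
qed

end

definition nabla :: "('a, 'm) monoid_scheme \<Rightarrow> ('a \<times> 'a) gword set set" where
  "nabla G = generate (tensor_square G) ((\<lambda>x. tensor G x x) ` carrier G)"

lemma tensor_square_generated:
  "carrier (tensor_square G) =
     generate (tensor_square G) ((\<lambda>(x, y). tensor G x y) ` (carrier G \<times> carrier G))"
  using presented_group_generated[of "carrier G \<times> carrier G" "tensor_relations G"]
  by (simp add: tensor_square_def tensor_def case_prod_unfold)

text \<open>By \<open>conj_by_value\<close>, conjugation by a generator of the tensor square or by its inverse permutes the
  symbols \<open>x \<otimes> x\<close>.\<close>

lemma nabla_normal:
  fixes G (structure)
  assumes "group G"
  shows "nabla G \<lhd> tensor_square G"
proof -
  let ?Q = "tensor_square G" and ?D = "(\<lambda>x. tensor G x x) ` carrier G"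
  interpret pairing G ?Q "tensor G"
    using assms group_tensor_square[of G] tensor_pairing_tensor[OF assms]
    by (simp add: pairing_def pairing_axioms_def)
  have D: "?D \<subseteq> carrier ?Q" by auto
  have c1: "\<exists>x\<in>carrier G. a = conj_by G x g" if "a \<in> carrier G" "g \<in> carrier G" for a g
    using that by (intro bexI[of _ "conj_by G a (inv g)"]) (simp_all add: G.conj_by_conj_by)
  have gen: "g \<otimes>\<^bsub>?Q\<^esub> d \<otimes>\<^bsub>?Q\<^esub> inv\<^bsub>?Q\<^esub> g \<in> ?D"
    if "g \<in> generate ?Q ((\<lambda>(x, y). tensor G x y) ` (carrier G \<times> carrier G))" "d \<in> ?D" for g d
    using that
  proof (induction arbitrary: d rule: generate.induct)
    case one thus ?case using D by auto
  next
    case (incl g)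
    then obtain a y z where 1: "d = tensor G a a" "g = tensor G y z"
      "a \<in> carrier G" "y \<in> carrier G" "z \<in> carrier G" by auto
    obtain x where x: "x \<in> carrier G" "a = conj_by G x (y \<otimes> z)" using c1[of a "y \<otimes> z"] 1 by auto
    have "g \<otimes>\<^bsub>?Q\<^esub> d \<otimes>\<^bsub>?Q\<^esub> inv\<^bsub>?Q\<^esub> g = tensor G (conj_by G x (z \<otimes> y)) (conj_by G x (z \<otimes> y))"
      using conj_by_value[of x y z x] 1 x by (simp add: P.inv_solve_right')
    thus ?case using 1 x by auto
  next
    case (inv g)
    then obtain a y z where 1: "d = tensor G a a" "g = tensor G y z"
      "a \<in> carrier G" "y \<in> carrier G" "z \<in> carrier G" by auto
    obtain x where x: "x \<in> carrier G" "a = conj_by G x (z \<otimes> y)" using c1[of a "z \<otimes> y"] 1 by auto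
    have "inv\<^bsub>?Q\<^esub> g \<otimes>\<^bsub>?Q\<^esub> d \<otimes>\<^bsub>?Q\<^esub> g = tensor G (conj_by G x (y \<otimes> z)) (conj_by G x (y \<otimes> z))"
      using conj_by_value[of x y z x] 1 x by (simp add: P.m_assoc P.inv_solve_left')
    thus ?case using 1 x by auto
  next
    case (eng g h)
    have cl: "g \<in> carrier ?Q" "h \<in> carrier ?Q" "d \<in> carrier ?Q"
      using eng D by (auto simp: tensor_square_generated[of G, symmetric])
    have "g \<otimes>\<^bsub>?Q\<^esub> h \<otimes>\<^bsub>?Q\<^esub> d \<otimes>\<^bsub>?Q\<^esub> inv\<^bsub>?Q\<^esub> (g \<otimes>\<^bsub>?Q\<^esub> h) =
        g \<otimes>\<^bsub>?Q\<^esub> (h \<otimes>\<^bsub>?Q\<^esub> d \<otimes>\<^bsub>?Q\<^esub> inv\<^bsub>?Q\<^esub> h) \<otimes>\<^bsub>?Q\<^esub> inv\<^bsub>?Q\<^esub> g"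
      using cl by (simp add: P.m_assoc P.inv_mult_group)
    thus ?case using eng by simp
  qed
  show ?thesis
    unfolding nabla_def
    by (rule P.normal_generateI[OF D]) (use gen tensor_square_generated[of G] in blast)
qed

section \<open>Limits of quotients\<close>

locale quotient_system = group Q for Q (structure) +
  fixes \<N> :: "'a set set"
  assumes normal: "N \<in> \<N> \<Longrightarrow> N \<lhd> Q"
    and Int: "N \<in> \<N> \<Longrightarrow> M \<in> \<N> \<Longrightarrow> N \<inter> M \<in> \<N>"
    and carrier: "carrier Q \<in> \<N>"
begin

abbreviation "L \<equiv> quot_limit Q \<N>"
abbreviation "TL \<equiv> quot_limit_topology Q \<N>"
abbreviation "\<pi> \<equiv> to_quot_limit Q \<N>"

lemma sub: "N \<in> \<N> \<Longrightarrow> subgroup N Q"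
  using normal by (simp add: normal_imp_subgroup)

lemma rcos_sum: "N \<in> \<N> \<Longrightarrow> x \<in> carrier Q \<Longrightarrow> y \<in> carrier Q \<Longrightarrow> (N #> x) <#> (N #> y) = N #> (x \<otimes> y)"
  using normal by (rule normal.rcos_sum)

lemma rcos_mono: "N \<in> \<N> \<Longrightarrow> M \<in> \<N> \<Longrightarrow> N \<subseteq> M \<Longrightarrow> x \<in> carrier Q \<Longrightarrow> M <#> (N #> x) = M #> x"
  using rcos_trans[OF is_group _ sub sub] .

lemma Inter:
  assumes "finite J" "J \<subseteq> \<N>"
  shows "carrier Q \<inter> \<Inter> J \<in> \<N>"
  using assms
proof (induction J rule: finite_induct)
  case (insert N J)
  hence "N \<inter> (carrier Q \<inter> \<Inter> J) \<in> \<N>" using Int by simp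
  thus ?case by (simp add: inf_left_commute)
qed (simp add: carrier)

lemma carrier_L:
  "f \<in> carrier L \<longleftrightarrow> f \<in> (\<Pi>\<^sub>E N\<in>\<N>. carrier (Q Mod N)) \<and>
     (\<forall>N\<in>\<N>. \<forall>M\<in>\<N>. N \<subseteq> M \<longrightarrow> f M = M <#> f N)"
  by (simp add: quot_limit_def)

lemma L_PiE: "f \<in> carrier L \<Longrightarrow> f \<in> (\<Pi>\<^sub>E N\<in>\<N>. carrier (Q Mod N))"
  by (simp add: quot_limit_def)

lemma L_mem: "f \<in> carrier L \<Longrightarrow> N \<in> \<N> \<Longrightarrow> f N \<in> carrier (Q Mod N)"
  using L_PiE by (rule PiE_mem)

lemma L_compat: "f \<in> carrier L \<Longrightarrow> N \<in> \<N> \<Longrightarrow> M \<in> \<N> \<Longrightarrow> N \<subseteq> M \<Longrightarrow> f M = M <#> f N"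
  using carrier_L by blast

text \<open>An element of the limit is represented by one group element simultaneously at \<open>N\<close> and at
  all larger members of the system.\<close>

lemma limit_coset:
  assumes "f \<in> carrier L" "N \<in> \<N>"
  obtains a where "a \<in> carrier Q" "\<And>M. M \<in> \<N> \<Longrightarrow> N \<subseteq> M \<Longrightarrow> f M = M #> a"
proof -
  have "f N \<in> carrier (Q Mod N)" using assms by (rule L_mem)
  then obtain a where a: "a \<in> carrier Q" "f N = N #> a" by (auto simp: carrier_FactGroup)
  show ?thesis
    using that[OF a(1)] L_compat[OF assms(1,2)] a rcos_mono[OF assms(2)] by simp
qed

lemma \<pi>_apply: "N \<in> \<N> \<Longrightarrow> \<pi> x N = N #> x"
  by (simp add: to_quot_limit_def)

lemma \<pi>_closed: "x \<in> carrier Q \<Longrightarrow> \<pi> x \<in> carrier L"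
  by (auto simp: carrier_L to_quot_limit_def carrier_FactGroup rcos_mono)

lemma L_eqI:
  assumes "f \<in> carrier L" "g \<in> carrier L" "\<And>N. N \<in> \<N> \<Longrightarrow> f N = g N"
  shows "f = g"
  by (rule PiE_ext[OF L_PiE[OF assms(1)] L_PiE[OF assms(2)] assms(3)])

lemma L_mult: "N \<in> \<N> \<Longrightarrow> (f \<otimes>\<^bsub>L\<^esub> g) N = f N <#> g N"
  by (simp add: quot_limit_def)

lemma L_one: "N \<in> \<N> \<Longrightarrow> \<one>\<^bsub>L\<^esub> N = N"
  by (simp add: quot_limit_def)

lemma L_carrierI:
  assumes "f \<in> extensional \<N>"
    and "\<And>N. N \<in> \<N> \<Longrightarrow> \<exists>a\<in>carrier Q. \<forall>M\<in>\<N>. N \<subseteq> M \<longrightarrow> f M = M #> a"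
  shows "f \<in> carrier L"
  unfolding carrier_L PiE_iff
proof (intro conjI ballI impI)
  fix N assume N: "N \<in> \<N>"
  obtain a where a: "a \<in> carrier Q" "\<And>M. M \<in> \<N> \<Longrightarrow> N \<subseteq> M \<Longrightarrow> f M = M #> a"
    using assms(2)[OF N] by blast
  show "f N \<in> carrier (Q Mod N)" using a N by (auto simp: carrier_FactGroup)
  show "f M = M <#> f N" if "M \<in> \<N>" "N \<subseteq> M" for M
    using a N that rcos_mono by simp
qed (rule assms(1))

lemma L_mult_closed:
  assumes "f \<in> carrier L" "g \<in> carrier L"
  shows "f \<otimes>\<^bsub>L\<^esub> g \<in> carrier L"
proof (rule L_carrierI)
  show "f \<otimes>\<^bsub>L\<^esub> g \<in> extensional \<N>" by (simp add: quot_limit_def)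
  fix N assume N: "N \<in> \<N>"
  obtain a where a: "a \<in> carrier Q" "\<And>M. M \<in> \<N> \<Longrightarrow> N \<subseteq> M \<Longrightarrow> f M = M #> a"
    using limit_coset[OF assms(1) N] by blast
  obtain b where b: "b \<in> carrier Q" "\<And>M. M \<in> \<N> \<Longrightarrow> N \<subseteq> M \<Longrightarrow> g M = M #> b"
    using limit_coset[OF assms(2) N] by blast
  show "\<exists>c\<in>carrier Q. \<forall>M\<in>\<N>. N \<subseteq> M \<longrightarrow> (f \<otimes>\<^bsub>L\<^esub> g) M = M #> c"
    using a b rcos_sum by (intro bexI[of _ "a \<otimes> b"]) (auto simp: L_mult)
qed

lemma group_L: "group L"
proof (rule groupI)
  show "\<one>\<^bsub>L\<^esub> \<in> carrier L"
  proof (rule L_carrierI)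
    show "\<one>\<^bsub>L\<^esub> \<in> extensional \<N>" by (simp add: quot_limit_def)
    show "\<exists>a\<in>carrier Q. \<forall>M\<in>\<N>. N \<subseteq> M \<longrightarrow> \<one>\<^bsub>L\<^esub> M = M #> a" for N
      using sub by (intro bexI[of _ \<one>]) (auto simp: L_one subgroup.subset)
  qed
  fix f g h assume fgh: "f \<in> carrier L" "g \<in> carrier L" "h \<in> carrier L"
  show "f \<otimes>\<^bsub>L\<^esub> g \<in> carrier L" using fgh L_mult_closed by blast
  have grp: "group (Q Mod N)" if "N \<in> \<N>" for N using normal[OF that] by (rule normal.factorgroup_is_group)
  have mem: "f N \<in> carrier (Q Mod N)" if "f \<in> carrier L" "N \<in> \<N>" for f N using that by (rule L_mem)
  show "f \<otimes>\<^bsub>L\<^esub> g \<otimes>\<^bsub>L\<^esub> h = f \<otimes>\<^bsub>L\<^esub> (g \<otimes>\<^bsub>L\<^esub> h)"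
  proof (rule L_eqI)
    fix N assume N: "N \<in> \<N>"
    have "f N \<otimes>\<^bsub>Q Mod N\<^esub> g N \<otimes>\<^bsub>Q Mod N\<^esub> h N = f N \<otimes>\<^bsub>Q Mod N\<^esub> (g N \<otimes>\<^bsub>Q Mod N\<^esub> h N)"
      using fgh mem N by (intro monoid.m_assoc group.is_monoid grp) auto
    thus "(f \<otimes>\<^bsub>L\<^esub> g \<otimes>\<^bsub>L\<^esub> h) N = (f \<otimes>\<^bsub>L\<^esub> (g \<otimes>\<^bsub>L\<^esub> h)) N"
      using N by (simp add: L_mult)
  qed (intro L_mult_closed fgh)+
  show "\<one>\<^bsub>L\<^esub> \<otimes>\<^bsub>L\<^esub> f = f"
  proof (rule L_eqI)
    fix N assume N: "N \<in> \<N>"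
    have "\<one>\<^bsub>Q Mod N\<^esub> \<otimes>\<^bsub>Q Mod N\<^esub> f N = f N"
      using fgh mem N by (intro monoid.l_one group.is_monoid grp) auto
    thus "(\<one>\<^bsub>L\<^esub> \<otimes>\<^bsub>L\<^esub> f) N = f N" using N by (simp add: L_mult L_one)
  qed (intro L_mult_closed fgh \<open>\<one>\<^bsub>L\<^esub> \<in> carrier L\<close>)+
  show "\<exists>k\<in>carrier L. k \<otimes>\<^bsub>L\<^esub> f = \<one>\<^bsub>L\<^esub>"
  proof
    let ?k = "\<lambda>N\<in>\<N>. inv\<^bsub>Q Mod N\<^esub> f N"
    show k: "?k \<in> carrier L"
    proof (rule L_carrierI)
      fix N assume N: "N \<in> \<N>"
      obtain a where a: "a \<in> carrier Q" "\<And>M. M \<in> \<N> \<Longrightarrow> N \<subseteq> M \<Longrightarrow> f M = M #> a"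
        using limit_coset[OF fgh(1) N] by blast
      have "inv\<^bsub>Q Mod M\<^esub> f M = M #> inv a" if "M \<in> \<N>" "N \<subseteq> M" for M
        using a that mem[OF fgh(1) that(1)] normal[OF that(1)]
        by (simp add: normal.inv_FactGroup normal.rcos_inv)
      thus "\<exists>c\<in>carrier Q. \<forall>M\<in>\<N>. N \<subseteq> M \<longrightarrow> ?k M = M #> c"
        using a(1) by (intro bexI[of _ "inv a"]) auto
    qed simp
    show "?k \<otimes>\<^bsub>L\<^esub> f = \<one>\<^bsub>L\<^esub>"
    proof (rule L_eqI)
      fix N assume N: "N \<in> \<N>"
      have "inv\<^bsub>Q Mod N\<^esub> f N \<otimes>\<^bsub>Q Mod N\<^esub> f N = \<one>\<^bsub>Q Mod N\<^esub>"
        using group.l_inv[OF grp[OF N] mem[OF fgh(1) N]] .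
      thus "(?k \<otimes>\<^bsub>L\<^esub> f) N = \<one>\<^bsub>L\<^esub> N" using N by (simp add: L_mult L_one)
    qed (intro L_mult_closed fgh k \<open>\<one>\<^bsub>L\<^esub> \<in> carrier L\<close>)+
  qed
qed

lemma \<pi>_hom: "\<pi> \<in> hom Q L"
proof (rule homI)
  fix x y assume "x \<in> carrier Q" "y \<in> carrier Q"
  thus "\<pi> (x \<otimes> y) = \<pi> x \<otimes>\<^bsub>L\<^esub> \<pi> y"
    by (intro L_eqI L_mult_closed \<pi>_closed) (auto simp: L_mult \<pi>_apply rcos_sum)
qed (rule \<pi>_closed)

lemma topspace_TL: "topspace TL = carrier L"
  using L_PiE by (auto simp: quot_limit_topology_def)

lemma TL_projection:
  assumes "N \<in> \<N>"
  shows "continuous_map TL (discrete_topology (carrier (Q Mod N))) (\<lambda>f. f N)"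
  unfolding quot_limit_topology_def
  by (rule continuous_map_from_subtopology[OF continuous_map_product_projection[OF assms]])

text \<open>As the system is closed under finite intersections, the fibres of the single projections form
  a basis.\<close>

lemma TL_basis:
  assumes "openin TL U" "c \<in> U"
  obtains N where "N \<in> \<N>" "\<And>d. d \<in> carrier L \<Longrightarrow> d N = c N \<Longrightarrow> d \<in> U"
proof -
  let ?X = "\<lambda>N. discrete_topology (carrier (Q Mod N))"
  obtain V where V: "openin (product_topology ?X \<N>) V" "U = V \<inter> carrier L"
    using assms(1) by (auto simp: quot_limit_topology_def openin_subtopology)
  have "c \<in> V" using assms(2) V by auto
  then obtain B where B: "finite {i \<in> \<N>. B i \<noteq> topspace (?X i)}" "c \<in> Pi\<^sub>E \<N> B" "Pi\<^sub>E \<N> B \<subseteq> V"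
    using V(1) unfolding openin_product_topology_alt by meson
  let ?J = "{i \<in> \<N>. B i \<noteq> topspace (?X i)}"
  let ?N = "carrier Q \<inter> \<Inter> ?J"
  have N: "?N \<in> \<N>" using Inter[OF B(1)] by blast
  show ?thesis
  proof (rule that[OF N])
    fix d assume d: "d \<in> carrier L" "d ?N = c ?N"
    have cL: "c \<in> carrier L" using assms V by auto
    have "d i \<in> B i" if "i \<in> \<N>" for i
    proof (cases "i \<in> ?J")
      case True
      hence "?N \<subseteq> i" by blast
      hence "d i = i <#> d ?N" "c i = i <#> c ?N"
        using L_compat[OF _ N that(1)] d(1) cL by blast+
      hence "d i = c i" using d by simp
      thus ?thesis using B(2) that by auto
    next
      case False
      thus ?thesis using L_mem[OF d(1) that] that by simp
    qed
    hence "d \<in> Pi\<^sub>E \<N> B" using L_PiE[OF d(1)] by (simp add: PiE_iff)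
    thus "d \<in> U" using B(3) V(2) d(1) by blast
  qed
qed

text \<open>Since the fibres of single projections form a basis, membership in a closure can be tested on
  one coordinate at a time.\<close>

lemma closure_of_\<pi>_image:
  assumes "S \<subseteq> carrier Q"
  shows "TL closure_of (\<pi> ` S) = {c \<in> carrier L. \<forall>N\<in>\<N>. \<exists>s\<in>S. c N = N #> s}"
proof (intro equalityI subsetI)
  fix c assume c: "c \<in> TL closure_of (\<pi> ` S)"
  hence cL: "c \<in> carrier L" using closure_of_subset_topspace[of TL] topspace_TL by blast
  have "\<exists>s\<in>S. c N = N #> s" if N: "N \<in> \<N>" for N
  proof -
    let ?U = "{f \<in> topspace TL. f N \<in> {c N}}"
    have "openin TL ?U"
      by (rule openin_continuous_map_preimage[OF TL_projection[OF N]])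
        (use L_mem[OF cL N] in simp)
    moreover have "c \<in> ?U" using cL by (simp add: topspace_TL)
    ultimately have "\<exists>y. y \<in> \<pi> ` S \<and> y \<in> ?U" using iffD1[OF in_closure_of c] by meson
    then obtain y where "y \<in> \<pi> ` S" "y \<in> ?U" by (elim exE conjE)
    then obtain x where "x \<in> S" "c N = N #> x" using N by (auto simp: \<pi>_apply)
    thus ?thesis by blast
  qed
  thus "c \<in> {c \<in> carrier L. \<forall>N\<in>\<N>. \<exists>s\<in>S. c N = N #> s}" using cL by blast
next
  fix c assume c: "c \<in> {c \<in> carrier L. \<forall>N\<in>\<N>. \<exists>s\<in>S. c N = N #> s}"
  show "c \<in> TL closure_of (\<pi> ` S)"
    unfolding in_closure_of
  proof (intro conjI allI impI)
    show "c \<in> topspace TL" using c topspace_TL by blast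
    fix U assume U: "c \<in> U \<and> openin TL U"
    obtain N where N: "N \<in> \<N>" "\<And>d. d \<in> carrier L \<Longrightarrow> d N = c N \<Longrightarrow> d \<in> U"
      using TL_basis U by blast
    obtain s where "s \<in> S" "c N = N #> s" using c N(1) by blast
    hence "\<pi> s \<in> U" using N assms \<pi>_closed \<pi>_apply by auto
    thus "\<exists>y. y \<in> \<pi> ` S \<and> y \<in> U" using \<open>s \<in> S\<close> by blast
  qed
qed

lemma subgroup_closure_of_\<pi>_image:
  assumes "subgroup S Q"
  shows "subgroup (TL closure_of (\<pi> ` S)) L"
proof -
  interpret S: subgroup S Q by fact
  interpret L: group L by (rule group_L)
  have eq: "TL closure_of (\<pi> ` S) = {c \<in> carrier L. \<forall>N\<in>\<N>. \<exists>s\<in>S. c N = N #> s}"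
    by (rule closure_of_\<pi>_image[OF S.subset])
  have inv: "(inv\<^bsub>L\<^esub> c) N = N #> inv s" if "c \<in> carrier L" "N \<in> \<N>" "s \<in> S" "c N = N #> s" for c N s
  proof -
    have "inv\<^bsub>Q Mod N\<^esub> (c N) = (inv\<^bsub>L\<^esub> c) N"
    proof (rule group.inv_equality[OF normal.factorgroup_is_group[OF normal[OF that(2)]]])
      have "(inv\<^bsub>L\<^esub> c \<otimes>\<^bsub>L\<^esub> c) N = \<one>\<^bsub>L\<^esub> N" using L.l_inv[OF that(1)] by simp
      thus "(inv\<^bsub>L\<^esub> c) N \<otimes>\<^bsub>Q Mod N\<^esub> c N = \<one>\<^bsub>Q Mod N\<^esub>" by (simp add: L_mult L_one that(2))
    qed (intro L_mem L.inv_closed that)+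
    moreover have "inv\<^bsub>Q Mod N\<^esub> (c N) = N #> inv s"
      using that normal S.mem_carrier
      by (simp add: normal.inv_FactGroup normal.rcos_inv carrier_FactGroup)
    ultimately show ?thesis by simp
  qed
  show ?thesis
    unfolding eq
  proof (rule L.subgroupI)
    show "{c \<in> carrier L. \<forall>N\<in>\<N>. \<exists>s\<in>S. c N = N #> s} \<noteq> {}"
      using \<pi>_closed[of \<one>] \<pi>_apply by (auto intro!: exI[of _ "\<pi> \<one>"])
  next
    fix c assume "c \<in> {c \<in> carrier L. \<forall>N\<in>\<N>. \<exists>s\<in>S. c N = N #> s}"
    hence c: "c \<in> carrier L" "\<forall>N\<in>\<N>. \<exists>s\<in>S. c N = N #> s" by simp_all
    have "\<exists>s\<in>S. (inv\<^bsub>L\<^esub> c) N = N #> s" if "N \<in> \<N>" for N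
      using c(2) inv[OF c(1) that] S.m_inv_closed that by meson
    thus "inv\<^bsub>L\<^esub> c \<in> {c \<in> carrier L. \<forall>N\<in>\<N>. \<exists>s\<in>S. c N = N #> s}"
      using c(1) by simp
  next
    fix c d assume cd: "c \<in> {c \<in> carrier L. \<forall>N\<in>\<N>. \<exists>s\<in>S. c N = N #> s}"
      "d \<in> {c \<in> carrier L. \<forall>N\<in>\<N>. \<exists>s\<in>S. c N = N #> s}"
    have "\<exists>s\<in>S. (c \<otimes>\<^bsub>L\<^esub> d) N = N #> s" if "N \<in> \<N>" for N
    proof -
      have "\<exists>s\<in>S. c N = N #> s" "\<exists>t\<in>S. d N = N #> t" using cd that by simp_all
      then obtain s t where "s \<in> S" "c N = N #> s" "t \<in> S" "d N = N #> t" by (elim bexE)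
      hence "(c \<otimes>\<^bsub>L\<^esub> d) N = N #> (s \<otimes> t)" "s \<otimes> t \<in> S"
        using that S.mem_carrier by (simp_all add: L_mult rcos_sum)
      thus ?thesis by blast
    qed
    thus "c \<otimes>\<^bsub>L\<^esub> d \<in> {c \<in> carrier L. \<forall>N\<in>\<N>. \<exists>s\<in>S. c N = N #> s}"
      using cd L_mult_closed by simp
  qed auto
qed

text \<open>By Tychonoff's theorem, as the compatibility conditions are closed.\<close>

lemma compact_TL:
  assumes "\<And>N. N \<in> \<N> \<Longrightarrow> finite (carrier (Q Mod N))"
  shows "compact_space TL"
proof -
  let ?X = "\<lambda>N. discrete_topology (carrier (Q Mod N))" and ?P = "product_topology (\<lambda>N. discrete_topology (carrier (Q Mod N))) \<N>"
  have cpt: "compact_space ?P"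
    using assms by (auto simp: compact_space_product_topology compact_space_discrete_topology)
  have "openin ?P (topspace ?P - carrier L)"
  proof (subst openin_subopen, intro ballI)
    fix f assume f: "f \<in> topspace ?P - carrier L"
    hence "f \<in> (\<Pi>\<^sub>E N\<in>\<N>. carrier (Q Mod N))" "f \<notin> carrier L" by simp_all
    then obtain N M where NM: "N \<in> \<N>" "M \<in> \<N>" "N \<subseteq> M" "f M \<noteq> M <#> f N"
      using carrier_L[of f] by meson
    let ?U = "{h \<in> topspace ?P. h N \<in> {f N}} \<inter> {h \<in> topspace ?P. h M \<in> {f M}}"
    have "openin ?P ?U"
      using f NM
      by (intro openin_Int openin_continuous_map_preimage[OF continuous_map_product_projection]) auto
    moreover have "?U \<subseteq> topspace ?P - carrier L"
      using NM(4) L_compat[OF _ NM(1-3)] by (intro subsetI) (metis (mono_tags, lifting) DiffI IntE mem_Collect_eq singletonD)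
    ultimately show "\<exists>U. openin ?P U \<and> f \<in> U \<and> U \<subseteq> topspace ?P - carrier L"
      using f by blast
  qed
  hence "closedin ?P (carrier L)"
    using L_PiE by (auto simp: closedin_def)
  thus ?thesis
    unfolding quot_limit_topology_def
    using cpt closedin_compact_space compact_space_subtopology by blast
qed

end

section \<open>Pro-\<open>p\<close>-groups and their complete exterior square\<close>

lemma continuous_map_into_discrete:
  "continuous_map X (discrete_topology D) f \<longleftrightarrow>
     f \<in> topspace X \<rightarrow> D \<and> (\<forall>x\<in>topspace X. openin X {y \<in> topspace X. f y = f x})"
proof (intro iffI conjI ballI)
  assume c: "continuous_map X (discrete_topology D) f"
  thus "f \<in> topspace X \<rightarrow> D" by (auto simp: continuous_map_def)
  fix x assume "x \<in> topspace X"
  thus "openin X {y \<in> topspace X. f y = f x}"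
    using openin_continuous_map_preimage[OF c, of "{f x}"] \<open>f \<in> topspace X \<rightarrow> D\<close> by auto
next
  assume *: "f \<in> topspace X \<rightarrow> D \<and> (\<forall>x\<in>topspace X. openin X {y \<in> topspace X. f y = f x})"
  have "openin X {x \<in> topspace X. f x \<in> U}" for U
  proof (subst openin_subopen, intro ballI)
    fix x assume x: "x \<in> {x \<in> topspace X. f x \<in> U}"
    thus "\<exists>V. openin X V \<and> x \<in> V \<and> V \<subseteq> {x \<in> topspace X. f x \<in> U}"
      using * by (intro exI[of _ "{y \<in> topspace X. f y = f x}"]) auto
  qed
  thus "continuous_map X (discrete_topology D) f"
    using * by (auto simp: continuous_map_def)
qed

locale pro_p = group G for G :: "('a, 'm) monoid_scheme" (structure) +
  fixes T :: "'a topology" and p :: nat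
  assumes prime: "prime p" and pro_p: "pro_p_group p G T"
begin

abbreviation "\<P> \<equiv> p_quot_kernels p G T"

lemma topspace: "topspace T = carrier G"
  using pro_p by (simp add: pro_p_group_def topological_group_def)

lemma \<P>_iff: "N \<in> \<P> \<longleftrightarrow> N \<lhd> G \<and> closedin T N \<and> finite_p_group p (G Mod N)"
  by (simp add: p_quot_kernels_def)

sublocale quotient_system G \<P>
proof (intro quotient_system.intro is_group quotient_system_axioms.intro)
  show "N \<lhd> G" if "N \<in> \<P>" for N using that by (simp add: \<P>_iff)
  show "N \<inter> M \<in> \<P>" if "N \<in> \<P>" "M \<in> \<P>" for N M
    using that finite_p_group_Mod_Int[OF prime, of N G M] by (auto simp: \<P>_iff)
  show "carrier G \<in> \<P>"
    using finite_p_group_Mod_self[OF is_group] closedin_topspace[of T] by (auto simp: \<P>_iff topspace)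
qed

lemma finite_quotient: "N \<in> \<P> \<Longrightarrow> finite (carrier (G Mod N))"
  by (simp add: \<P>_iff finite_p_group_def)

lemma homeo: "homeomorphic_map T TL \<pi>"
  using pro_p by (simp add: pro_p_group_def Let_def)

lemma iso_\<pi>: "\<pi> \<in> iso G L"
  using pro_p by (simp add: pro_p_group_def Let_def)

lemma compact: "compact_space T"
  using homeomorphic_compact_space[OF homeomorphic_map_imp_homeomorphic_space[OF homeo]]
    compact_TL finite_quotient by blast

lemma rcos_iff:
  assumes "subgroup N G" "x \<in> carrier G"
  shows "y \<in> N #> x \<longleftrightarrow> y \<in> carrier G \<and> N #> y = N #> x"
proof
  assume y: "y \<in> N #> x"
  hence "y \<in> carrier G" using subgroup.elemrcos_carrier[OF assms(1) is_group assms(2)] by blast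
  moreover have "N #> x = N #> y" using repr_independence[OF y assms(2,1)] .
  ultimately show "y \<in> carrier G \<and> N #> y = N #> x" by simp
next
  assume "y \<in> carrier G \<and> N #> y = N #> x"
  thus "y \<in> N #> x" using rcos_self[of y N] assms(1) by auto
qed

text \<open>The cosets of the kernels are a basis of the topology.\<close>

lemma openin_rcos:
  assumes "N \<in> \<P>" "x \<in> carrier G"
  shows "openin T (N #> x)"
proof -
  have "continuous_map T (discrete_topology (carrier (G Mod N))) ((\<lambda>f. f N) \<circ> \<pi>)"
    by (rule continuous_map_compose[OF homeomorphic_imp_continuous_map[OF homeo] TL_projection[OF assms(1)]])
  hence "openin T {y \<in> topspace T. N #> y = N #> x}"
    using assms topspace unfolding continuous_map_into_discrete by (auto simp: \<pi>_apply)
  moreover have "{y \<in> topspace T. N #> y = N #> x} = N #> x"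
    using assms(2) topspace rcos_iff[OF sub[OF assms(1)] assms(2)] by blast
  ultimately show ?thesis by simp
qed

lemma open_basis:
  assumes "openin T U" "x \<in> U"
  obtains N where "N \<in> \<P>" "N #> x \<subseteq> U"
proof -
  have U: "U \<subseteq> carrier G" using assms(1) openin_subset topspace by blast
  have "openin TL (\<pi> ` U)"
    using homeomorphic_map_openness[OF homeo] assms(1) U topspace by blast
  then obtain N where N: "N \<in> \<P>" "\<And>d. d \<in> carrier L \<Longrightarrow> d N = \<pi> x N \<Longrightarrow> d \<in> \<pi> ` U"
    using TL_basis[of "\<pi> ` U" "\<pi> x"] assms(2) by blast
  have inj: "inj_on \<pi> (carrier G)" using iso_\<pi> by (simp add: iso_def bij_betw_def)
  have "y \<in> U" if y: "y \<in> N #> x" for y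
  proof -
    have yG: "y \<in> carrier G"
      using y U assms(2) subgroup.elemrcos_carrier[OF sub[OF N(1)] is_group] by blast
    have "N #> y = N #> x" using repr_independence[OF y _ sub[OF N(1)]] U assms(2) by auto
    hence "\<pi> y \<in> \<pi> ` U" using N \<pi>_closed[OF yG] by (simp add: \<pi>_apply)
    thus ?thesis using inj U yG inj_on_image_mem_iff by metis
  qed
  thus ?thesis using that N(1) by blast
qed

lemma Inter_\<P>:
  assumes "x \<in> carrier G" "\<And>N. N \<in> \<P> \<Longrightarrow> x \<in> N"
  shows "x = \<one>"
proof -
  have "\<pi> x = \<pi> \<one>"
    by (rule L_eqI)
      (use assms \<pi>_closed in \<open>simp_all add: \<pi>_apply rcos_eq_self_iff sub subgroup.subset\<close>)
  thus ?thesis using iso_\<pi> assms(1) by (auto simp: iso_def bij_betw_def inj_on_def)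
qed

lemma clopen_saturated:
  assumes "N \<in> \<P>" "S \<subseteq> carrier G" "\<And>x. x \<in> S \<Longrightarrow> N #> x \<subseteq> S"
  shows "openin T S" "closedin T S"
proof -
  show "openin T S"
  proof (subst openin_subopen, intro ballI)
    fix x assume x: "x \<in> S"
    hence "x \<in> carrier G" using assms(2) by blast
    hence "openin T (N #> x)" "x \<in> N #> x"
      using openin_rcos[OF assms(1)] rcos_self[OF _ sub[OF assms(1)]] by simp_all
    thus "\<exists>U. openin T U \<and> x \<in> U \<and> U \<subseteq> S" using assms(3)[OF x] by blast
  qed
  have "openin T (carrier G - S)"
  proof (subst openin_subopen, intro ballI)
    fix x assume x: "x \<in> carrier G - S"
    hence xN: "openin T (N #> x)" "x \<in> N #> x"
      using openin_rcos[OF assms(1)] rcos_self[OF _ sub[OF assms(1)]] by simp_all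
    have "N #> x \<subseteq> carrier G - S"
    proof
      fix y assume "y \<in> N #> x"
      hence y: "y \<in> carrier G" "N #> y = N #> x" using rcos_iff[OF sub[OF assms(1)]] x by simp_all
      hence "y \<notin> S" using assms(3)[of y] xN(2) x by blast
      thus "y \<in> carrier G - S" using y by blast
    qed
    thus "\<exists>U. openin T U \<and> x \<in> U \<and> U \<subseteq> carrier G - S" using xN by blast
  qed
  thus "closedin T S" using assms(2) by (simp add: closedin_def topspace)
qed

lemma subgroup_saturated:
  assumes "N \<subseteq> H" "subgroup H G" "x \<in> H"
  shows "N #> x \<subseteq> H"
  using assms by (auto simp: r_coset_def subgroup.m_closed)

lemma \<P>_mono:
  assumes "N \<in> \<P>" "N \<subseteq> M" "M \<lhd> G"
  shows "M \<in> \<P>"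
proof -
  have M: "subgroup M G" using assms(3) by (rule normal_imp_subgroup)
  have "closedin T M"
    by (rule clopen_saturated(2)[OF assms(1) subgroup.subset[OF M] subgroup_saturated[OF assms(2) M]])
  thus ?thesis
    using assms finite_p_group_Mod_mono[OF prime, of N G M] by (simp add: \<P>_iff)
qed

abbreviation "Q \<equiv> tensor_square G"
abbreviation "\<K> \<equiv> tensor_kernels p G T"

lemma \<K>_iff:
  "K \<in> \<K> \<longleftrightarrow> K \<lhd> Q \<and> finite_p_group p (Q Mod K) \<and>
     (\<forall>x\<in>carrier G. \<forall>y\<in>carrier G. openin (prod_topology T T)
       {(x', y'). x' \<in> carrier G \<and> y' \<in> carrier G \<and> K #>\<^bsub>Q\<^esub> tensor G x' y' = K #>\<^bsub>Q\<^esub> tensor G x y})"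
proof -
  note tensor_closed[OF is_group]
  moreover have "{z. fst z \<in> carrier G \<and> snd z \<in> carrier G \<and> K #>\<^bsub>Q\<^esub> tensor G (fst z) (snd z) = C} =
      {(x', y'). x' \<in> carrier G \<and> y' \<in> carrier G \<and> K #>\<^bsub>Q\<^esub> tensor G x' y' = C}" for K C
    by auto
  ultimately show ?thesis
    by (simp add: tensor_kernels_def continuous_map_into_discrete topspace carrier_FactGroup
        Pi_iff mem_Times_iff case_prod_unfold Ball_def conj_assoc) blast
qed

text \<open>The kernels that define the complete tensor square form a system closed under intersections, so
  that the results on limits apply to it as well.\<close>

sublocale TK: quotient_system Q \<K>
proof -
  interpret Q: group Q by (rule group_tensor_square)
  note cl = tensor_closed[OF is_group]
  show "quotient_system Q \<K>"
  proof (intro quotient_system.intro Q.is_group quotient_system_axioms.intro)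
    show "N \<lhd> Q" if "N \<in> \<K>" for N using that by (simp add: \<K>_iff)
    show "N \<inter> M \<in> \<K>" if NM: "N \<in> \<K>" "M \<in> \<K>" for N M
    proof -
      note I = finite_p_group_Mod_Int[OF prime, of N Q M]
      have n: "N \<lhd> Q" "M \<lhd> Q" "finite_p_group p (Q Mod N)" "finite_p_group p (Q Mod M)"
        using NM by (simp_all add: \<K>_iff)
      have eq: "(N \<inter> M) #>\<^bsub>Q\<^esub> s = (N \<inter> M) #>\<^bsub>Q\<^esub> t \<longleftrightarrow> N #>\<^bsub>Q\<^esub> s = N #>\<^bsub>Q\<^esub> t \<and> M #>\<^bsub>Q\<^esub> s = M #>\<^bsub>Q\<^esub> t"
        if "s \<in> carrier Q" "t \<in> carrier Q" for s t
        using that n I(1) by (simp add: Q.rcos_eq_iff normal_imp_subgroup)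
      have "openin (prod_topology T T)
         {(x', y'). x' \<in> carrier G \<and> y' \<in> carrier G \<and> (N \<inter> M) #>\<^bsub>Q\<^esub> tensor G x' y' = (N \<inter> M) #>\<^bsub>Q\<^esub> tensor G x y}"
        if xy: "x \<in> carrier G" "y \<in> carrier G" for x y
      proof -
        have "{(x', y'). x' \<in> carrier G \<and> y' \<in> carrier G \<and> (N \<inter> M) #>\<^bsub>Q\<^esub> tensor G x' y' = (N \<inter> M) #>\<^bsub>Q\<^esub> tensor G x y} =
          {(x', y'). x' \<in> carrier G \<and> y' \<in> carrier G \<and> N #>\<^bsub>Q\<^esub> tensor G x' y' = N #>\<^bsub>Q\<^esub> tensor G x y} \<inter>
          {(x', y'). x' \<in> carrier G \<and> y' \<in> carrier G \<and> M #>\<^bsub>Q\<^esub> tensor G x' y' = M #>\<^bsub>Q\<^esub> tensor G x y}"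
          by (intro Set.set_eqI) (simp add: split_beta eq[OF cl cl[OF xy]] cong: conj_cong)
        thus ?thesis using NM xy by (simp add: \<K>_iff openin_Int)
      qed
      thus ?thesis using I n by (simp add: \<K>_iff)
    qed
    have "carrier Q #>\<^bsub>Q\<^esub> t = carrier Q" if "t \<in> carrier Q" for t
      using that Q.coset_join2 Q.subgroup_self by blast
    moreover have "openin (prod_topology T T) (carrier G \<times> carrier G)"
      by (metis openin_topspace topspace topspace_prod_topology)
    moreover have "{(x', y'). x' \<in> carrier G \<and> y' \<in> carrier G} = carrier G \<times> carrier G" by auto
    ultimately show "carrier Q \<in> \<K>"
      using finite_p_group_Mod_self[OF group_tensor_square[of G]] cl by (simp add: \<K>_iff cong: conj_cong)
  qed
qed

definition wedge_trivial :: "'a \<Rightarrow> 'a \<Rightarrow> bool" where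
  "wedge_trivial x y \<longleftrightarrow> cwedge p G T x y = \<one>\<^bsub>cext_square p G T\<^esub>"

text \<open>At the level of a single kernel the closed subgroup generated by the \<open>x \<otimes> x\<close> is the image of the
  abstract one.\<close>

lemma wedge_trivial_iff:
  assumes "x \<in> carrier G" "y \<in> carrier G"
  shows "wedge_trivial x y \<longleftrightarrow> (\<forall>K\<in>\<K>. \<exists>s\<in>nabla G. K #>\<^bsub>Q\<^esub> tensor G x y = K #>\<^bsub>Q\<^esub> s)"
proof -
  note cl = tensor_closed[OF is_group]
  interpret H: group_hom Q TK.L TK.\<pi>
    using TK.group_L TK.\<pi>_hom group_tensor_square by (simp add: group_hom_def group_hom_axioms_def)
  let ?D = "(\<lambda>x. tensor G x x) ` carrier G"
  have nab: "subgroup (nabla G) Q" using nabla_normal[OF is_group] by (rule normal_imp_subgroup)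
  have D: "?D \<subseteq> carrier Q" using cl by auto
  have im: "{ctensor p G T x x |x. x \<in> carrier G} = TK.\<pi> ` ?D"
    by (auto simp: ctensor_def)
  have "cnabla p G T = TK.TL closure_of (generate TK.L (TK.\<pi> ` ?D))"
    by (simp add: cnabla_def top_generate_def im ctensor_topology_def ctensor_square_def)
  also have "generate TK.L (TK.\<pi> ` ?D) = TK.\<pi> ` nabla G"
    using H.generate_img[OF D] by (simp add: nabla_def)
  finally have cn: "cnabla p G T = TK.TL closure_of (TK.\<pi> ` nabla G)" .
  have "wedge_trivial x y \<longleftrightarrow> cnabla p G T #>\<^bsub>TK.L\<^esub> TK.\<pi> (tensor G x y) = cnabla p G T"
    by (simp add: wedge_trivial_def cwedge_def cext_square_def ctensor_square_def ctensor_def)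
  also have "\<dots> \<longleftrightarrow> TK.\<pi> (tensor G x y) \<in> cnabla p G T"
    unfolding cn
    by (rule H.H.rcos_eq_self_iff[OF TK.subgroup_closure_of_\<pi>_image[OF nab] TK.\<pi>_closed[OF cl[OF assms]]])
  also have "\<dots> \<longleftrightarrow> (\<forall>K\<in>\<K>. \<exists>s\<in>nabla G. K #>\<^bsub>Q\<^esub> tensor G x y = K #>\<^bsub>Q\<^esub> s)"
    unfolding cn TK.closure_of_\<pi>_image[OF subgroup.subset[OF nab]]
    using TK.\<pi>_closed[OF cl[OF assms]] by (simp add: TK.\<pi>_apply)
  finally show ?thesis .
qed

end

section \<open>Alternating pairings\<close>

text \<open>The last condition expresses continuity: for an alternating pairing it makes \<open>b\<close> constant on
  products of cosets of an open normal subgroup.\<close>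

locale alternating_pairing = pro_p G T p + pairing G P b
  for G :: "('a, 'm) monoid_scheme" (structure) and T p and P :: "('b, 'n) monoid_scheme" and b +
  assumes finite_p: "finite_p_group p P"
    and alternating: "x \<in> carrier G \<Longrightarrow> b x x = \<one>\<^bsub>P\<^esub>"
    and smooth: "\<exists>N\<in>\<P>. \<forall>n\<in>N. \<forall>y\<in>carrier G. b n y = \<one>\<^bsub>P\<^esub>"
begin

lemma conj_by_surj:
  assumes "x \<in> carrier G" "w \<in> carrier G"
  obtains x' where "x' \<in> carrier G" "x = conj_by G x' w"
  using that[of "conj_by G x (inv w)"] assms by (simp add: conj_by_conj_by)

text \<open>Expand \<open>b (x' y) (x' y) = 1\<close> with \<open>x'\<close> chosen such that \<open>x\<close> is its conjugate by \<open>y\<close>.\<close>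

lemma antisymmetric:
  assumes "x \<in> carrier G" "y \<in> carrier G"
  shows "b x y \<otimes>\<^bsub>P\<^esub> b y x = \<one>\<^bsub>P\<^esub>"
proof -
  obtain x' where x: "x' \<in> carrier G" "x = conj_by G x' y" using conj_by_surj assms by blast
  have "b (x' \<otimes> y) (x' \<otimes> y) = b x (conj_by G (x' \<otimes> y) y) \<otimes>\<^bsub>P\<^esub> b y (x' \<otimes> y)"
    using x assms by (simp add: mult_left)
  also have "b y (x' \<otimes> y) = b y x"
    using x assms by (simp add: mult_right alternating)
  also have "b x (conj_by G (x' \<otimes> y) y) = b x y"
    using x assms by (simp add: conj_by_mult mult_right alternating)
  finally show ?thesis using x assms alternating[of "x' \<otimes> y"] by simp
qed

lemma symmetric:
  assumes "x \<in> carrier G" "y \<in> carrier G" "b x y = \<one>\<^bsub>P\<^esub>"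
  shows "b y x = \<one>\<^bsub>P\<^esub>"
  using antisymmetric[OF assms(1,2)] assms by simp

text \<open>The terms that arise when \<open>b (n x) (m y)\<close> is expanded have an argument in the normal subgroup \<open>N\<close>,
  on either side by symmetry.\<close>

lemma locally_constant:
  assumes "N \<in> \<P>" "\<And>n y. n \<in> N \<Longrightarrow> y \<in> carrier G \<Longrightarrow> b n y = \<one>\<^bsub>P\<^esub>"
    and "x \<in> carrier G" "y \<in> carrier G" "x' \<in> N #> x" "y' \<in> N #> y"
  shows "b x' y' = b x y"
proof -
  interpret N: normal N G using normal assms(1) .
  obtain n m where nm: "n \<in> N" "m \<in> N" "x' = n \<otimes> x" "y' = m \<otimes> y"
    using assms(5,6) by (auto simp: r_coset_def)
  have cN: "conj_by G k w \<in> N" if "k \<in> N" "w \<in> carrier G" for k w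
    using N.inv_op_closed1[OF that(2,1)] by (simp add: conj_by_def)
  have N1: "b n y = \<one>\<^bsub>P\<^esub>" "b y n = \<one>\<^bsub>P\<^esub>" if "n \<in> N" "y \<in> carrier G" for n y
    using that assms(2) symmetric[of n y] N.mem_carrier by simp_all
  have "b x' y' = b x (m \<otimes> y)"
    using nm assms(3,4) N1(1)[OF cN[OF nm(1) assms(3)]] by (simp add: mult_left)
  also have "\<dots> = b x y"
    using nm assms(3,4) N1(2)[OF cN[OF nm(2) assms(4)]] by (simp add: mult_right)
  finally show ?thesis .
qed

lemma conjugate:
  assumes w: "w \<in> carrier G"
  shows "alternating_pairing G T p P (\<lambda>x y. b (conj_by G x w) (conj_by G y w))"
proof -
  obtain N where N: "N \<in> \<P>" "\<And>n y. n \<in> N \<Longrightarrow> y \<in> carrier G \<Longrightarrow> b n y = \<one>\<^bsub>P\<^esub>"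
    using smooth by blast
  interpret N: normal N G using normal N(1) .
  have "conj_by G n w \<in> N" if "n \<in> N" for n
    using N.inv_op_closed1[OF w that] by (simp add: conj_by_def)
  hence "\<forall>n\<in>N. \<forall>y\<in>carrier G. b (conj_by G n w) (conj_by G y w) = \<one>\<^bsub>P\<^esub>"
    using N(2) w by simp
  thus ?thesis
    using N(1) w alternating finite_p tensor_pairing_conj[OF is_group pairing w] pro_p_axioms
      is_group P.is_group
    by (intro alternating_pairing.intro pairing.intro alternating_pairing_axioms.intro pairing_axioms.intro) auto
qed

text \<open>An alternating pairing factors through the complete exterior square: the kernel of the
  homomorphism that it induces on the tensor square is one of the kernels that define the
  completion, and contains all \<open>x \<otimes> x\<close>.\<close>

lemma wedge_trivial_imp:
  assumes xy: "x \<in> carrier G" "y \<in> carrier G" and c: "wedge_trivial x y"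
  shows "b x y = \<one>\<^bsub>P\<^esub>"
proof -
  obtain \<phi> where \<phi>: "\<phi> \<in> hom Q P" "\<And>x y. x \<in> carrier G \<Longrightarrow> y \<in> carrier G \<Longrightarrow> \<phi> (tensor G x y) = b x y"
    using tensor_square_universal[OF is_group P.is_group pairing] by blast
  interpret \<phi>: group_hom Q P \<phi>
    using \<phi>(1) group_tensor_square P.is_group by (simp add: group_hom_def group_hom_axioms_def)
  note cl = tensor_closed[OF is_group]
  let ?K = "kernel Q P \<phi>"
  have eq: "?K #>\<^bsub>Q\<^esub> s = ?K #>\<^bsub>Q\<^esub> t \<longleftrightarrow> \<phi> s = \<phi> t" if "s \<in> carrier Q" "t \<in> carrier Q" for s t
    using that by (simp add: group.rcos_eq_iff[OF group_tensor_square \<phi>.subgroup_kernel])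
      (simp add: kernel_def P.inv_solve_right')
  obtain N where N: "N \<in> \<P>" "\<And>n y. n \<in> N \<Longrightarrow> y \<in> carrier G \<Longrightarrow> b n y = \<one>\<^bsub>P\<^esub>"
    using smooth by blast
  have "openin (prod_topology T T)
      {(x', y'). x' \<in> carrier G \<and> y' \<in> carrier G \<and> ?K #>\<^bsub>Q\<^esub> tensor G x' y' = ?K #>\<^bsub>Q\<^esub> tensor G x y}"
    (is "openin _ ?U") if xy: "x \<in> carrier G" "y \<in> carrier G" for x y
  proof -
    have U: "?U = {(x', y'). x' \<in> carrier G \<and> y' \<in> carrier G \<and> b x' y' = b x y}"
      by (intro Set.set_eqI) (simp add: split_beta eq cl \<phi>(2) xy cong: conj_cong)
    show ?thesis
      unfolding openin_prod_topology_alt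
    proof (intro allI impI)
      fix x' y' assume "(x', y') \<in> ?U"
      hence x': "x' \<in> carrier G" "y' \<in> carrier G" "b x' y' = b x y" unfolding U by auto
      have "(N #> x') \<times> (N #> y') \<subseteq> ?U"
        unfolding U
        using locally_constant[OF N x'(1,2)] x' rcos_iff[OF sub[OF N(1)]] by auto
      thus "\<exists>A B. openin T A \<and> openin T B \<and> x' \<in> A \<and> y' \<in> B \<and> A \<times> B \<subseteq> ?U"
        using openin_rcos[OF N(1)] x' rcos_self[OF _ sub[OF N(1)]] by meson
    qed
  qed
  hence K: "?K \<in> \<K>"
    unfolding \<K>_iff
    using \<phi>.normal_kernel finite_p_group_Mod_kernel[OF prime group_tensor_square finite_p \<phi>(1)] by blast
  obtain s where s: "s \<in> nabla G" "?K #>\<^bsub>Q\<^esub> tensor G x y = ?K #>\<^bsub>Q\<^esub> s"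
    using K c wedge_trivial_iff[OF xy] by blast
  have "nabla G \<subseteq> ?K"
    unfolding nabla_def
    by (rule group.generate_subgroup_incl[OF group_tensor_square _ \<phi>.subgroup_kernel])
      (use cl \<phi>(2) alternating in \<open>auto simp: kernel_def\<close>)
  hence "\<phi> s = \<one>\<^bsub>P\<^esub>" "s \<in> carrier Q" using s(1) by (auto simp: kernel_def)
  thus ?thesis using eq[OF cl[OF xy], of s] s(2) \<phi>(2)[OF xy] by simp
qed

end

context pro_p
begin

lemma openin_prod_topologyE:
  assumes "openin (prod_topology X Y) W" "(x, y) \<in> W"
  obtains U V where "openin X U" "openin Y V" "x \<in> U" "y \<in> V" "U \<times> V \<subseteq> W"
  using assms openin_prod_topology_alt[of X Y W] by metis

text \<open>The tube lemma for \<open>{1} \<times> G\<close>; finitely many kernels suffice by compactness of \<open>G\<close>.\<close>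

lemma tube:
  assumes W: "\<And>y. y \<in> carrier G \<Longrightarrow> \<exists>U V. openin T U \<and> openin T V \<and> \<one> \<in> U \<and> y \<in> V \<and> U \<times> V \<subseteq> W"
  obtains N where "N \<in> \<P>" "N \<times> carrier G \<subseteq> W"
proof -
  have "\<exists>N V. N \<in> \<P> \<and> openin T V \<and> y \<in> V \<and> N \<times> V \<subseteq> W" if y: "y \<in> carrier G" for y
  proof -
    obtain U V where UV: "openin T U" "openin T V" "\<one> \<in> U" "y \<in> V" "U \<times> V \<subseteq> W"
      using W[OF y] by blast
    obtain N where N: "N \<in> \<P>" "N #> \<one> \<subseteq> U" using open_basis[OF UV(1,3)] by blast
    hence "N \<subseteq> U" using subgroup.subset[OF sub[OF N(1)]] by simp
    hence "N \<times> V \<subseteq> W" using UV(5) by blast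
    thus ?thesis using N(1) UV by blast
  qed
  then obtain N V where NV: "\<And>y. y \<in> carrier G \<Longrightarrow> N y \<in> \<P>" "\<And>y. y \<in> carrier G \<Longrightarrow> openin T (V y)"
    "\<And>y. y \<in> carrier G \<Longrightarrow> y \<in> V y" "\<And>y. y \<in> carrier G \<Longrightarrow> N y \<times> V y \<subseteq> W" by metis
  have "\<exists>F. finite F \<and> F \<subseteq> V ` carrier G \<and> carrier G \<subseteq> \<Union>F"
  proof (rule compactinD)
    show "compactin T (carrier G)" using compact topspace by (simp add: compact_space_def)
  qed (use NV(2,3) in auto)
  then obtain F where F: "finite F" "F \<subseteq> V ` carrier G" "carrier G \<subseteq> \<Union>F" by (elim exE conjE)
  obtain Y where Y: "Y \<subseteq> carrier G" "finite Y" "F = V ` Y"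
    using finite_subset_image[OF F(1,2)] by (elim exE conjE)
  let ?N = "carrier G \<inter> \<Inter> (N ` Y)"
  have "?N \<in> \<P>" using Y NV(1) by (intro Inter) auto
  moreover have "?N \<times> carrier G \<subseteq> W" using Y(1,3) F(3) NV(4) by blast
  ultimately show ?thesis using that by blast
qed

text \<open>Conversely the alternating pairings detect the nontrivial symbols: if \<open>x \<and> y\<close> is nontrivial, it
  is nontrivial in the quotient of some \<open>Q / K\<close> by the image of the group generated by the \<open>x \<otimes> x\<close>.\<close>

lemma detecting_pairing:
  assumes xy: "x \<in> carrier G" "y \<in> carrier G" and c: "\<not> wedge_trivial x y"
  obtains P :: "('a \<times> 'a) gword set set set monoid" and b
  where "alternating_pairing G T p P b" "b x y \<noteq> \<one>\<^bsub>P\<^esub>"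
proof -
  note cl = tensor_closed[OF is_group]
  obtain K where K: "K \<in> \<K>" "\<And>s. s \<in> nabla G \<Longrightarrow> K #>\<^bsub>Q\<^esub> tensor G x y \<noteq> K #>\<^bsub>Q\<^esub> s"
    using c wedge_trivial_iff[OF xy] by blast
  interpret K: normal K Q using TK.normal K(1) .
  interpret nabla: normal "nabla G" Q using nabla_normal[OF is_group] .
  let ?k = "\<lambda>t. K #>\<^bsub>Q\<^esub> t"
  have QK: "group (Q Mod K)" by (rule K.factorgroup_is_group)
  have k: "?k \<in> hom Q (Q Mod K)" by (rule K.r_coset_hom_Mod)
  have "group_hom Q (Q Mod K) ?k" using k QK group_tensor_square by (simp add: group_hom_def group_hom_axioms_def)
  hence "?k ` nabla G \<lhd> Q Mod K"
    by (rule nabla.surj_hom_normal_subgroup) (simp add: carrier_FactGroup)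
  then interpret M: normal "?k ` nabla G" "Q Mod K" .
  \<comment> \<open>the quotient of \<open>Q\<close> by the product of \<open>K\<close> and \<open>nabla G\<close>\<close>
  let ?P = "(Q Mod K) Mod (?k ` nabla G)"
  let ?m = "\<lambda>C. (?k ` nabla G) #>\<^bsub>Q Mod K\<^esub> C"
  let ?b = "\<lambda>x y. ?m (?k (tensor G x y))"
  have P: "group ?P" by (rule M.factorgroup_is_group)
  have m: "?m \<in> hom (Q Mod K) ?P" by (rule M.r_coset_hom_Mod)
  have pair: "tensor_pairing G ?P ?b"
    using tensor_pairing_hom[OF is_group tensor_pairing_hom[OF is_group tensor_pairing_tensor[OF is_group] k] m] .
  then interpret pairing G ?P ?b
    using is_group P by (simp add: pairing_def pairing_axioms_def)
  have one: "?m (?k t) = \<one>\<^bsub>?P\<^esub> \<longleftrightarrow> ?k t \<in> ?k ` nabla G" if "t \<in> carrier Q" for t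
    using that group.rcos_eq_self_iff[OF QK M.subgroup_axioms] by (simp add: carrier_FactGroup)
  have fin: "finite_p_group p ?P"
    by (rule finite_p_group_epi[OF prime _ P m]) (use K(1) in \<open>simp_all add: \<K>_iff carrier_FactGroup\<close>)
  have alt: "?b a a = \<one>\<^bsub>?P\<^esub>" if "a \<in> carrier G" for a
  proof -
    have "tensor G a a \<in> nabla G" using that by (auto simp: nabla_def intro: generate.incl)
    thus ?thesis using one[OF cl[OF that that]] by blast
  qed
  obtain N where N: "N \<in> \<P>" "N \<times> carrier G \<subseteq> {(n, y). ?b n y = \<one>\<^bsub>?P\<^esub>}"
  proof (rule tube)
    fix y assume y: "y \<in> carrier G"
    let ?U = "{(x', y'). x' \<in> carrier G \<and> y' \<in> carrier G \<and> ?k (tensor G x' y') = ?k (tensor G \<one> y)}"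
    have "?U \<subseteq> {(n, y). ?b n y = \<one>\<^bsub>?P\<^esub>}" using one_left[OF y] by auto
    moreover have "openin (prod_topology T T) ?U" "(\<one>, y) \<in> ?U" using K(1) y by (auto simp: \<K>_iff)
    ultimately show "\<exists>U V. openin T U \<and> openin T V \<and> \<one> \<in> U \<and> y \<in> V \<and> U \<times> V \<subseteq> {(n, y). ?b n y = \<one>\<^bsub>?P\<^esub>}"
    proof -
      assume 1: "?U \<subseteq> {(n, y). ?b n y = \<one>\<^bsub>?P\<^esub>}"
      assume "openin (prod_topology T T) ?U" and "(\<one>, y) \<in> ?U"
      then obtain A B where "openin T A" "openin T B" "\<one> \<in> A" "y \<in> B" "A \<times> B \<subseteq> ?U"
        by (rule openin_prod_topologyE)
      thus ?thesis using 1 by (intro exI[of _ A] exI[of _ B] conjI) (assumption | rule order_trans)+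
    qed
  qed blast
  have "\<exists>N\<in>\<P>. \<forall>n\<in>N. \<forall>y\<in>carrier G. ?b n y = \<one>\<^bsub>?P\<^esub>" using N by blast
  hence "alternating_pairing G T p ?P ?b"
    by (intro alternating_pairing.intro pairing.intro alternating_pairing_axioms.intro
        pairing_axioms.intro pair fin alt pro_p_axioms is_group P)
  moreover have "?b x y \<noteq> \<one>\<^bsub>?P\<^esub>"
    using K(2) one[OF cl[OF xy]] by auto
  ultimately show ?thesis by (rule that)
qed

abbreviation annihilator :: "('a \<Rightarrow> 'a \<Rightarrow> bool) \<Rightarrow> 'a \<Rightarrow> 'a set" where
  "annihilator R x \<equiv> {y \<in> carrier G. R x y}"

abbreviation radical :: "('a \<Rightarrow> 'a \<Rightarrow> bool) \<Rightarrow> 'a set" where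
  "radical R \<equiv> {x \<in> carrier G. \<forall>y\<in>carrier G. R x y}"

text \<open>These relations are the open approximations of the relation \<open>x \<and> y = 1\<close>. Openness is the condition
  on the radical: each annihilator is a subgroup containing the radical, hence a union of its
  cosets.\<close>

definition exterior_relation :: "('a \<Rightarrow> 'a \<Rightarrow> bool) \<Rightarrow> bool" where
  "exterior_relation R \<longleftrightarrow>
     (\<forall>x\<in>carrier G. R x x) \<and>
     (\<forall>x\<in>carrier G. \<forall>y\<in>carrier G. R x y \<longrightarrow> R y x) \<and>
     (\<forall>x\<in>carrier G. subgroup (annihilator R x) G) \<and>
     radical R \<in> \<P> \<and>
     (\<forall>x\<in>carrier G. \<forall>y\<in>carrier G. wedge_trivial x y \<longrightarrow> R x y)"

lemma exterior_relation_conj: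
  assumes "exterior_relation R" "exterior_relation S"
  shows "exterior_relation (\<lambda>x y. R x y \<and> S x y)"
proof -
  have "subgroup {y \<in> carrier G. R x y \<and> S x y} G" if "x \<in> carrier G" for x
  proof -
    have "{y \<in> carrier G. R x y \<and> S x y} = {y \<in> carrier G. R x y} \<inter> {y \<in> carrier G. S x y}" by auto
    thus ?thesis using assms that subgroups_Inter_pair by (simp add: exterior_relation_def)
  qed
  moreover have "{x \<in> carrier G. \<forall>y\<in>carrier G. R x y \<and> S x y} =
      {x \<in> carrier G. \<forall>y\<in>carrier G. R x y} \<inter> {x \<in> carrier G. \<forall>y\<in>carrier G. S x y}" by auto
  ultimately show ?thesis using assms Int by (simp add: exterior_relation_def)
qed

end

context alternating_pairing
begin

text \<open>The expansion of \<open>b x (y z)\<close> contains conjugates of \<open>x\<close> and \<open>y\<close>, so that the elements \<open>y\<close> with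
  \<open>b x y = 1\<close> need not form a subgroup. They do once the condition is imposed on all simultaneous
  conjugates of \<open>x\<close> and \<open>y\<close>.\<close>

definition conj_kernel :: "'a \<Rightarrow> 'a \<Rightarrow> bool" where
  "conj_kernel x y \<longleftrightarrow> (\<forall>w\<in>carrier G. b (conj_by G x w) (conj_by G y w) = \<one>\<^bsub>P\<^esub>)"

lemma conj_kernelD: "conj_kernel x y \<Longrightarrow> x \<in> carrier G \<Longrightarrow> y \<in> carrier G \<Longrightarrow> b x y = \<one>\<^bsub>P\<^esub>"
  unfolding conj_kernel_def using conj_by_simps(2) one_closed by metis

lemma conj_kernel_conj:
  assumes "conj_kernel x y" "x \<in> carrier G" "y \<in> carrier G" "w \<in> carrier G"
  shows "conj_kernel (conj_by G x w) (conj_by G y w)"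
  using assms by (auto simp: conj_kernel_def conj_by_conj_by)

lemma conj_kernel_mult:
  assumes "conj_kernel x y" "conj_kernel x z" "x \<in> carrier G" "y \<in> carrier G" "z \<in> carrier G"
  shows "conj_kernel x (y \<otimes> z)"
  unfolding conj_kernel_def
proof
  fix w assume w: "w \<in> carrier G"
  have "b (conj_by G x w) (conj_by G (y \<otimes> z) w) =
      b (conj_by G x w) (conj_by G z w) \<otimes>\<^bsub>P\<^esub> b (conj_by G x (z \<otimes> w)) (conj_by G y (z \<otimes> w))"
    using assms w by (simp add: conj_by_mult mult_right conj_by_conj_by conj_by_swap)
  thus "b (conj_by G x w) (conj_by G (y \<otimes> z) w) = \<one>\<^bsub>P\<^esub>"
    using assms w by (simp add: conj_kernel_def)
qed

lemma conj_kernel_inv: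
  assumes "conj_kernel x y" "x \<in> carrier G" "y \<in> carrier G"
  shows "conj_kernel x (inv y)"
proof -
  have "conj_kernel (conj_by G x y) (inv y)"
    unfolding conj_kernel_def
  proof
    fix w assume w: "w \<in> carrier G"
    have 1: "b (conj_by G x w) (conj_by G (inv y) w \<otimes> conj_by G y w) =
        b (conj_by G x w) (conj_by G y w) \<otimes>\<^bsub>P\<^esub> b (conj_by G x (y \<otimes> w)) (conj_by G (inv y) (y \<otimes> w))"
      using assms w by (simp add: mult_right conj_by_conj_by conj_by_swap)
    have 2: "conj_by G (inv y) w \<otimes> conj_by G y w = \<one>"
      using assms w by (simp add: conj_by_inv)
    have 3: "conj_by G (inv y) (y \<otimes> w) = conj_by G (inv y) w"
      using assms w by (simp add: conj_by_def m_assoc inv_mult_group mult_inv_cancel)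
    have 4: "b (conj_by G x w) (conj_by G y w) = \<one>\<^bsub>P\<^esub>"
      using assms w by (simp add: conj_kernel_def)
    have "b (conj_by G x (y \<otimes> w)) (conj_by G (inv y) w) = \<one>\<^bsub>P\<^esub>"
      using 1 assms w unfolding 2 3 4 by simp
    thus "b (conj_by G (conj_by G x y) w) (conj_by G (inv y) w) = \<one>\<^bsub>P\<^esub>"
      using assms w by (simp add: conj_by_conj_by)
  qed
  hence "conj_kernel (conj_by G (conj_by G x y) (inv y)) (conj_by G (inv y) (inv y))"
    using assms by (intro conj_kernel_conj) auto
  thus ?thesis using assms by (simp add: conj_by_conj_by)
qed

lemma conj_kernel_exterior_relation: "exterior_relation conj_kernel"
  unfolding exterior_relation_def
proof (intro conjI ballI impI)
  fix x assume x: "x \<in> carrier G"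
  show "conj_kernel x x" using x alternating by (simp add: conj_kernel_def)
  show "conj_kernel y x" if "y \<in> carrier G" "conj_kernel x y" for y
    using that x symmetric by (simp add: conj_kernel_def)
  show "subgroup {y \<in> carrier G. conj_kernel x y} G"
  proof (rule subgroupI)
    have "conj_kernel x \<one>" using x by (simp add: conj_kernel_def)
    thus "{y \<in> carrier G. conj_kernel x y} \<noteq> {}" by blast
  qed (use x conj_kernel_mult conj_kernel_inv in auto)
  show "conj_kernel x y" if "y \<in> carrier G" "wedge_trivial x y" for y
    unfolding conj_kernel_def
  proof
    fix w assume "w \<in> carrier G"
    then interpret w: alternating_pairing G T p P "\<lambda>x y. b (conj_by G x w) (conj_by G y w)"
      by (rule conjugate)
    show "b (conj_by G x w) (conj_by G y w) = \<one>\<^bsub>P\<^esub>" using w.wedge_trivial_imp x that by blast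
  qed
next
  let ?Z = "{x \<in> carrier G. \<forall>y\<in>carrier G. conj_kernel x y}"
  have sym: "conj_kernel y x" if "x \<in> carrier G" "y \<in> carrier G" "conj_kernel x y" for x y
    using that symmetric by (simp add: conj_kernel_def)
  obtain N where N: "N \<in> \<P>" "\<And>n y. n \<in> N \<Longrightarrow> y \<in> carrier G \<Longrightarrow> b n y = \<one>\<^bsub>P\<^esub>"
    using smooth by blast
  interpret N: normal N G using normal N(1) .
  have "N \<subseteq> ?Z"
    using N(2) N.inv_op_closed1 N.mem_carrier by (auto simp: conj_kernel_def conj_by_def[of _ _ _])
  moreover have "?Z \<lhd> G"
  proof (rule normal_invI)
    show "subgroup ?Z G"
    proof (rule subgroupI)
      have "conj_kernel \<one> y" if "y \<in> carrier G" for y using that by (simp add: conj_kernel_def)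
      thus "?Z \<noteq> {}" by blast
      show "inv x \<in> ?Z" if "x \<in> ?Z" for x using that sym conj_kernel_inv by simp
      show "x \<otimes> y \<in> ?Z" if "x \<in> ?Z" "y \<in> ?Z" for x y using that sym conj_kernel_mult by simp
    qed auto
    fix w x assume w: "w \<in> carrier G" and x: "x \<in> ?Z"
    have "conj_kernel (conj_by G x (inv w)) y" if "y \<in> carrier G" for y
    proof -
      have "conj_kernel (conj_by G x (inv w)) (conj_by G (conj_by G y w) (inv w))"
        using x w that by (intro conj_kernel_conj) auto
      thus ?thesis using w that by (simp add: conj_by_conj_by)
    qed
    thus "w \<otimes> x \<otimes> inv w \<in> ?Z" using w x by (simp add: conj_by_def)
  qed
  ultimately show "?Z \<in> \<P>" by (rule \<P>_mono[OF N(1)])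
qed

end

lemma (in pro_p) detecting_relation:
  assumes "x \<in> carrier G" "y \<in> carrier G" "\<not> wedge_trivial x y"
  obtains R where "exterior_relation R" "\<not> R x y"
proof -
  obtain P :: "('a \<times> 'a) gword set set set monoid" and b
    where "alternating_pairing G T p P b" and b: "b x y \<noteq> \<one>\<^bsub>P\<^esub>"
    using detecting_pairing[OF assms] by blast
  then interpret alternating_pairing G T p P b by simp
  show ?thesis using that[OF conj_kernel_exterior_relation] conj_kernelD b assms by blast
qed

section \<open>Haar measure and the degree of an exterior relation\<close>

context pro_p
begin

lemma exterior_relationD:
  assumes "exterior_relation R"
  shows "x \<in> carrier G \<Longrightarrow> R x x"
    and "x \<in> carrier G \<Longrightarrow> y \<in> carrier G \<Longrightarrow> R x y \<Longrightarrow> R y x"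
    and "x \<in> carrier G \<Longrightarrow> subgroup (annihilator R x) G"
    and "radical R \<in> \<P>"
    and "x \<in> carrier G \<Longrightarrow> y \<in> carrier G \<Longrightarrow> wedge_trivial x y \<Longrightarrow> R x y"
  using assms by (simp_all add: exterior_relation_def)

lemma radical_subset_annihilator:
  assumes "exterior_relation R" "x \<in> carrier G"
  shows "radical R \<subseteq> annihilator R x"
  using exterior_relationD(2)[OF assms(1)] assms(2) by auto

end

locale haar = pro_p G T p for G :: "('a, 'm) monoid_scheme" (structure) and T p +
  fixes \<mu> :: "'a measure"
  assumes haar: "normalized_haar G T \<mu>"
begin

lemma space_\<mu>: "space \<mu> = carrier G"
  using haar by (simp add: normalized_haar_def)

lemma open_sets_\<mu>: "openin T U \<Longrightarrow> U \<in> sets \<mu>"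
  using haar by (simp add: normalized_haar_def sigma_sets.Basic)

lemma translation: "g \<in> carrier G \<Longrightarrow> A \<in> sets \<mu> \<Longrightarrow> emeasure \<mu> (g <# A) = emeasure \<mu> A"
  using haar by (simp add: normalized_haar_def)

lemma total: "emeasure \<mu> (carrier G) = 1"
  using haar by (simp add: normalized_haar_def)

sublocale finite_measure \<mu>
  by (rule finite_measureI) (simp add: space_\<mu> total)

lemma rcos_sets: "N \<in> \<P> \<Longrightarrow> C \<in> carrier (G Mod N) \<Longrightarrow> C \<in> sets \<mu>"
  using open_sets_\<mu>[OF openin_rcos] by (auto simp: carrier_FactGroup)

text \<open>Translation invariance is assumed for left cosets; for a normal subgroup these are the right cosets.\<close>

lemma measure_rcos:
  assumes "N \<in> \<P>" "C \<in> carrier (G Mod N)"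
  shows "measure \<mu> C = measure \<mu> N"
proof -
  interpret N: normal N G using normal assms(1) .
  obtain x where x: "x \<in> carrier G" "C = N #> x" using assms(2) by (auto simp: carrier_FactGroup)
  have "N #> \<one> = N" using N.subset by simp
  hence "N \<in> carrier (G Mod N)" by (force simp: carrier_FactGroup)
  hence "emeasure \<mu> (x <# N) = emeasure \<mu> N" using translation x(1) rcos_sets assms(1) by blast
  thus ?thesis using N.coset_eq x by (simp add: measure_def)
qed

lemma measure_Union_rcos:
  assumes "N \<in> \<P>" "A \<subseteq> carrier (G Mod N)"
  shows "\<Union>A \<in> sets \<mu>" "measure \<mu> (\<Union>A) = card A / order (G Mod N)"
proof -
  have fin: "finite A" if "A \<subseteq> carrier (G Mod N)" for A
    using finite_quotient[OF assms(1)] that finite_subset by blast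
  have meas: "measure \<mu> (\<Union>A) = card A * measure \<mu> N" if A: "A \<subseteq> carrier (G Mod N)" for A
  proof -
    have "measure \<mu> (\<Union>C\<in>A. C) = (\<Sum>C\<in>A. measure \<mu> C)"
    proof (rule finite_measure_finite_Union[OF fin[OF A]])
      show "(\<lambda>C. C) ` A \<subseteq> sets \<mu>" using A rcos_sets[OF assms(1)] by auto
      show "disjoint_family_on (\<lambda>C. C) A"
        using rcos_disjoint[OF sub[OF assms(1)]] A
        by (auto simp: disjoint_family_on_def pairwise_def disjnt_def FactGroup_def)
    qed
    also have "\<dots> = (\<Sum>C\<in>A. measure \<mu> N)"
      using A measure_rcos[OF assms(1)] by (intro sum.cong) auto
    finally show ?thesis by simp
  qed
  show "\<Union>A \<in> sets \<mu>"
    using fin[OF assms(2)] assms(2) rcos_sets[OF assms(1)] by (intro sets.finite_Union) auto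
  have "\<Union> (carrier (G Mod N)) = carrier G"
    using rcosets_part_G[OF sub[OF assms(1)]] by (simp add: FactGroup_def)
  hence "order (G Mod N) * measure \<mu> N = 1"
    using meas[of "carrier (G Mod N)"] total by (simp add: order_def measure_def)
  hence "measure \<mu> N = 1 / order (G Mod N)"
    by (metis mult_zero_left nonzero_mult_div_cancel_left zero_neq_one)
  thus "measure \<mu> (\<Union>A) = card A / order (G Mod N)" using meas[OF assms(2)] by simp
qed

lemma order_pos: "N \<in> \<P> \<Longrightarrow> order (G Mod N) > 0"
  using \<P>_iff[of N] group.is_monoid monoid.order_gt_0_iff_finite finite_p_group_def by blast

lemma measure_kernel: "N \<in> \<P> \<Longrightarrow> measure \<mu> N = 1 / order (G Mod N)"
  using measure_Union_rcos(2)[of N "{N}"] rcosetsI[of N \<one>] subgroup.subset[OF sub, of N]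
  by (simp add: FactGroup_def)

lemma measure_saturated:
  assumes "N \<in> \<P>" "N \<subseteq> H" "subgroup H G"
  shows "H \<in> sets \<mu>" "measure \<mu> H = card ((#>) N ` H) / order (G Mod N)"
proof -
  interpret H: subgroup H G by fact
  have "\<Union> ((#>) N ` H) = H"
    using subgroup_saturated[OF assms(2,3)] rcos_self[OF H.mem_carrier sub[OF assms(1)]] by blast
  moreover have "(#>) N ` H \<subseteq> carrier (G Mod N)" using H.subset by (auto simp: carrier_FactGroup)
  ultimately show "H \<in> sets \<mu>" "measure \<mu> H = card ((#>) N ` H) / order (G Mod N)"
    using measure_Union_rcos[OF assms(1), of "(#>) N ` H"] by simp_all
qed

lemma p_gt_1: "real p > 1"
  using prime prime_gt_1_nat by auto

text \<open>The image of \<open>H\<close> in the finite \<open>p\<close>-group \<open>G/N\<close> has order a power of \<open>p\<close>.\<close>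

lemma measure_power:
  assumes "N \<in> \<P>" "N \<subseteq> H" "subgroup H G"
  obtains k :: nat where "measure \<mu> H = 1 / real p ^ k"
proof -
  interpret N: normal N G using normal assms(1) .
  interpret H: subgroup H G by fact
  have Q: "finite_p_group p (G Mod N)" using assms(1) by (simp add: \<P>_iff)
  then obtain n where n: "order (G Mod N) = p ^ n" by (auto simp: finite_p_group_def)
  have "group_hom G (G Mod N) ((#>) N)"
    using N.r_coset_hom_Mod N.factorgroup_is_group is_group by (simp add: group_hom_def group_hom_axioms_def)
  hence sub: "subgroup ((#>) N ` H) (G Mod N)"
    using group_hom.subgroup_img_is_subgroup assms(3) by blast
  then obtain j where j: "card ((#>) N ` H) = p ^ j"
    using finite_p_group_subgroup[OF prime Q sub] by (auto simp: finite_p_group_def order_def)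
  have "card ((#>) N ` H) \<le> order (G Mod N)"
    unfolding order_def by (rule card_mono[OF finite_quotient[OF assms(1)] subgroup.subset[OF sub]])
  hence "j \<le> n" using n j prime_gt_1_nat[OF prime] by simp
  hence "measure \<mu> H = 1 / real p ^ (n - j)"
    using measure_saturated(2)[OF assms] n j p_gt_1 by (simp add: power_diff)
  thus ?thesis by (rule that)
qed

text \<open>Measures of open subgroups are powers of \<open>1/p\<close>, so a proper inclusion costs a factor \<open>p\<close>.\<close>

lemma measure_psubset:
  assumes "N \<in> \<P>" "N \<subseteq> H" "subgroup H G" "subgroup K G" "H \<subset> K"
  shows "measure \<mu> H \<le> measure \<mu> K / p"
proof -
  have K: "N \<subseteq> K" using assms by blast
  obtain x where x: "x \<in> K" "x \<notin> H" using assms(5) by blast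
  have xG: "x \<in> carrier G" using x(1) assms(4) by (rule subgroup.mem_carrier[rotated])
  have "N #> x \<notin> (#>) N ` H"
  proof
    assume "N #> x \<in> (#>) N ` H"
    then obtain h where "h \<in> H" "N #> x = N #> h" by blast
    moreover have "x \<in> N #> x" using rcos_self[OF xG sub[OF assms(1)]] .
    ultimately show False using x(2) subgroup_saturated[OF assms(2,3)] by blast
  qed
  hence "(#>) N ` H \<subset> (#>) N ` K" using assms(5) x(1) by blast
  moreover have "finite ((#>) N ` K)"
    using finite_quotient[OF assms(1)] subgroup.subset[OF assms(4)] finite_subset[OF image_mono]
    unfolding carrier_FactGroup by blast
  ultimately have "card ((#>) N ` H) < card ((#>) N ` K)" by (rule psubset_card_mono[rotated])
  hence less: "measure \<mu> H < measure \<mu> K"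
    using measure_saturated(2)[OF assms(1-3)] measure_saturated(2)[OF assms(1) K assms(4)]
      order_pos[OF assms(1)] by (simp add: divide_strict_right_mono)
  obtain a where a: "measure \<mu> H = 1 / real p ^ a" using measure_power[OF assms(1-3)] .
  obtain b where b: "measure \<mu> K = 1 / real p ^ b" using measure_power[OF assms(1) K assms(4)] .
  have "real p ^ b < real p ^ a" using less a b p_gt_1 by (simp add: field_simps)
  hence "Suc b \<le> a" using p_gt_1 by (simp add: power_strict_increasing_iff)
  hence "real p ^ Suc b \<le> real p ^ a" using p_gt_1 by (intro power_increasing) auto
  thus ?thesis unfolding a b using p_gt_1 by (simp add: field_simps)
qed

lemma measure_carrier: "measure \<mu> (carrier G) = 1"
  using total by (simp add: measure_def)

lemma measure_proper:
  assumes "N \<in> \<P>" "N \<subseteq> H" "subgroup H G" "H \<noteq> carrier G"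
  shows "measure \<mu> H \<le> 1 / p"
  using measure_psubset[OF assms(1-3) subgroup_self] assms(4) subgroup.subset[OF assms(3)]
  by (auto simp: measure_carrier)

lemma annihilator_proper:
  assumes R: "exterior_relation R" and x: "x \<in> carrier G" "x \<notin> radical R"
  shows "radical R \<subset> annihilator R x" "annihilator R x \<noteq> carrier G"
    "measure \<mu> (annihilator R x) \<le> 1 / p" "measure \<mu> (radical R) \<le> measure \<mu> (annihilator R x) / p"
proof -
  note D = exterior_relationD[OF R]
  show 1: "radical R \<subset> annihilator R x"
    using radical_subset_annihilator[OF R x(1)] D(1)[OF x(1)] x by blast
  show 2: "annihilator R x \<noteq> carrier G" using x by blast
  show "measure \<mu> (annihilator R x) \<le> 1 / p"
    by (rule measure_proper[OF D(4) _ D(3)[OF x(1)] 2]) (use 1 in blast)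
  show "measure \<mu> (radical R) \<le> measure \<mu> (annihilator R x) / p"
    by (rule measure_psubset[OF D(4) _ sub[OF D(4)] D(3)[OF x(1)] 1]) blast
qed

text \<open>The radical has index at least \<open>p\<^sup>2\<close>: an element \<open>x\<close> outside of it has an annihilator that
  contains \<open>x\<close> and the radical and is not the whole group.\<close>

lemma measure_radical:
  assumes R: "exterior_relation R" and "radical R \<noteq> carrier G"
  shows "measure \<mu> (radical R) \<le> 1 / p\<^sup>2"
proof -
  obtain x where x: "x \<in> carrier G" "x \<notin> radical R" using assms(2) by blast
  have "measure \<mu> (radical R) \<le> (1 / p) / p"
    using annihilator_proper(3,4)[OF R x] p_gt_1 by (meson divide_right_mono le_less_trans not_le order_trans zero_le_one less_imp_le)
  thus ?thesis by (simp add: power2_eq_square)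
qed

definition degree :: "('a \<Rightarrow> 'a \<Rightarrow> bool) \<Rightarrow> real" where
  "degree R = measure (\<mu> \<Otimes>\<^sub>M \<mu>) {(x, y). x \<in> carrier G \<and> y \<in> carrier G \<and> R x y}"

text \<open>The annihilator of \<open>x\<close> depends only on the coset of \<open>x\<close> modulo the radical, so the relation is a
  finite union of rectangles.\<close>

lemma relation_sets:
  assumes R: "exterior_relation R"
  shows "{(x, y). x \<in> carrier G \<and> y \<in> carrier G \<and> R x y} \<in> sets (\<mu> \<Otimes>\<^sub>M \<mu>)"
proof -
  note D = exterior_relationD[OF R]
  let ?Z = "radical R"
  have same: "annihilator R x' = annihilator R x" if x: "x \<in> carrier G" "x' \<in> ?Z #> x" for x x'
  proof -
    obtain z where z: "z \<in> ?Z" "x' = z \<otimes> x" using x(2) by (auto simp: r_coset_def)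
    have zG: "z \<in> carrier G" using z(1) by blast
    have *: "R y (z \<otimes> x) \<longleftrightarrow> R y x" if y: "y \<in> carrier G" for y
    proof -
      have zA: "z \<in> annihilator R y" using radical_subset_annihilator[OF R y] z(1) by blast
      have 1: "x \<in> annihilator R y" if "z \<otimes> x \<in> annihilator R y"
      proof -
        have "inv z \<otimes> (z \<otimes> x) \<in> annihilator R y" by (rule subgroup.m_closed[OF D(3)[OF y] subgroup.m_inv_closed[OF D(3)[OF y] zA] that])
        thus ?thesis unfolding mult_inv_cancel(2)[OF zG x(1)] .
      qed
      have "z \<otimes> x \<in> annihilator R y \<longleftrightarrow> x \<in> annihilator R y"
        by (rule iffI[OF 1 subgroup.m_closed[OF D(3)[OF y] zA]])
      thus ?thesis using x(1) zG by simp
    qed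
    have x': "x' \<in> carrier G" using x(1) zG z(2) by simp
    have "R x' y \<longleftrightarrow> R x y" if y: "y \<in> carrier G" for y
      using *[OF y] D(2)[OF x(1) y] D(2)[OF y x(1)] D(2)[OF x' y] D(2)[OF y x'] z(2) by blast
    thus ?thesis by blast
  qed
  have "{(x, y). x \<in> carrier G \<and> y \<in> carrier G \<and> R x y} =
      (\<Union>A\<in>carrier (G Mod ?Z). A \<times> (\<Union>x\<in>A. annihilator R x))"
  proof (intro equalityI subsetI)
    fix w assume "w \<in> {(x, y). x \<in> carrier G \<and> y \<in> carrier G \<and> R x y}"
    then obtain x y where xy: "w = (x, y)" "x \<in> carrier G" "y \<in> carrier G" "R x y" by auto
    have "x \<in> ?Z #> x" using rcos_self[OF xy(2) sub[OF D(4)]] .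
    thus "w \<in> (\<Union>A\<in>carrier (G Mod ?Z). A \<times> (\<Union>x\<in>A. annihilator R x))"
      using xy by (auto simp: carrier_FactGroup)
  next
    fix w assume "w \<in> (\<Union>A\<in>carrier (G Mod ?Z). A \<times> (\<Union>x\<in>A. annihilator R x))"
    then obtain a x x' y where w: "w = (x, y)" "a \<in> carrier G" "x \<in> ?Z #> a" "x' \<in> ?Z #> a" "y \<in> annihilator R x'"
      by (auto simp: carrier_FactGroup)
    have "y \<in> annihilator R x"
      using w(5) unfolding same[OF w(2,4)] same[OF w(2,3)] .
    moreover have "x \<in> carrier G"
      using w(3) rcos_iff[OF sub[OF D(4)] w(2)] by simp
    ultimately show "w \<in> {(x, y). x \<in> carrier G \<and> y \<in> carrier G \<and> R x y}" using w(1) by simp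
  qed
  also have "\<dots> \<in> sets (\<mu> \<Otimes>\<^sub>M \<mu>)"
  proof (rule sets.finite_UN[OF finite_quotient[OF D(4)]])
    fix A assume A: "A \<in> carrier (G Mod ?Z)"
    then obtain a where a: "a \<in> carrier G" "A = ?Z #> a" by (auto simp: carrier_FactGroup)
    have "(\<Union>x\<in>A. annihilator R x) = annihilator R a"
      using same[OF a(1)] rcos_self[OF a(1) sub[OF D(4)]] unfolding a(2) by blast
    moreover have "annihilator R a \<in> sets \<mu>"
      using measure_saturated(1)[OF D(4) radical_subset_annihilator[OF R a(1)] D(3)[OF a(1)]] .
    ultimately show "A \<times> (\<Union>x\<in>A. annihilator R x) \<in> sets (\<mu> \<Otimes>\<^sub>M \<mu>)"
      using rcos_sets[OF D(4) A] by simp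
  qed
  finally show ?thesis .
qed

text \<open>Fubini's theorem, as the section of the relation over \<open>x\<close> is the annihilator of \<open>x\<close>.\<close>

lemma emeasure_relation:
  assumes R: "exterior_relation R"
  shows "emeasure (\<mu> \<Otimes>\<^sub>M \<mu>) {(x, y). x \<in> carrier G \<and> y \<in> carrier G \<and> R x y} =
    (\<integral>\<^sup>+x. ennreal (measure \<mu> (annihilator R x)) \<partial>\<mu>)"
proof -
  have "Pair x -` {(x, y). x \<in> carrier G \<and> y \<in> carrier G \<and> R x y} = annihilator R x" if "x \<in> carrier G" for x
    using that by auto
  thus ?thesis
    unfolding emeasure_pair_measure_alt[OF relation_sets[OF R]] emeasure_eq_measure
    by (intro nn_integral_cong) (simp add: space_\<mu>)
qed

lemma nn_integral_step:
  assumes Z: "Z \<in> sets \<mu>"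
  shows "(\<integral>\<^sup>+x. ennreal (1 / p + (1 - 1 / p) * indicator Z x) \<partial>\<mu>) =
    ennreal (1 / p + (1 - 1 / p) * measure \<mu> Z)"
proof -
  have ind: "integrable \<mu> (\<lambda>x. (1 - 1 / p) * indicator Z x :: real)"
    using Z by (intro integrable_mult_right integrable_real_indicator) (simp_all add: less_top[symmetric])
  have i: "integrable \<mu> (\<lambda>x. 1 / p + (1 - 1 / p) * indicator Z x :: real)"
    by (intro Bochner_Integration.integrable_add integrable_const ind)
  have "(\<integral>x. 1 / p + (1 - 1 / p) * indicator Z x \<partial>\<mu>) =
      (\<integral>x. 1 / p \<partial>\<mu>) + (\<integral>x. (1 - 1 / p) * indicator Z x \<partial>\<mu>)"
    by (rule Bochner_Integration.integral_add[OF integrable_const ind])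
  also have "\<dots> = 1 / p + (1 - 1 / p) * measure \<mu> Z"
    using measure_carrier space_\<mu> sets.sets_into_space[OF Z] by (simp add: Int_absorb2)
  finally have "(\<integral>x. 1 / p + (1 - 1 / p) * indicator Z x \<partial>\<mu>) = 1 / p + (1 - 1 / p) * measure \<mu> Z" .
  thus ?thesis
    using nn_integral_eq_integral[OF i] p_gt_1 by (simp add: divide_simps)
qed

lemma degree_le:
  assumes R: "exterior_relation R"
  shows "degree R \<le> 1 / p + (1 - 1 / p) * measure \<mu> (radical R)"
proof -
  note D = exterior_relationD[OF R]
  have Z: "radical R \<in> sets \<mu>" using rcos_sets[OF D(4)] measure_saturated(1)[OF D(4) order_refl sub[OF D(4)]] by blast
  have "emeasure (\<mu> \<Otimes>\<^sub>M \<mu>) {(x, y). x \<in> carrier G \<and> y \<in> carrier G \<and> R x y} \<le>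
      (\<integral>\<^sup>+x. ennreal (1 / p + (1 - 1 / p) * indicator (radical R) x) \<partial>\<mu>)"
    unfolding emeasure_relation[OF R]
  proof (rule nn_integral_mono, rule ennreal_leI)
    fix x assume x: "x \<in> space \<mu>"
    show "measure \<mu> (annihilator R x) \<le> 1 / p + (1 - 1 / p) * indicator (radical R) x"
    proof (cases "x \<in> radical R")
      case True
      hence "annihilator R x = carrier G" by blast
      thus ?thesis using True by (simp only: indicator_simps measure_carrier) simp
    next
      case False
      thus ?thesis using annihilator_proper(3)[OF R _ False] x space_\<mu> by simp
    qed
  qed
  hence "emeasure (\<mu> \<Otimes>\<^sub>M \<mu>) {(x, y). x \<in> carrier G \<and> y \<in> carrier G \<and> R x y} \<le>
      ennreal (1 / p + (1 - 1 / p) * measure \<mu> (radical R))"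
    by (simp only: nn_integral_step[OF Z])
  moreover have "0 \<le> 1 / p + (1 - 1 / p) * measure \<mu> (radical R)"
    using p_gt_1 by (simp add: divide_simps)
  ultimately show ?thesis
    unfolding degree_def measure_def[of "\<mu> \<Otimes>\<^sub>M \<mu>"] by (rule enn2real_leI[rotated])
qed

lemma degree_eq:
  assumes R: "exterior_relation R"
    and "\<And>x. x \<in> carrier G \<Longrightarrow> x \<notin> radical R \<Longrightarrow> measure \<mu> (annihilator R x) = 1 / p"
  shows "degree R = 1 / p + (1 - 1 / p) * measure \<mu> (radical R)"
proof -
  note D = exterior_relationD[OF R]
  have Z: "radical R \<in> sets \<mu>" using measure_saturated(1)[OF D(4) order_refl sub[OF D(4)]] by blast
  have "measure \<mu> (annihilator R x) = 1 / p + (1 - 1 / p) * indicator (radical R) x"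
    if x: "x \<in> space \<mu>" for x
  proof (cases "x \<in> radical R")
    case True
    hence "annihilator R x = carrier G" by blast
    thus ?thesis using True by (simp only: indicator_simps measure_carrier) simp
  next
    case False
    thus ?thesis using assms(2)[OF _ False] x space_\<mu> by simp
  qed
  hence "emeasure (\<mu> \<Otimes>\<^sub>M \<mu>) {(x, y). x \<in> carrier G \<and> y \<in> carrier G \<and> R x y} =
      ennreal (1 / p + (1 - 1 / p) * measure \<mu> (radical R))"
    unfolding emeasure_relation[OF R] nn_integral_step[OF Z, symmetric]
    by (intro nn_integral_cong) simp
  thus ?thesis
    unfolding degree_def measure_def[of "\<mu> \<Otimes>\<^sub>M \<mu>"] using p_gt_1 by (simp add: divide_simps)
qed

lemma ext_degree_def':
  "ext_degree p G T \<mu> =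
     measure (completion (\<mu> \<Otimes>\<^sub>M \<mu>)) {(x, y). x \<in> carrier G \<and> y \<in> carrier G \<and> wedge_trivial x y}"
  by (simp add: ext_degree_def wedge_trivial_def)

text \<open>If the relation \<open>x \<and> y = 1\<close> is not measurable, its \<open>emeasure\<close> is \<open>0\<close>; in both cases it is bounded
  by that of the larger measurable relation.\<close>

lemma ext_degree_le_degree:
  assumes R: "exterior_relation R"
  shows "ext_degree p G T \<mu> \<le> degree R"
proof -
  let ?W = "{(x, y). x \<in> carrier G \<and> y \<in> carrier G \<and> wedge_trivial x y}"
  let ?V = "{(x, y). x \<in> carrier G \<and> y \<in> carrier G \<and> R x y}"
  have V: "?V \<in> sets (\<mu> \<Otimes>\<^sub>M \<mu>)" by (rule relation_sets[OF R])
  have "?W \<subseteq> ?V" using exterior_relationD(5)[OF R] by auto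
  hence "emeasure (completion (\<mu> \<Otimes>\<^sub>M \<mu>)) ?W \<le> emeasure (completion (\<mu> \<Otimes>\<^sub>M \<mu>)) ?V"
    using V by (intro emeasure_mono) auto
  moreover have "emeasure (completion (\<mu> \<Otimes>\<^sub>M \<mu>)) ?V < Orderings.top_class.top"
  proof -
    interpret P: finite_measure "\<mu> \<Otimes>\<^sub>M \<mu>"
      by (intro finite_measure_pair_measure finite_measure_axioms)
    show ?thesis using V by (simp add: less_top[symmetric])
  qed
  ultimately have "measure (completion (\<mu> \<Otimes>\<^sub>M \<mu>)) ?W \<le> measure (completion (\<mu> \<Otimes>\<^sub>M \<mu>)) ?V"
    unfolding measure_def by (rule enn2real_mono)
  thus ?thesis using V by (simp add: ext_degree_def' degree_def)
qed

lemma ext_degree_le: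
  assumes "exterior_relation R" "measure \<mu> (radical R) \<le> c"
  shows "ext_degree p G T \<mu> \<le> 1 / p + (1 - 1 / p) * c"
proof -
  have "(1 - 1 / real p) * measure \<mu> (radical R) \<le> (1 - 1 / real p) * c"
    using assms(2) p_gt_1 by (intro mult_left_mono) auto
  thus ?thesis using ext_degree_le_degree[OF assms(1)] degree_le[OF assms(1)] by linarith
qed

lemma cext_center_eq: "cext_center p G T = radical wedge_trivial"
  by (simp add: cext_center_def wedge_trivial_def)

end

section \<open>The case of equality\<close>

lemma (in group) coprime_pow_mem:
  assumes "subgroup H G" "x \<in> carrier G" "x [^] (i::int) \<in> H" "x [^] (j::int) \<in> H" "coprime i j"
  shows "x \<in> H"
proof -
  obtain u v where uv: "u * i + v * j = 1"
    using bezout_int[of i j] assms(5) by auto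
  have "(x [^] i) [^] u \<otimes> (x [^] j) [^] v \<in> H"
    using assms subgroup_int_pow_closed[OF assms(1)] subgroup.m_closed[OF assms(1)] by blast
  also have "(x [^] i) [^] u \<otimes> (x [^] j) [^] v = x [^] (i * u + j * v)"
    using assms(2) by (simp add: int_pow_mult int_pow_pow)
  also have "i * u + j * v = 1" using uv by (simp add: mult.commute)
  finally show ?thesis using assms(2) by simp
qed

lemma (in pro_p) coprime_p_iff: "coprime (int p) j \<longleftrightarrow> \<not> int p dvd j"
  using prime prime_nat_int_transfer prime_imp_coprime[of "int p" j] coprime_common_divisor_int[of "int p" j "int p"]
    prime_gt_1_nat[OF prime] by auto

lemma (in pro_p) wedge_trivial_iff_relations:
  assumes "x \<in> carrier G" "y \<in> carrier G"
  shows "wedge_trivial x y \<longleftrightarrow> (\<forall>R. exterior_relation R \<longrightarrow> R x y)"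
  using assms detecting_relation[OF assms] exterior_relationD(5) by metis

lemma (in pro_p) exterior_relation_True: "exterior_relation (\<lambda>x y. True)"
  using carrier subgroup_self by (simp add: exterior_relation_def)

lemma (in pro_p) radical_wedge_trivial: "radical wedge_trivial = \<Inter> {radical R |R. exterior_relation R}"
proof (intro equalityI subsetI)
  fix x assume "x \<in> radical wedge_trivial"
  thus "x \<in> \<Inter> {radical R |R. exterior_relation R}" using exterior_relationD(5) by blast
next
  fix x assume x: "x \<in> \<Inter> {radical R |R. exterior_relation R}"
  hence R: "x \<in> radical R" if "exterior_relation R" for R using that by blast
  hence "x \<in> carrier G" using exterior_relation_True by blast
  thus "x \<in> radical wedge_trivial" using R wedge_trivial_iff_relations by blast
qed

lemma (in pro_p) subgroup_radical_wedge_trivial: "subgroup (radical wedge_trivial) G"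
  unfolding radical_wedge_trivial
  using exterior_relation_True exterior_relationD(4) sub by (intro subgroups_Inter) auto

text \<open>The case of equality: every proper radical has the largest measure that \<open>measure_radical\<close> admits.
  As exterior relations are closed under conjunction, all proper radicals then coincide.\<close>

locale minimal_index = haar +
  fixes R
  assumes R: "exterior_relation R" and nontrivial: "radical R \<noteq> carrier G"
    and minimal: "\<And>S. exterior_relation S \<Longrightarrow> radical S \<noteq> carrier G \<Longrightarrow> 1 / p\<^sup>2 \<le> measure \<mu> (radical S)"
begin

lemma measure_R: "measure \<mu> (radical R) = 1 / p\<^sup>2"
  using measure_radical[OF R nontrivial] minimal[OF R nontrivial] by simp

lemma order_quotient: "order (G Mod radical R) = p\<^sup>2"
proof -
  note ZP = exterior_relationD(4)[OF R]
  have "1 / real (order (G Mod radical R)) = 1 / real (p\<^sup>2)"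
    using measure_kernel[OF ZP] unfolding measure_R by simp
  hence "real (order (G Mod radical R)) = real (p\<^sup>2)" by (simp only: divide_cancel_left) simp
  thus ?thesis by (simp only: of_nat_eq_iff)
qed

lemma radical_conj:
  assumes S: "exterior_relation S"
  shows "radical (\<lambda>x y. R x y \<and> S x y) = radical R"
proof (rule ccontr)
  assume neq: "radical (\<lambda>x y. R x y \<and> S x y) \<noteq> radical R"
  have RS: "exterior_relation (\<lambda>x y. R x y \<and> S x y)" by (rule exterior_relation_conj[OF R S])
  have sub': "radical (\<lambda>x y. R x y \<and> S x y) \<subset> radical R" using neq by blast
  have "measure \<mu> (radical (\<lambda>x y. R x y \<and> S x y)) \<le> measure \<mu> (radical R) / p"
    using measure_psubset[OF exterior_relationD(4)[OF RS] order_refl sub sub sub']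
      exterior_relationD(4)[OF RS] exterior_relationD(4)[OF R] by blast
  moreover have "1 / p\<^sup>2 \<le> measure \<mu> (radical (\<lambda>x y. R x y \<and> S x y))"
    by (rule minimal[OF RS]) (use sub' in blast)
  ultimately have "1 / real p ^ 2 \<le> 1 / real p ^ 2 / p" using measure_R by simp
  thus False using p_gt_1 by (simp add: field_simps)
qed

lemma radical_wedge_trivial_eq: "radical wedge_trivial = radical R"
proof
  show "radical wedge_trivial \<subseteq> radical R" using exterior_relationD(5)[OF R] by blast
  have "radical R \<subseteq> radical S" if "exterior_relation S" for S
    using radical_conj[OF that] by blast
  thus "radical R \<subseteq> radical wedge_trivial" unfolding radical_wedge_trivial by blast
qed

lemma measure_annihilator:
  assumes "x \<in> carrier G" "x \<notin> radical R"
  shows "measure \<mu> (annihilator R x) = 1 / p"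
proof -
  have "1 / p\<^sup>2 \<le> measure \<mu> (annihilator R x) / p"
    using annihilator_proper(4)[OF R assms] measure_R by simp
  hence "1 / p \<le> measure \<mu> (annihilator R x)" using p_gt_1 by (simp add: field_simps power2_eq_square)
  thus ?thesis using annihilator_proper(3)[OF R assms] by simp
qed

text \<open>For \<open>x\<close> outside of the radical the annihilators have index \<open>p\<close>, so passing to a smaller relation does not change them.\<close>

lemma R_imp_wedge_trivial:
  assumes xy: "x \<in> carrier G" "y \<in> carrier G" and Rxy: "R x y"
  shows "wedge_trivial x y"
proof (cases "x \<in> radical R")
  case True
  thus ?thesis using radical_wedge_trivial_eq xy by blast
next
  case False
  have "S x y" if S: "exterior_relation S" for S
  proof (rule ccontr)
    assume "\<not> S x y"
    let ?RS = "\<lambda>x y. R x y \<and> S x y"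
    have RS: "exterior_relation ?RS" by (rule exterior_relation_conj[OF R S])
    have x: "x \<notin> radical ?RS" unfolding radical_conj[OF S] by (rule False)
    have "annihilator ?RS x \<subset> annihilator R x" using \<open>\<not> S x y\<close> xy Rxy by blast
    hence "measure \<mu> (annihilator ?RS x) \<le> measure \<mu> (annihilator R x) / p"
      using measure_psubset[OF exterior_relationD(4)[OF RS] radical_subset_annihilator[OF RS xy(1)]
          exterior_relationD(3)[OF RS xy(1)] exterior_relationD(3)[OF R xy(1)]] by blast
    moreover have "measure \<mu> (radical ?RS) \<le> measure \<mu> (annihilator ?RS x) / p"
      by (rule annihilator_proper(4)[OF RS xy(1) x])
    ultimately have "1 / p\<^sup>2 \<le> 1 / p / p / p"
      unfolding radical_conj[OF S] measure_R measure_annihilator[OF xy(1) False]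
      using p_gt_1 by (smt (verit) divide_right_mono)
    thus False using p_gt_1 by (simp add: field_simps power2_eq_square)
  qed
  thus ?thesis using wedge_trivial_iff_relations[OF xy] by blast
qed

lemma ext_degree_eq: "ext_degree p G T \<mu> = (real p ^ 2 + real p - 1) / real p ^ 3"
proof -
  have "{(x, y). x \<in> carrier G \<and> y \<in> carrier G \<and> wedge_trivial x y} =
      {(x, y). x \<in> carrier G \<and> y \<in> carrier G \<and> R x y}"
    using R_imp_wedge_trivial exterior_relationD(5)[OF R] by auto
  hence "ext_degree p G T \<mu> = degree R"
    using relation_sets[OF R] by (simp add: ext_degree_def' degree_def)
  also have "\<dots> = 1 / p + (1 - 1 / p) * (1 / p\<^sup>2)"
    using degree_eq[OF R measure_annihilator] measure_R by simp
  also have "\<dots> = (real p ^ 2 + real p - 1) / real p ^ 3"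
    using p_gt_1 by (simp add: field_simps power2_eq_square power3_eq_cube)
  finally show ?thesis .
qed

text \<open>For \<open>x\<close> outside of the radical, the annihilator of \<open>x\<close> modulo the radical has order \<open>p\<close> and contains the coset of \<open>x\<close>.\<close>

lemma pow_p_in_radical:
  assumes x: "x \<in> carrier G"
  shows "x [^] p \<in> radical R"
proof (cases "x \<in> radical R")
  case True
  thus ?thesis
    using subgroup_int_pow_closed[OF sub[OF exterior_relationD(4)[OF R]] True, of "int p"]
    by (simp only: int_pow_int)
next
  case False
  let ?Z = "radical R" and ?H = "annihilator R x"
  have ZP: "?Z \<in> \<P>" by (rule exterior_relationD(4)[OF R])
  note Z = normal[OF ZP]
  note A = normal.factorgroup_is_group[OF Z]
  have H: "subgroup ?H G" "?Z \<subseteq> ?H"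
    using exterior_relationD(3)[OF R x] radical_subset_annihilator[OF R x] by blast+
  let ?K = "(#>) ?Z ` ?H"
  have "group_hom G (G Mod ?Z) ((#>) ?Z)"
    by (intro group_hom.intro group_hom_axioms.intro is_group A normal.r_coset_hom_Mod[OF Z])
  hence K: "subgroup ?K (G Mod ?Z)" by (rule group_hom.subgroup_img_is_subgroup[OF _ H(1)])
  have "real (card ?K) = real p"
    using measure_saturated(2)[OF ZP H(2,1)] measure_annihilator[OF x False] p_gt_1
    unfolding order_quotient by (simp add: field_simps power2_eq_square)
  hence card: "card ?K = p" by simp
  interpret K: group "(G Mod ?Z)\<lparr>carrier := ?K\<rparr>"
    using group.subgroup_imp_group[OF A K] .
  have "x \<in> ?H" using x exterior_relationD(1)[OF R x] by blast
  hence "(?Z #> x) [^]\<^bsub>(G Mod ?Z)\<lparr>carrier := ?K\<rparr>\<^esub> order ((G Mod ?Z)\<lparr>carrier := ?K\<rparr>) =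
      \<one>\<^bsub>(G Mod ?Z)\<lparr>carrier := ?K\<rparr>\<^esub>"
    by (intro K.pow_order_eq_1) simp
  hence "(?Z #> x) [^]\<^bsub>G Mod ?Z\<^esub> p = ?Z"
    using monoid.nat_pow_consistent[OF group.is_monoid[OF A], of "?Z #> x" p ?K]
    by (simp add: order_def card)
  hence "?Z #> (x [^] p) = ?Z" using normal.FactGroup_pow[OF Z x, of p] by simp
  thus ?thesis using rcos_eq_self_iff[OF normal_imp_subgroup[OF Z] nat_pow_closed[OF x]] by blast
qed

lemma root_closed:
  assumes H: "subgroup H G" "radical R \<subseteq> H" and x: "x \<in> carrier G"
    and j: "x [^] (j::int) \<in> H" "\<not> int p dvd j"
  shows "x \<in> H"
proof -
  have "x [^] int p \<in> H" using pow_p_in_radical[OF x] H(2) by (auto simp: int_pow_int)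
  thus ?thesis using coprime_pow_mem[OF H(1) x _ j(1)] coprime_p_iff j(2) by blast
qed

text \<open>The quotient is elementary abelian of order \<open>p\<^sup>2\<close>. A basis is given by \<open>g\<close> outside of the radical and
  \<open>h\<close> outside of the annihilator of \<open>g\<close>: if \<open>g\<^sup>i h\<^sup>j\<close> lies in the radical, it annihilates \<open>g\<close>, hence
  so does \<open>h\<^sup>j\<close>, and \<open>p\<close> divides \<open>j\<close>.\<close>

lemma quotient_iso:
  assumes ab: "comm_group G"
  shows "G Mod radical R \<cong> integer_mod_group p \<times>\<times> integer_mod_group p"
proof -
  let ?Z = "radical R"
  let ?A = "G Mod ?Z" and ?C = "integer_mod_group p \<times>\<times> integer_mod_group p"
  have ZP: "?Z \<in> \<P>" by (rule exterior_relationD(4)[OF R])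
  have Zsub: "subgroup ?Z G" by (rule sub[OF ZP])
  have Z: "?Z \<lhd> G" by (rule normal[OF ZP])
  interpret A: comm_group ?A using comm_group.abelian_FactGroup[OF ab Zsub] .
  obtain g where g: "g \<in> carrier G" "g \<notin> ?Z" using nontrivial by blast
  then obtain h where h: "h \<in> carrier G" "h \<notin> annihilator R g" by blast
  let ?a = "?Z #> g" and ?b = "?Z #> h"
  have aA: "?a \<in> carrier ?A" "?b \<in> carrier ?A" using g h by (auto simp: carrier_FactGroup)
  have red: "(?Z #> x) [^]\<^bsub>?A\<^esub> (i mod int p) = (?Z #> x) [^]\<^bsub>?A\<^esub> i"
    if x: "x \<in> carrier G" for x and i :: int
  proof -
    have xA: "?Z #> x \<in> carrier ?A" using x by (auto simp: carrier_FactGroup)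
    have "(?Z #> x) [^]\<^bsub>?A\<^esub> p = ?Z #> (x [^] p)" using normal.FactGroup_pow[OF Z x] .
    also have "\<dots> = ?Z"
      using rcos_eq_self_iff[OF Zsub nat_pow_closed[OF x]] pow_p_in_radical[OF x] by blast
    finally have p1: "(?Z #> x) [^]\<^bsub>?A\<^esub> int p = \<one>\<^bsub>?A\<^esub>" by (simp add: int_pow_int)
    have "(?Z #> x) [^]\<^bsub>?A\<^esub> i = (?Z #> x) [^]\<^bsub>?A\<^esub> (int p * (i div int p) + i mod int p)" by simp
    also have "\<dots> = ((?Z #> x) [^]\<^bsub>?A\<^esub> int p) [^]\<^bsub>?A\<^esub> (i div int p) \<otimes>\<^bsub>?A\<^esub> (?Z #> x) [^]\<^bsub>?A\<^esub> (i mod int p)"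
      unfolding A.int_pow_mult[OF xA] A.int_pow_pow[OF xA] ..
    also have "\<dots> = (?Z #> x) [^]\<^bsub>?A\<^esub> (i mod int p)"
      unfolding p1 A.int_pow_one using A.l_one[OF A.int_pow_closed[OF xA]] .
    finally show ?thesis by simp
  qed
  let ?\<phi> = "\<lambda>(i, j). ?a [^]\<^bsub>?A\<^esub> (i::int) \<otimes>\<^bsub>?A\<^esub> ?b [^]\<^bsub>?A\<^esub> (j::int)"
  have C: "group ?C" by (rule DirProd_group) simp_all
  have hom: "?\<phi> \<in> hom ?C ?A"
  proof (rule homI)
    fix u assume "u \<in> carrier ?C"
    show "?\<phi> u \<in> carrier ?A"
      unfolding case_prod_unfold by (intro A.m_closed A.int_pow_closed aA)
  next
    fix u v assume "u \<in> carrier ?C" "v \<in> carrier ?C"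
    obtain i j k l where uv: "u = (i, j)" "v = (k, l)" by (cases u, cases v)
    have "?\<phi> (u \<otimes>\<^bsub>?C\<^esub> v) = ?a [^]\<^bsub>?A\<^esub> (i + k) \<otimes>\<^bsub>?A\<^esub> ?b [^]\<^bsub>?A\<^esub> (j + l)"
      by (simp only: uv mult_DirProd case_prod_conv mult_integer_mod_group red[OF g(1)] red[OF h(1)])
    also have "\<dots> = (?a [^]\<^bsub>?A\<^esub> i \<otimes>\<^bsub>?A\<^esub> ?a [^]\<^bsub>?A\<^esub> k) \<otimes>\<^bsub>?A\<^esub> (?b [^]\<^bsub>?A\<^esub> j \<otimes>\<^bsub>?A\<^esub> ?b [^]\<^bsub>?A\<^esub> l)"
      by (simp only: A.int_pow_mult aA)
    also have "\<dots> = ?\<phi> u \<otimes>\<^bsub>?A\<^esub> ?\<phi> v"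
      unfolding uv case_prod_conv
      by (simp only: A.m_ac A.int_pow_closed aA A.m_closed)
    finally show "?\<phi> (u \<otimes>\<^bsub>?C\<^esub> v) = ?\<phi> u \<otimes>\<^bsub>?A\<^esub> ?\<phi> v" .
  qed
  have small: "i = 0" if "i \<in> {0..<int p}" "int p dvd i" for i
    using that zdvd_imp_le[of "int p" i] by force
  have "(i, j) = (0, 0)" if ij: "i \<in> {0..<int p}" "j \<in> {0..<int p}" "?\<phi> (i, j) = ?Z" for i j
  proof -
    have gh: "g [^] i \<in> carrier G" "h [^] j \<in> carrier G" using g h by simp_all
    have "?\<phi> (i, j) = ?Z #> (g [^] i \<otimes> h [^] j)"
      using normal.rcos_sum[OF Z gh] normal.FactGroup_int_pow[OF Z g(1), of i]
        normal.FactGroup_int_pow[OF Z h(1), of j] by simp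
    hence mem: "g [^] i \<otimes> h [^] j \<in> ?Z"
      using ij(3) rcos_eq_self_iff[OF Zsub m_closed[OF gh]] by simp
    note H = exterior_relationD(3)[OF R g(1)] radical_subset_annihilator[OF R g(1)]
    have "g \<in> annihilator R g" using exterior_relationD(1)[OF R g(1)] g(1) by blast
    hence "inv (g [^] i) \<in> annihilator R g"
      using subgroup_int_pow_closed[OF H(1)] subgroup.m_inv_closed[OF H(1)] by blast
    hence "inv (g [^] i) \<otimes> (g [^] i \<otimes> h [^] j) \<in> annihilator R g"
      using mem H(2) subgroup.m_closed[OF H(1)] by blast
    hence "h [^] j \<in> annihilator R g" unfolding mult_inv_cancel(2)[OF gh] .
    hence j: "j = 0" using root_closed[OF H h(1)] h(2) small[OF ij(2)] by blast
    hence "g [^] i \<in> ?Z" using mem gh(1) by simp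
    hence "i = 0" using root_closed[OF Zsub order_refl g(1)] g(2) small[OF ij(1)] by blast
    thus ?thesis using j by simp
  qed
  hence inj: "inj_on ?\<phi> (carrier ?C)"
    using group_hom.inj_on_one_iff[of ?C ?A ?\<phi>] C hom A.is_group prime_gt_0_nat[OF prime]
    by (auto simp: group_hom_def group_hom_axioms_def carrier_integer_mod_group)
  have "card (carrier ?A) = p\<^sup>2" using order_quotient by (simp only: order_def)
  moreover have "card (carrier ?C) = p\<^sup>2"
    using prime_gt_0_nat[OF prime] by (simp add: carrier_integer_mod_group power2_eq_square)
  ultimately have "card (?\<phi> ` carrier ?C) = card (carrier ?A)" by (simp only: card_image[OF inj])
  moreover have "?\<phi> ` carrier ?C \<subseteq> carrier ?A" by (rule hom_carrier[OF hom])
  ultimately have "?\<phi> ` carrier ?C = carrier ?A"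
    using finite_quotient[OF ZP] card_subset_eq by blast
  hence "?\<phi> \<in> iso ?C ?A" using hom inj by (simp add: iso_def bij_betw_def)
  thus ?thesis using group.iso_sym[OF C] is_isoI by blast
qed

end

context haar
begin

text \<open>A proper radical of measure less than \<open>1/p\<^sup>2\<close> would bound the degree strictly below the given value.\<close>

lemma ext_degree_bound_eq:
  assumes R: "exterior_relation R" "radical R \<noteq> carrier G"
    and eq: "ext_degree p G T \<mu> = (real p ^ 2 + real p - 1) / real p ^ 3"
  shows "minimal_index G T p \<mu> R"
proof -
  have "1 / p\<^sup>2 \<le> measure \<mu> (radical S)" if S: "exterior_relation S" "radical S \<noteq> carrier G" for S
  proof -
    have "(real p ^ 2 + real p - 1) / real p ^ 3 \<le> 1 / p + (1 - 1 / p) * measure \<mu> (radical S)"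
      using ext_degree_le[OF S(1) order_refl] eq by simp
    also have "(real p ^ 2 + real p - 1) / real p ^ 3 = 1 / p + (1 - 1 / p) * (1 / p\<^sup>2)"
      using p_gt_1 by (simp add: field_simps power2_eq_square power3_eq_cube)
    finally have "(1 - 1 / p) * (1 / p\<^sup>2) \<le> (1 - 1 / p) * measure \<mu> (radical S)" by simp
    moreover have "0 < 1 - 1 / real p" using p_gt_1 by simp
    ultimately show ?thesis by (simp only: mult_le_cancel_left_pos)
  qed
  thus ?thesis using haar_axioms R by (simp add: minimal_index_def minimal_index_axioms_def)
qed

text \<open>Every radical contains the exterior center, which has index \<open>p\<^sup>2\<close>, so its index is at most \<open>p\<^sup>2\<close>.\<close>

lemma iso_minimal_index:
  assumes R: "exterior_relation R" "radical R \<noteq> carrier G"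
    and iso: "G Mod radical wedge_trivial \<cong> integer_mod_group p \<times>\<times> integer_mod_group p"
  shows "minimal_index G T p \<mu> R"
proof -
  let ?C = "integer_mod_group p \<times>\<times> integer_mod_group p"
  obtain f where f: "bij_betw f (carrier (G Mod radical wedge_trivial)) (carrier ?C)"
    using iso by (auto simp: is_iso_def iso_def)
  have finC: "finite (carrier ?C)" "card (carrier ?C) = p\<^sup>2"
    using prime_gt_0_nat[OF prime] by (simp_all add: carrier_integer_mod_group power2_eq_square)
  have fin: "finite (carrier (G Mod radical wedge_trivial))" "card (carrier (G Mod radical wedge_trivial)) = p\<^sup>2"
    using finC bij_betw_finite[OF f] bij_betw_same_card[OF f] by simp_all
  have "1 / p\<^sup>2 \<le> measure \<mu> (radical S)" if S: "exterior_relation S" for S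
  proof -
    have SP: "radical S \<in> \<P>" by (rule exterior_relationD(4)[OF S])
    have sub': "radical wedge_trivial \<subseteq> radical S" using exterior_relationD(5)[OF S] by blast
    have "carrier (G Mod radical S) = (\<lambda>C. radical S <#> C) ` carrier (G Mod radical wedge_trivial)"
      using rcos_trans[OF is_group sub' subgroup_radical_wedge_trivial sub[OF SP]]
      by (auto simp: carrier_FactGroup image_iff)
    hence "order (G Mod radical S) \<le> p\<^sup>2"
      unfolding order_def using card_image_le[OF fin(1), of "\<lambda>C. radical S <#> C"] fin(2) by simp
    hence "real (order (G Mod radical S)) \<le> real (p\<^sup>2)" by (rule of_nat_mono)
    hence "1 / real (p\<^sup>2) \<le> 1 / real (order (G Mod radical S))"
      using order_pos[OF SP] prime_gt_0_nat[OF prime] by (intro divide_left_mono) simp_all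
    thus ?thesis unfolding measure_kernel[OF SP] by simp
  qed
  thus ?thesis using haar_axioms R by (simp add: minimal_index_def minimal_index_axioms_def)
qed

end

section \<open>Pairings from commutators and from characters\<close>

definition commutator :: "('a, 'm) monoid_scheme \<Rightarrow> 'a \<Rightarrow> 'a \<Rightarrow> 'a" where
  "commutator G x y = inv\<^bsub>G\<^esub> x \<otimes>\<^bsub>G\<^esub> conj_by G x y"

lemma (in group) commutator_closed [simp]:
  "x \<in> carrier G \<Longrightarrow> y \<in> carrier G \<Longrightarrow> commutator G x y \<in> carrier G"
  by (simp add: commutator_def)

lemma (in group) commutator_eq_one_iff:
  assumes "x \<in> carrier G" "y \<in> carrier G"
  shows "commutator G x y = \<one> \<longleftrightarrow> x \<otimes> y = y \<otimes> x"
proof -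
  have "commutator G x y = \<one> \<longleftrightarrow> conj_by G x y = x"
    using assms by (metis commutator_def conj_by_closed inv_closed inv_inv inv_equality l_inv m_assoc r_one mult_inv_cancel(1))
  also have "\<dots> \<longleftrightarrow> x \<otimes> y = y \<otimes> x"
    using assms by (metis conj_by_closed conj_by_def conj_by_swap inv_closed m_assoc m_closed mult_inv_cancel(1) mult_inv_cancel(2))
  finally show ?thesis .
qed

lemma (in group) tensor_pairing_commutator: "tensor_pairing G G (commutator G)"
  unfolding tensor_pairing_def commutator_def
  by (auto simp: conj_by_def m_assoc inv_mult_group mult_inv_cancel)

context pro_p
begin

lemma alternating_pairing_commutator:
  assumes N: "N \<in> \<P>"
  shows "alternating_pairing G T p (G Mod N) (\<lambda>x y. N #> commutator G x y)"
proof (intro alternating_pairing.intro pairing.intro alternating_pairing_axioms.intro pairing_axioms.intro)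
  note n = normal[OF N]
  show "pro_p G T p" by (rule pro_p_axioms)
  show "group G" by (rule is_group)
  show "group (G Mod N)" by (rule normal.factorgroup_is_group[OF n])
  show "tensor_pairing G (G Mod N) (\<lambda>x y. N #> commutator G x y)"
    by (rule tensor_pairing_hom[OF is_group tensor_pairing_commutator normal.r_coset_hom_Mod[OF n]])
  show "finite_p_group p (G Mod N)" using N by (simp add: \<P>_iff)
  have one: "N #> commutator G x y = \<one>\<^bsub>G Mod N\<^esub>"
    if "commutator G x y \<in> N" for x y
    using that rcos_eq_self_iff[OF sub[OF N]] subgroup.subset[OF sub[OF N]] by auto
  show "N #> commutator G x x = \<one>\<^bsub>G Mod N\<^esub>" if "x \<in> carrier G" for x
    using that subgroup.one_closed[OF sub[OF N]] by (intro one) (simp add: commutator_def)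
  have "commutator G x y \<in> N" if "x \<in> N" "y \<in> carrier G" for x y
    using that normal.inv_op_closed1[OF n that(2,1)] subgroup.m_inv_closed[OF sub[OF N]]
      subgroup.m_closed[OF sub[OF N]] by (simp add: commutator_def conj_by_def)
  thus "\<exists>N'\<in>\<P>. \<forall>x\<in>N'. \<forall>y\<in>carrier G. N #> commutator G x y = \<one>\<^bsub>G Mod N\<^esub>"
    using N one by blast
qed

lemma wedge_trivial_imp_commutator:
  assumes "x \<in> carrier G" "y \<in> carrier G" "wedge_trivial x y"
  shows "commutator G x y = \<one>"
proof (rule Inter_\<P>)
  fix N assume N: "N \<in> \<P>"
  interpret c: alternating_pairing G T p "G Mod N" "\<lambda>x y. N #> commutator G x y"
    by (rule alternating_pairing_commutator[OF N])
  show "commutator G x y \<in> N"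
    using c.wedge_trivial_imp[OF assms] rcos_eq_self_iff[OF sub[OF N]] assms by simp
qed (use assms in simp)

lemma radical_wedge_trivial_subset_center: "radical wedge_trivial \<subseteq> group_center G"
proof
  fix g assume g: "g \<in> radical wedge_trivial"
  have "g \<otimes> x = x \<otimes> g" if "x \<in> carrier G" for x
    using wedge_trivial_imp_commutator[of g x] commutator_eq_one_iff[of g x] g that by blast
  thus "g \<in> group_center G" using g by (simp add: group_center_def)
qed

end

text \<open>The radical of the commutator pairing modulo a suitable \<open>N\<close> is a proper subgroup, of measure at most
  \<open>1/p\<^sup>2\<close>, and contains the center. A central element \<open>z\<close> outside of the exterior center is removed by a
  second relation, at the cost of another factor \<open>p\<close>.\<close>

lemma (in haar) nonabelian_bound:
  assumes nonab: "\<not> comm_group G" and neq: "radical wedge_trivial \<noteq> group_center G"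
  obtains R where "exterior_relation R" "measure \<mu> (radical R) \<le> 1 / real p ^ 3"
proof -
  obtain z where z: "z \<in> group_center G" "z \<notin> radical wedge_trivial"
    using neq radical_wedge_trivial_subset_center by blast
  have zG: "z \<in> carrier G" using z(1) by (simp add: group_center_def)
  have zc: "commutator G z y = \<one>" if "y \<in> carrier G" for y
    using z(1) that commutator_eq_one_iff[OF zG that] by (simp add: group_center_def)
  obtain y where y: "y \<in> carrier G" "\<not> wedge_trivial z y" using z(2) zG by blast
  obtain R where R: "exterior_relation R" "\<not> R z y" using detecting_relation[OF zG y] .
  obtain a c where ac: "a \<in> carrier G" "c \<in> carrier G" "a \<otimes> c \<noteq> c \<otimes> a"
    using nonab group_comm_groupI by blast
  have "commutator G a c \<noteq> \<one>" using commutator_eq_one_iff[OF ac(1,2)] ac(3) by simp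
  then obtain N where N: "N \<in> \<P>" "commutator G a c \<notin> N"
    using Inter_\<P>[OF commutator_closed[OF ac(1,2)]] by blast
  interpret c: alternating_pairing G T p "G Mod N" "\<lambda>x y. N #> commutator G x y"
    by (rule alternating_pairing_commutator[OF N(1)])
  let ?S = "c.conj_kernel"
  have S: "exterior_relation ?S" by (rule c.conj_kernel_exterior_relation)
  have "\<not> ?S a c"
  proof
    assume "?S a c"
    hence "N #> commutator G a c = N" using c.conj_kernelD ac by simp
    thus False using N(2) rcos_eq_self_iff[OF sub[OF N(1)]] ac by simp
  qed
  hence S_nontrivial: "radical ?S \<noteq> carrier G" using ac by blast
  have conj_z: "conj_by G z w = z" if "w \<in> carrier G" for w
  proof -
    have "z \<otimes> w = w \<otimes> z" using zc[OF that] commutator_eq_one_iff[OF zG that] by simp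
    thus ?thesis using zG that by (simp add: conj_by_def m_assoc mult_inv_cancel)
  qed
  have zS: "z \<in> radical ?S"
    using zG subgroup.subset[OF sub[OF N(1)]] by (simp add: c.conj_kernel_def conj_z zc)
  let ?RS = "\<lambda>x y. R x y \<and> ?S x y"
  have RS: "exterior_relation ?RS" by (rule exterior_relation_conj[OF R(1) S])
  have "radical ?RS \<subset> radical ?S" using zS R(2) y(1) by blast
  hence "measure \<mu> (radical ?RS) \<le> measure \<mu> (radical ?S) / p"
    by (rule measure_psubset[OF exterior_relationD(4)[OF RS] order_refl sub[OF exterior_relationD(4)[OF RS]]
          sub[OF exterior_relationD(4)[OF S]]])
  also have "\<dots> \<le> 1 / p\<^sup>2 / p"
    using measure_radical[OF S S_nontrivial] by (intro divide_right_mono) simp_all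
  also have "\<dots> = 1 / real p ^ 3" by (simp add: power2_eq_square power3_eq_cube)
  finally show ?thesis using RS that by blast
qed

text \<open>The continuous homomorphisms into \<open>\<int>/p\<close>, with values represented by integers.\<close>

definition (in pro_p) character :: "('a \<Rightarrow> int) \<Rightarrow> bool" where
  "character f \<longleftrightarrow> (\<forall>x\<in>carrier G. \<forall>y\<in>carrier G. int p dvd f (x \<otimes> y) - f x - f y) \<and>
     {x \<in> carrier G. int p dvd f x} \<in> \<P>"

lemma finite_p_group_integer_mod_group: "prime p \<Longrightarrow> finite_p_group p (integer_mod_group p)"
  using prime_gt_0_nat[of p]
  by (auto simp: finite_p_group_def order_def carrier_integer_mod_group intro!: exI[of _ 1])

text \<open>The pairing is the determinant \<open>f x * f' y - f' x * f y\<close>, which at the given \<open>x\<close> reduces to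
  \<open>- f' x * f y\<close>.\<close>

lemma (in pro_p) relation_of_characters:
  assumes ab: "comm_group G" and f: "character f" "character f'"
    and x: "x \<in> carrier G" "int p dvd f x" "\<not> int p dvd f' x"
    and y: "y \<in> carrier G" "\<not> int p dvd f y"
  obtains R where "exterior_relation R" "radical R \<noteq> carrier G"
proof -
  interpret ab: comm_group G by (rule ab)
  let ?b = "\<lambda>x y. (f x * f' y - f' x * f y) mod int p"
  have cj: "conj_by G x y = x" if "x \<in> carrier G" "y \<in> carrier G" for x y
    using that by (simp add: conj_by_def m_assoc ab.m_comm[of x y] mult_inv_cancel)
  have p: "int p > 0" using prime_gt_0_nat[OF prime] by simp
  have add: "int p dvd h (x \<otimes> y) - h x - h y"
    if "h \<in> {f, f'}" "x \<in> carrier G" "y \<in> carrier G" for h x y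
    using that f by (auto simp: character_def)
  have lin1: "?b (x \<otimes> y) z = (?b x z + ?b y z) mod int p"
    if "x \<in> carrier G" "y \<in> carrier G" for x y z
  proof -
    have "int p dvd (f (x \<otimes> y) - f x - f y) * f' z - (f' (x \<otimes> y) - f' x - f' y) * f z"
      by (rule dvd_diff[OF dvd_mult2[OF add] dvd_mult2[OF add]]) (use that in auto)
    hence "int p dvd (f (x \<otimes> y) * f' z - f' (x \<otimes> y) * f z) - (f x * f' z - f' x * f z + (f y * f' z - f' y * f z))"
      by (simp add: algebra_simps)
    thus ?thesis by (simp add: mod_eq_dvd_iff mod_add_eq)
  qed
  have skew: "?b x y = (- ?b y x) mod int p" for x y
    by (simp add: mod_minus_eq algebra_simps)
  have lin2: "?b y (t \<otimes> z) = (?b y z + ?b y t) mod int p"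
    if "t \<in> carrier G" "z \<in> carrier G" for y t z
  proof -
    have "?b y (t \<otimes> z) = (- (?b t y + ?b z y)) mod int p"
      unfolding skew[of y "t \<otimes> z"] lin1[OF that] by (simp add: mod_minus_eq)
    also have "\<dots> = ((- ?b z y) mod int p + (- ?b t y) mod int p) mod int p"
      by (simp only: mod_add_eq) (simp add: algebra_simps)
    finally show ?thesis unfolding skew[of y z] skew[of y t] .
  qed
  have ap: "alternating_pairing G T p (integer_mod_group p) ?b"
  proof (intro alternating_pairing.intro pairing.intro alternating_pairing_axioms.intro pairing_axioms.intro)
    show "pro_p G T p" by (rule pro_p_axioms)
    show "group G" by (rule is_group)
    show "group (integer_mod_group p)" by simp
    show "finite_p_group p (integer_mod_group p)" by (rule finite_p_group_integer_mod_group[OF prime])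
    show "tensor_pairing G (integer_mod_group p) ?b"
      unfolding tensor_pairing_def
    proof (intro conjI ballI)
      fix x y z assume xyz: "x \<in> carrier G" "y \<in> carrier G" "z \<in> carrier G"
      show "?b x y \<in> carrier (integer_mod_group p)" using p by (simp add: carrier_integer_mod_group)
      show "?b (x \<otimes> y) z = ?b (conj_by G x y) (conj_by G z y) \<otimes>\<^bsub>integer_mod_group p\<^esub> ?b y z"
        unfolding cj[OF xyz(1,2)] cj[OF xyz(3,2)] mult_integer_mod_group by (rule lin1[OF xyz(1,2)])
      show "?b x (z \<otimes> y) = ?b x y \<otimes>\<^bsub>integer_mod_group p\<^esub> ?b (conj_by G x y) (conj_by G z y)"
        unfolding cj[OF xyz(1,2)] cj[OF xyz(3,2)] mult_integer_mod_group by (rule lin2[OF xyz(3,2)])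
    qed
    show "?b x x = \<one>\<^bsub>integer_mod_group p\<^esub>" for x by simp
    let ?N = "{x \<in> carrier G. int p dvd f x} \<inter> {x \<in> carrier G. int p dvd f' x}"
    have "?N \<in> \<P>" using f by (intro Int) (simp_all add: character_def)
    moreover have "\<forall>n\<in>?N. \<forall>y\<in>carrier G. ?b n y = \<one>\<^bsub>integer_mod_group p\<^esub>" by simp
    ultimately show "\<exists>N\<in>\<P>. \<forall>n\<in>N. \<forall>y\<in>carrier G. ?b n y = \<one>\<^bsub>integer_mod_group p\<^esub>" by blast
  qed
  interpret b: alternating_pairing G T p "integer_mod_group p" ?b by (rule ap)
  have "?b x y \<noteq> 0"
  proof
    assume "?b x y = 0"
    hence "int p dvd f x * f' y - f' x * f y" by (simp add: dvd_eq_mod_eq_0)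
    hence "int p dvd f' x * f y" using x(2) by (metis dvd_diff_right_iff dvd_mult2 dvd_diffD1 dvd_diff_commute)
    thus False using x(3) y(2) prime by (simp add: prime_dvd_mult_iff)
  qed
  hence "\<not> b.conj_kernel x y" using b.conj_kernelD[of x y] x(1) y(1) by auto
  hence "radical b.conj_kernel \<noteq> carrier G" using x(1) y(1) by blast
  thus ?thesis using that b.conj_kernel_exterior_relation by blast
qed

section \<open>Abelian groups without alternating pairings\<close>

lemma (in pro_p) pow_p_mem:
  assumes "N \<in> \<P>"
  obtains n :: nat where "\<And>x. x \<in> carrier G \<Longrightarrow> x [^] int (p ^ n) \<in> N"
proof -
  note n = normal[OF assms]
  obtain n where n': "order (G Mod N) = p ^ n" using assms by (auto simp: \<P>_iff finite_p_group_def)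
  have "x [^] int (p ^ n) \<in> N" if x: "x \<in> carrier G" for x
  proof -
    have "(N #> x) [^]\<^bsub>G Mod N\<^esub> (p ^ n) = \<one>\<^bsub>G Mod N\<^esub>"
      using group.pow_order_eq_1[OF normal.factorgroup_is_group[OF n], of "N #> x"] x
      by (simp add: n' carrier_FactGroup)
    hence "N #> (x [^] (p ^ n)) = N" using normal.FactGroup_pow[OF n x, of "p ^ n"] by simp
    hence "x [^] (p ^ n) \<in> N" using rcos_eq_self_iff[OF sub[OF assms] nat_pow_closed[OF x]] by blast
    thus ?thesis by (simp only: int_pow_int)
  qed
  thus ?thesis by (rule that)
qed

lemma (in pro_p) coprime_one_minus: "coprime (1 - int p * k) (int (p ^ n))"
proof -
  have "coprime (1 - int p * k) (int p)"
    by (rule coprimeI) (metis dvd_add_right_iff dvd_mult2 diff_add_cancel dvd_trans)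
  thus ?thesis by simp
qed

locale abelian_haar = haar + comm_group G
begin

definition span :: "'a set \<Rightarrow> 'a \<Rightarrow> 'a set" where
  "span N h = {x \<in> carrier G. \<exists>k::int. x \<otimes> inv (h [^] k) \<in> N}"

lemma spanE:
  assumes "x \<in> span N h" "h \<in> carrier G"
  obtains k :: int and n where "n \<in> N" "x = n \<otimes> h [^] k"
proof -
  obtain k :: int where k: "x \<in> carrier G" "x \<otimes> inv (h [^] k) \<in> N" using assms by (auto simp: span_def)
  have "x = (x \<otimes> inv (h [^] k)) \<otimes> h [^] k" using k(1) assms(2) by (simp add: m_assoc)
  thus ?thesis using that k(2) by blast
qed

lemma spanI:
  assumes "n \<in> N" "subgroup N G" "h \<in> carrier G"
  shows "n \<otimes> h [^] (k::int) \<in> span N h"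
proof -
  have n: "n \<in> carrier G" by (rule subgroup.mem_carrier[OF assms(2,1)])
  have "n \<otimes> h [^] k \<otimes> inv (h [^] k) = n" using n assms(3) by (simp add: m_assoc)
  thus ?thesis
    unfolding span_def using n assms by (intro CollectI conjI exI[of _ k]) simp_all
qed

lemma subgroup_span:
  assumes N: "subgroup N G" and h: "h \<in> carrier G"
  shows "subgroup (span N h) G" "N \<subseteq> span N h" "h \<in> span N h"
proof -
  have eq: "span N h = N <#> generate G {h}"
  proof (intro equalityI subsetI)
    fix x assume "x \<in> span N h"
    then obtain k :: int and n where "n \<in> N" "x = n \<otimes> h [^] k" using spanE h by blast
    thus "x \<in> N <#> generate G {h}" by (auto simp: set_mult_def generate_pow[OF h])
  next
    fix x assume "x \<in> N <#> generate G {h}"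
    thus "x \<in> span N h" using spanI[OF _ N h] by (auto simp: set_mult_def generate_pow[OF h])
  qed
  show "subgroup (span N h) G"
    unfolding eq using h by (intro mult_subgroups N generate_is_subgroup) simp
  show "N \<subseteq> span N h"
    using spanI[OF _ N h, of _ 0] subgroup.mem_carrier[OF N] by fastforce
  show "h \<in> span N h"
    using spanI[OF subgroup.one_closed[OF N] N h, of 1] h by simp
qed

lemma span_subset:
  assumes "subgroup K G" "N \<subseteq> K" "h \<in> K"
  shows "span N h \<subseteq> K"
proof
  fix x assume "x \<in> span N h"
  then obtain k :: int and n where "n \<in> N" "x = n \<otimes> h [^] k"
    using spanE assms subgroup.mem_carrier by metis
  thus "x \<in> K" using assms subgroup_int_pow_closed[OF assms(1)] subgroup.m_closed[OF assms(1)] by blast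
qed

text \<open>A proper open subgroup lies in a maximal one, \<open>M\<close> say. For \<open>x\<close> outside of \<open>M\<close> the quotient
  \<open>G/M\<close> is generated by the coset of \<open>x\<close> and has order \<open>p\<close>, and the character maps \<open>m x\<^sup>i\<close> to \<open>i\<close>.\<close>

lemma character_exists:
  assumes N: "N \<in> \<P>" and H: "N \<subseteq> H" "subgroup H G" "H \<noteq> carrier G"
  obtains f x where "character f" "\<And>y. y \<in> H \<Longrightarrow> int p dvd f y" "x \<in> carrier G" "\<not> int p dvd f x"
proof -
  let ?P = "\<lambda>M. subgroup M G \<and> H \<subseteq> M \<and> M \<noteq> carrier G"
  have "?P H" using H by simp
  then obtain M where M: "subgroup M G" "H \<subseteq> M" "M \<noteq> carrier G"
    and least: "\<And>M'. ?P M' \<Longrightarrow> order (G Mod M) \<le> order (G Mod M')"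
    using ex_has_least_nat[of ?P H "\<lambda>M. order (G Mod M)"] by blast
  have P: "K \<in> \<P>" if "subgroup K G" "N \<subseteq> K" for K
    using \<P>_mono[OF N that(2)] that(1) subgroup_imp_normal by blast
  have MP: "M \<in> \<P>" using P M H by blast
  have maximal: "K = carrier G" if K: "subgroup K G" "M \<subset> K" for K
  proof (rule ccontr)
    assume "K \<noteq> carrier G"
    hence "order (G Mod M) \<le> order (G Mod K)" using K M least by blast
    moreover have KP: "K \<in> \<P>" using P K M H by blast
    ultimately have "measure \<mu> K \<le> measure \<mu> M"
      using order_pos[OF MP] order_pos[OF KP] by (simp add: measure_kernel[OF MP] measure_kernel[OF KP] frac_le)
    also have "measure \<mu> M \<le> measure \<mu> K / p"
      by (rule measure_psubset[OF MP order_refl M(1) K])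
    finally have "measure \<mu> K \<le> measure \<mu> K / p" .
    moreover have "measure \<mu> K > 0" using order_pos[OF KP] by (simp add: measure_kernel[OF KP])
    ultimately show False using p_gt_1 by (simp add: field_simps)
  qed
  obtain x where x: "x \<in> carrier G" "x \<notin> M" using M subgroup.subset[OF M(1)] by blast
  obtain n where n: "\<And>x. x \<in> carrier G \<Longrightarrow> x [^] int (p ^ n) \<in> M" using pow_p_mem[OF MP] by blast
  have full: "span M a = carrier G" if a: "a \<in> carrier G" "a \<notin> M" for a
    using maximal subgroup_span[OF M(1) a(1)] a(2) by blast
  have xp: "x [^] int p \<in> M"
  proof (rule ccontr)
    assume np: "x [^] int p \<notin> M"
    hence "x \<in> span M (x [^] int p)" using full[of "x [^] int p"] x(1) by simp
    then obtain k :: int where k: "x \<otimes> inv ((x [^] int p) [^] k) \<in> M" by (auto simp: span_def)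
    have "x \<otimes> inv ((x [^] int p) [^] k) = x [^] (1 - int p * k)"
      using x(1) by (simp add: int_pow_pow int_pow_diff)
    hence "x [^] (1 - int p * k) \<in> M" using k by simp
    moreover have "coprime (1 - int p * k) (int (p ^ n))"
      by (rule coprime_one_minus)
    ultimately show False using coprime_pow_mem[OF M(1) x(1) _ n[OF x(1)]] x(2) by blast
  qed
  have dvd: "x [^] i \<in> M \<longleftrightarrow> int p dvd i" for i :: int
  proof
    assume "x [^] i \<in> M"
    thus "int p dvd i" using coprime_pow_mem[OF M(1) x(1) xp] coprime_p_iff x(2) by blast
  next
    assume "int p dvd i"
    then obtain k where "i = int p * k" by blast
    thus "x [^] i \<in> M" using subgroup_int_pow_closed[OF M(1) xp, of k] x(1) by (simp add: int_pow_pow)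
  qed
  \<comment> \<open>\<open>f y\<close> is determined modulo \<open>p\<close>, by the equivalence just proved.\<close>
  define f where "f y = (SOME i::int. y \<otimes> inv (x [^] i) \<in> M)" for y
  have f: "y \<otimes> inv (x [^] f y) \<in> M" if "y \<in> carrier G" for y
  proof -
    have "\<exists>i::int. y \<otimes> inv (x [^] i) \<in> M" using full[OF x] that by (auto simp: span_def)
    thus ?thesis unfolding f_def by (rule someI_ex)
  qed
  have fM: "y \<in> M \<longleftrightarrow> int p dvd f y" if y: "y \<in> carrier G" for y
  proof -
    have eq: "y = (y \<otimes> inv (x [^] f y)) \<otimes> x [^] f y" using y x(1) by (simp add: m_assoc)
    have "y \<in> M \<longleftrightarrow> x [^] f y \<in> M"
    proof
      assume "y \<in> M"
      hence "inv (y \<otimes> inv (x [^] f y)) \<otimes> y \<in> M"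
        using f[OF y] subgroup.m_closed[OF M(1)] subgroup.m_inv_closed[OF M(1)] by blast
      also have "inv (y \<otimes> inv (x [^] f y)) \<otimes> y = x [^] f y"
        using y x(1) by (simp add: inv_mult_group m_assoc)
      finally show "x [^] f y \<in> M" .
    next
      assume "x [^] f y \<in> M"
      thus "y \<in> M" using eq f[OF y] subgroup.m_closed[OF M(1)] by metis
    qed
    thus ?thesis using dvd by blast
  qed
  have "character f"
    unfolding character_def
  proof (intro conjI ballI)
    have "{y \<in> carrier G. int p dvd f y} = M" using fM subgroup.subset[OF M(1)] by blast
    thus "{y \<in> carrier G. int p dvd f y} \<in> \<P>" using MP by simp
    fix y z assume yz: "y \<in> carrier G" "z \<in> carrier G"
    let ?X = "\<lambda>i::int. x [^] i"
    have "y \<otimes> inv ?X (f y) \<otimes> (z \<otimes> inv ?X (f z)) \<otimes> inv (y \<otimes> z \<otimes> inv ?X (f (y \<otimes> z))) \<in> M"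
      using f yz subgroup.m_closed[OF M(1)] subgroup.m_inv_closed[OF M(1)] by simp
    also have "y \<otimes> inv ?X (f y) \<otimes> (z \<otimes> inv ?X (f z)) \<otimes> inv (y \<otimes> z \<otimes> inv ?X (f (y \<otimes> z))) =
        (y \<otimes> z \<otimes> inv (y \<otimes> z)) \<otimes> (?X (f (y \<otimes> z)) \<otimes> inv ?X (f y) \<otimes> inv ?X (f z))"
    proof -
      have key: "y \<otimes> (z \<otimes> (inv y \<otimes> (inv z \<otimes> w))) = w" if "w \<in> carrier G" for w
        using yz that m_lcomm[of z "inv y" "inv z \<otimes> w"] by (simp add: mult_inv_cancel)
      show ?thesis using yz x(1) by (simp add: inv_mult_group m_ac key)
    qed
    also have "\<dots> = ?X (f (y \<otimes> z) - f y - f z)"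
      using yz x(1) by (simp add: int_pow_diff)
    finally show "int p dvd f (y \<otimes> z) - f y - f z" using dvd by blast
  qed
  thus ?thesis using that fM H(2) M(1,2) x subgroup.mem_carrier[OF H(2)] by blast
qed

text \<open>Distinct kernels of characters are excluded by \<open>relation_of_characters\<close>. So an element on which one
  character does not vanish lies in no kernel of a nontrivial character, hence in no proper open
  subgroup. If there are no nontrivial characters, \<open>G\<close> is trivial.\<close>

lemma procyclic:
  assumes triv: "\<And>R. exterior_relation R \<Longrightarrow> radical R = carrier G"
  obtains g where "g \<in> carrier G" "\<And>N. N \<in> \<P> \<Longrightarrow> span N g = carrier G"
proof (cases "\<exists>f x. character f \<and> x \<in> carrier G \<and> \<not> int p dvd f x")
  case True
  then obtain f g where fg: "character f" "g \<in> carrier G" "\<not> int p dvd f g" by blast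
  have "span N g = carrier G" if N: "N \<in> \<P>" for N
  proof (rule ccontr)
    assume neq: "span N g \<noteq> carrier G"
    note S = subgroup_span[OF sub[OF N] fg(2)]
    obtain f' y where f': "character f'" "\<And>y. y \<in> span N g \<Longrightarrow> int p dvd f' y"
      "y \<in> carrier G" "\<not> int p dvd f' y"
      using character_exists[OF N S(2,1) neq] by blast
    obtain R where "exterior_relation R" "radical R \<noteq> carrier G"
      using relation_of_characters[OF comm_group_axioms f'(1) fg(1,2) f'(2)[OF S(3)] fg(3) f'(3,4)] .
    thus False using triv by blast
  qed
  thus ?thesis using that fg(2) by blast
next
  case False
  have "span N \<one> = carrier G" if N: "N \<in> \<P>" for N
    using character_exists[OF N subgroup_span(2,1)[OF sub[OF N] one_closed]] False by metis
  thus ?thesis using that one_closed by blast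
qed

text \<open>In a cyclic \<open>p\<close>-group the subgroup generated by an element is determined by an exponent, so
  that these subgroups form a chain.\<close>

lemma span_chain:
  assumes g: "g \<in> carrier G" "span N g = carrier G" and N: "N \<in> \<P>"
  obtains e :: "'a \<Rightarrow> nat"
  where "\<And>x y. x \<in> carrier G \<Longrightarrow> y \<in> carrier G \<Longrightarrow> e x \<le> e y \<Longrightarrow> y \<in> span N x"
proof -
  note Ns = sub[OF N]
  obtain n where n: "\<And>x. x \<in> carrier G \<Longrightarrow> x [^] int (p ^ n) \<in> N" using pow_p_mem[OF N] by blast
  let ?q = "int (p ^ n)"
  have "\<exists>i::int. \<exists>a::nat. x \<otimes> inv (g [^] i) \<in> N \<and> gcd i ?q = int (p ^ a)" if x: "x \<in> carrier G" for x
  proof -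
    obtain i :: int where i: "x \<otimes> inv (g [^] i) \<in> N" using x g by (auto simp: span_def)
    have "nat (gcd i ?q) dvd p ^ n"
      by (metis gcd_dvd2 gcd_ge_0_int int_dvd_int_iff nat_0_le)
    then obtain a where "nat (gcd i ?q) = p ^ a" using divides_primepow_nat[OF prime] by blast
    hence "gcd i ?q = int (p ^ a)" by (metis gcd_ge_0_int nat_0_le)
    thus ?thesis using i by blast
  qed
  then obtain i :: "'a \<Rightarrow> int" and e :: "'a \<Rightarrow> nat" where
    i: "\<And>x. x \<in> carrier G \<Longrightarrow> x \<otimes> inv (g [^] i x) \<in> N" and
    e: "\<And>x. x \<in> carrier G \<Longrightarrow> gcd (i x) ?q = int (p ^ e x)" by metis
  have "y \<in> span N x" if xy: "x \<in> carrier G" "y \<in> carrier G" "e x \<le> e y" for x y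
  proof -
    note S = subgroup_span[OF Ns xy(1)]
    have "int (p ^ e x) dvd int (p ^ e y)" using xy(3) by (simp add: le_imp_power_dvd)
    hence "gcd (i x) ?q dvd i y" using e xy by (metis dvd_trans gcd_dvd1)
    then obtain c where c: "i y = gcd (i x) ?q * c" by blast
    obtain u v where uv: "u * i x + v * ?q = gcd (i x) ?q" using bezout_int by blast
    have iy: "i y = i x * (u * c) + ?q * (v * c)" unfolding c uv[symmetric] by (simp add: algebra_simps)
    have gx: "g [^] i x \<in> span N x"
    proof -
      have "inv (x \<otimes> inv (g [^] i x)) \<otimes> x \<in> span N x"
        using i[OF xy(1)] S subgroup.m_closed[OF S(1)] subgroup.m_inv_closed[OF S(1)] by blast
      also have "inv (x \<otimes> inv (g [^] i x)) \<otimes> x = g [^] i x"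
        using xy(1) g(1) by (simp add: inv_mult_group m_assoc)
      finally show ?thesis .
    qed
    have "g [^] ?q \<in> span N x" using n[OF g(1)] S(2) by blast
    hence "(g [^] i x) [^] (u * c) \<otimes> (g [^] ?q) [^] (v * c) \<in> span N x"
      using gx subgroup_int_pow_closed[OF S(1)] subgroup.m_closed[OF S(1)] by blast
    also have "(g [^] i x) [^] (u * c) \<otimes> (g [^] ?q) [^] (v * c) = g [^] i y"
      using g(1) unfolding iy by (simp only: int_pow_pow int_pow_mult)
    finally have "(y \<otimes> inv (g [^] i y)) \<otimes> g [^] i y \<in> span N x"
      using i[OF xy(2)] S subgroup.m_closed[OF S(1)] by blast
    also have "(y \<otimes> inv (g [^] i y)) \<otimes> g [^] i y = y" using xy(2) g(1) by (simp add: m_assoc)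
    finally show ?thesis .
  qed
  thus ?thesis by (rule that)
qed

text \<open>Choose \<open>N\<^sub>0\<close> such that the image of \<open>H\<close> in \<open>G/N\<^sub>0\<close> is nontrivial, and \<open>h\<close> in \<open>H\<close> that generates
  this image. If \<open>y\<close> in \<open>H\<close> is not a power of \<open>h\<close> modulo a smaller kernel, then \<open>h\<close> is a power of \<open>y\<close>
  there, with an exponent divisible by \<open>p\<close>. Modulo \<open>N\<^sub>0\<close> also \<open>y\<close> is a power of \<open>h\<close>, so that \<open>h\<close> equals
  the power of itself by a multiple of \<open>p\<close>, which makes it trivial modulo \<open>N\<^sub>0\<close>.\<close>

lemma subgroup_monogenic:
  assumes g: "g \<in> carrier G" "\<And>N. N \<in> \<P> \<Longrightarrow> span N g = carrier G" and H: "subgroup H G"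
  obtains h where "h \<in> H" "\<And>N. N \<in> \<P> \<Longrightarrow> H \<subseteq> span N h"
proof (cases "H = {\<one>}")
  case True
  have "H \<subseteq> span N \<one>" if "N \<in> \<P>" for N
    using subgroup_span(3)[OF sub[OF that] one_closed] True by simp
  thus ?thesis using that[of \<one>] True by blast
next
  case False
  note HG = subgroup.mem_carrier[OF H]
  obtain z where z: "z \<in> H" "z \<noteq> \<one>" using False subgroup.one_closed[OF H] by blast
  then obtain N0 where N0: "N0 \<in> \<P>" "z \<notin> N0" using Inter_\<P>[OF HG[OF z(1)]] by blast
  obtain e :: "'a \<Rightarrow> nat" where e: "\<And>x y. x \<in> carrier G \<Longrightarrow> y \<in> carrier G \<Longrightarrow> e x \<le> e y \<Longrightarrow> y \<in> span N0 x"
    using span_chain[OF g(1) g(2)[OF N0(1)] N0(1)] by blast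
  obtain h where h: "h \<in> H" "\<And>y. y \<in> H \<Longrightarrow> e h \<le> e y"
    using ex_has_least_nat[of "\<lambda>x. x \<in> H" z e] z(1) by blast
  note hG = HG[OF h(1)]
  have H0: "H \<subseteq> span N0 h" using e[OF hG HG] h(2) by blast
  have h0: "h \<notin> N0"
    using span_subset[OF sub[OF N0(1)] order_refl, of h] H0 z(1) N0(2) by blast
  have "H \<subseteq> span N h" if N: "N \<in> \<P>" for N
  proof
    fix y assume y: "y \<in> H"
    note yG = HG[OF y]
    let ?N = "N \<inter> N0"
    have NP: "?N \<in> \<P>" by (rule Int[OF N N0(1)])
    note S = subgroup_span[OF sub[OF NP] hG]
    have "y \<in> span ?N h"
    proof (rule ccontr)
      assume ny: "y \<notin> span ?N h"
      obtain d :: "'a \<Rightarrow> nat" where d: "\<And>x y. x \<in> carrier G \<Longrightarrow> y \<in> carrier G \<Longrightarrow> d x \<le> d y \<Longrightarrow> y \<in> span ?N x"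
        using span_chain[OF g(1) g(2)[OF NP] NP] by blast
      have "\<not> d h \<le> d y" using d[OF hG yG] ny by blast
      hence "h \<in> span ?N y" using d[OF yG hG] by simp
      then obtain i :: int where i: "h \<otimes> inv (y [^] i) \<in> ?N" by (auto simp: span_def)
      obtain n where n: "\<And>x. x \<in> carrier G \<Longrightarrow> x [^] int (p ^ n) \<in> ?N" using pow_p_mem[OF NP] by blast
      have yi: "y [^] i \<in> span ?N h"
      proof -
        have "inv (h \<otimes> inv (y [^] i)) \<otimes> h \<in> span ?N h"
          using i S subgroup.m_closed[OF S(1)] subgroup.m_inv_closed[OF S(1)] by blast
        also have "inv (h \<otimes> inv (y [^] i)) \<otimes> h = y [^] i"
          using hG yG by (simp add: inv_mult_group m_assoc)
        finally show ?thesis .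
      qed
      have "int p dvd i"
      proof (rule ccontr)
        assume "\<not> int p dvd i"
        hence "coprime i (int (p ^ n))" using coprime_p_iff[of i] by (simp add: coprime_commute)
        moreover have "y [^] int (p ^ n) \<in> span ?N h" using n[OF yG] S(2) by blast
        ultimately show False using coprime_pow_mem[OF S(1) yG yi] ny by blast
      qed
      then obtain j where j: "i = int p * j" by blast
      obtain k :: int and m where k: "m \<in> N0" "y = m \<otimes> h [^] k" using H0 y spanE[OF _ hG] by blast
      note N0s = sub[OF N0(1)]
      have mG: "m \<in> carrier G" using subgroup.mem_carrier[OF N0s k(1)] .
      have "y [^] i = m [^] i \<otimes> h [^] (k * i)"
        unfolding k(2) using mG hG by (simp add: int_pow_distrib int_pow_pow)
      hence "h \<otimes> inv (m [^] i \<otimes> h [^] (k * i)) \<in> N0" using i by simp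
      hence "(h \<otimes> inv (m [^] i \<otimes> h [^] (k * i))) \<otimes> m [^] i \<in> N0"
        using subgroup_int_pow_closed[OF N0s k(1)] subgroup.m_closed[OF N0s] by blast
      also have "(h \<otimes> inv (m [^] i \<otimes> h [^] (k * i))) \<otimes> m [^] i = h \<otimes> inv (h [^] (k * i))"
        using mG hG by (simp add: inv_mult_group m_assoc)
      also have "\<dots> = h [^] (1 - int p * (j * k))"
        using hG by (simp add: int_pow_diff j mult_ac)
      finally have "h [^] (1 - int p * (j * k)) \<in> N0" .
      moreover have "h [^] int (p ^ n) \<in> N0" using n[OF hG] by blast
      ultimately show False using coprime_pow_mem[OF N0s hG] coprime_one_minus h0 by blast
    qed
    moreover have "span ?N h \<subseteq> span N h"
      using subgroup_span[OF sub[OF N] hG] by (intro span_subset) blast+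
    ultimately show "y \<in> span N h" by blast
  qed
  thus ?thesis using that h(1) by blast
qed

lemma rank_le_1:
  assumes triv: "\<And>R. exterior_relation R \<Longrightarrow> radical R = carrier G"
  shows "pro_rank G T \<le> 1"
  unfolding pro_rank_def
proof (rule SUP_least)
  fix H assume "H \<in> {H. subgroup H G \<and> closedin T H}"
  hence H: "subgroup H G" "closedin T H" by simp_all
  obtain g where g: "g \<in> carrier G" "\<And>N. N \<in> \<P> \<Longrightarrow> span N g = carrier G"
    using procyclic[OF triv] by blast
  obtain h where h: "h \<in> H" "\<And>N. N \<in> \<P> \<Longrightarrow> H \<subseteq> span N h"
    using subgroup_monogenic[OF g H(1)] by blast
  have hG: "h \<in> carrier G" using subgroup.mem_carrier[OF H(1) h(1)] .
  have "T closure_of generate G {h} = H"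
  proof
    have "generate G {h} \<subseteq> H" using generate_subgroup_incl[OF _ H(1)] h(1) by blast
    thus "T closure_of generate G {h} \<subseteq> H" using H(2) by (rule closure_of_minimal)
    show "H \<subseteq> T closure_of generate G {h}"
    proof
      fix y assume y: "y \<in> H"
      hence yG: "y \<in> carrier G" by (rule subgroup.mem_carrier[OF H(1)])
      have "\<exists>z. z \<in> generate G {h} \<and> z \<in> U" if U: "y \<in> U" "openin T U" for U
      proof -
        obtain N where N: "N \<in> \<P>" "N #> y \<subseteq> U" using open_basis[OF U(2,1)] by blast
        obtain k :: int and n where k: "n \<in> N" "y = n \<otimes> h [^] k"
          using h(2)[OF N(1)] y spanE[OF _ hG] by blast
        have "inv n \<otimes> y = h [^] k"
          unfolding k(2) using k(1) subgroup.mem_carrier[OF sub[OF N(1)]] hG by (simp add: mult_inv_cancel)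
        moreover have "inv n \<otimes> y \<in> N #> y"
          using subgroup.m_inv_closed[OF sub[OF N(1)] k(1)] by (auto simp: r_coset_def)
        ultimately have "h [^] k \<in> N #> y" by simp
        thus ?thesis using N(2) by (auto simp: generate_pow[OF hG])
      qed
      thus "y \<in> T closure_of generate G {h}" using yG by (auto simp: in_closure_of topspace)
    qed
  qed
  hence "{h} \<in> {S. S \<subseteq> H \<and> finite S \<and> top_generate G T S = H}" using h(1) by (simp add: top_generate_def)
  hence "top_gen_number G T H \<le> enat (card {h})"
    unfolding top_gen_number_def by (rule INF_lower)
  thus "top_gen_number G T H \<le> 1" by (simp add: one_enat_def)
qed

end

section \<open>The bounds for the exterior degree\<close>

theorem corollary3p10:
  fixes p :: nat and G :: "('a, 'm) monoid_scheme" and T :: "'a topology" and \<mu> :: "'a measure"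
  assumes "prime p"
    and "pro_p_group p G T"
    and "normalized_haar G T \<mu>"
  shows "(comm_group G \<and> pro_rank G T > 1 \<longrightarrow>
            ext_degree p G T \<mu> \<le> (real p ^ 2 + real p - 1) / real p ^ 3 \<and>
            (ext_degree p G T \<mu> = (real p ^ 2 + real p - 1) / real p ^ 3 \<longleftrightarrow>
               G Mod cext_center p G T \<cong> integer_mod_group p \<times>\<times> integer_mod_group p))
       \<and> (\<not> comm_group G \<and> cext_center p G T \<noteq> group_center G \<longrightarrow>
            ext_degree p G T \<mu> \<le> (real p ^ 3 + real p - 1) / real p ^ 4)"
proof -
  have "group G" using assms(2) by (simp add: pro_p_group_def topological_group_def)
  then interpret haar G T p \<mu>
    using assms by (simp add: haar_def haar_axioms_def pro_p_def pro_p_axioms_def)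
  have p: "real p > 1" by (rule p_gt_1)
  show ?thesis
  proof (intro conjI impI)
    assume "comm_group G \<and> pro_rank G T > 1"
    hence ab: "comm_group G" and rank: "\<not> pro_rank G T \<le> 1" by auto
    interpret abelian_haar G T p \<mu>
      using ab haar_axioms by (simp add: abelian_haar_def)
    obtain R where R: "exterior_relation R" "radical R \<noteq> carrier G"
      using rank rank_le_1 by blast
    have "ext_degree p G T \<mu> \<le> 1 / p + (1 - 1 / p) * (1 / p\<^sup>2)"
      using ext_degree_le[OF R(1) measure_radical[OF R]] by simp
    also have "\<dots> = (real p ^ 2 + real p - 1) / real p ^ 3"
      using p by (simp add: field_simps power2_eq_square power3_eq_cube)
    finally show "ext_degree p G T \<mu> \<le> (real p ^ 2 + real p - 1) / real p ^ 3" .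
    show "ext_degree p G T \<mu> = (real p ^ 2 + real p - 1) / real p ^ 3 \<longleftrightarrow>
        G Mod cext_center p G T \<cong> integer_mod_group p \<times>\<times> integer_mod_group p"
    proof
      assume "ext_degree p G T \<mu> = (real p ^ 2 + real p - 1) / real p ^ 3"
      then interpret minimal_index G T p \<mu> R by (rule ext_degree_bound_eq[OF R])
      show "G Mod cext_center p G T \<cong> integer_mod_group p \<times>\<times> integer_mod_group p"
        unfolding cext_center_eq radical_wedge_trivial_eq by (rule quotient_iso[OF ab])
    next
      assume "G Mod cext_center p G T \<cong> integer_mod_group p \<times>\<times> integer_mod_group p"
      then interpret minimal_index G T p \<mu> R
        unfolding cext_center_eq by (rule iso_minimal_index[OF R])
      show "ext_degree p G T \<mu> = (real p ^ 2 + real p - 1) / real p ^ 3" by (rule ext_degree_eq)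
    qed
  next
    assume "\<not> comm_group G \<and> cext_center p G T \<noteq> group_center G"
    then obtain R where R: "exterior_relation R" "measure \<mu> (radical R) \<le> 1 / real p ^ 3"
      using nonabelian_bound unfolding cext_center_eq by blast
    have "ext_degree p G T \<mu> \<le> 1 / p + (1 - 1 / p) * (1 / real p ^ 3)"
      using ext_degree_le[OF R] by simp
    also have "\<dots> = (real p ^ 3 + real p - 1) / real p ^ 4"
      using p by (simp add: field_simps power3_eq_cube power4_eq_xxxx)
    finally show "ext_degree p G T \<mu> \<le> (real p ^ 3 + real p - 1) / real p ^ 4" .
  qed
qed

end
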